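(* Let $\mathbf F_1$ satisfy the Host Assumption below, $\tau\geqslant0$, and let $f_0\in L^1_3(\mathbb R^3)$ be nonnegative. Then, for all $T>0$, there exists a unique solution $f\in\mathcal C([0,T];L^1_2)\cap L^\infty(0,T;L^1_3)$ of $\partial_tf=\tau\mathcal Q(f,f)+\mathcal L(f)$ with $f(\cdot,0)=f_0$.
   Context: Notation: $\langle v\rangle=\sqrt{1+|v|^2}$; $\|f\|_{L^p_\eta}=\left(\int_{\mathbb R^3}|f(v)|^p\langle v\rangle^{p\eta}\,dv\right)^{1/p}$; $H^k_\eta$ has norm $\|f\|_{H^k_\eta}^2=\sum_{|s|\leqslant k}\|\partial^s_vf\|^2_{L^2_\eta}$, extended to real $s\geqslant0$ by Fourier transform. Inelastic Boltzmann operator: fix $\epsilon\in(0,1)$, $\zeta=(1+\epsilon)/2$; for $q=v-w$, $\sigma\in\mathbb S^2$, $v'=v+\frac\zeta2(|q|\sigma-q)$, $w'=w-\frac\zeta2(|q|\sigma-q)$; $\mathcal Q$ is defined weakly by $\int\mathcal Q(f,f)\psi\,dv=\frac12\iint f(v)f(w)|q|\mathcal A_\zeta[\psi](v,w)\,dw\,dv$ with $\mathcal A_\zeta[\psi](v,w)=\frac1{4\pi}\int_{\mathbb S^2}(\psi(v')+\psi(w')-\psi(v)-\psi(w))\,d\sigma$. Linear scattering operator: host particle mass $m_1>0$ (granular particle mass $1$), $\alpha=m_1/(1+m_1)$, restitution $e\in(0,1)$, $\beta=(1-e)/2$, mean free path $\lambda>0$; $\mathcal L$ is defined weakly by $\int\mathcal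 L(f)\psi\,dv=\frac1\lambda\iint|q|f(v)\mathbf F_1(w)\mathcal J_e[\psi](v,w)\,dv\,dw$, $\mathcal J_e[\psi](v,w)=\frac1{2\pi}\int_{\mathbb S^2}|\hat q\cdot n|(\psi(v^\star)-\psi(v))\,dn$, $\hat q=q/|q|$, $v^\star=v-2\alpha(1-\beta)(q\cdot n)n$. Solutions are understood in the weak sense: for every regular test function $\psi$, $\frac{d}{dt}\int f(v,t)\psi(v)\,dv=\frac\tau2\iint f(v,t)f(w,t)|q|\mathcal A_\zeta[\psi](v,w)\,dw\,dv+\frac1\lambda\iint|q|f(v,t)\mathbf F_1(w)\mathcal J_e[\psi](v,w)\,dv\,dw$. Host Assumption: $\mathbf F_1\geqslant0$, $\int\mathbf F_1=1$, with bulk velocity $\mathbf u_1\in\mathbb R^3$ and temperature $\Theta_1>0$; $\mathbf F_1\in H^s_\delta(\mathbb R^3)$ for all $s,\delta\geqslant 0$; and $\int\mathbf F_1\log\mathbf F_1\,dv<\infty$. *)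

theory Defs
  imports "HOL-Analysis.Analysis"
begin

type_synonym vel = "real^3"

definition jbr :: "vel \<Rightarrow> real" where
  "jbr v = sqrt (1 + (norm v)^2)"

definition L1w :: "real \<Rightarrow> (vel \<Rightarrow> real) \<Rightarrow> bool" where
  "L1w eta f \<longleftrightarrow> f \<in> borel_measurable lborel
      \<and> integrable lborel (\<lambda>v. \<bar>f v\<bar> * jbr v powr eta)"

definition L1w_norm :: "real \<Rightarrow> (vel \<Rightarrow> real) \<Rightarrow> real" where
  "L1w_norm eta f = (\<integral>v. \<bar>f v\<bar> * jbr v powr eta \<partial>lborel)"

definition L2w :: "real \<Rightarrow> (vel \<Rightarrow> real) \<Rightarrow> bool" where
  "L2w eta f \<longleftrightarrow> f \<in> borel_measurable lborel
      \<and> integrable lborel (\<lambda>v. (f v)^2 * jbr v powr (2 * eta))"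

definition fourier3 :: "(vel \<Rightarrow> real) \<Rightarrow> vel \<Rightarrow> complex" where
  "fourier3 g xi = (\<integral>v. complex_of_real (g v) * cis (- (v \<bullet> xi)) \<partial>lborel)"

definition Hsw :: "real \<Rightarrow> real \<Rightarrow> (vel \<Rightarrow> real) \<Rightarrow> bool" where
  "Hsw s delta f \<longleftrightarrow> L2w delta f
      \<and> (\<forall>xi. integrable lborel (\<lambda>v. complex_of_real (f v * jbr v powr delta) * cis (- (v \<bullet> xi))))
      \<and> fourier3 (\<lambda>v. f v * jbr v powr delta) \<in> borel_measurable lborel
      \<and> integrable lborel (\<lambda>xi. jbr xi powr (2 * s) * (cmod (fourier3 (\<lambda>v. f v * jbr v powr delta) xi))^2)"

text \<open>Average over the unit sphere S^2 w.r.t. the normalised surface measure,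
  i.e. (1/(4 pi)) \<integral>_{S^2} g(sigma) d sigma.  The normalised surface measure is the
  image of the normalised Lebesgue measure on the unit ball under x \<mapsto> x/|x|.\<close>
definition sphere_avg :: "(vel \<Rightarrow> real) \<Rightarrow> real" where
  "sphere_avg g = (\<integral>x\<in>ball 0 1. g (x /\<^sub>R norm x) \<partial>lborel) / measure lborel (ball (0::vel) 1)"

definition vpost :: "real \<Rightarrow> vel \<Rightarrow> vel \<Rightarrow> vel \<Rightarrow> vel" where
  "vpost zeta v w \<sigma> = v + (zeta/2) *\<^sub>R (norm (v - w) *\<^sub>R \<sigma> - (v - w))"

definition wpost :: "real \<Rightarrow> vel \<Rightarrow> vel \<Rightarrow> vel \<Rightarrow> vel" where
  "wpost zeta v w \<sigma> = w - (zeta/2) *\<^sub>R (norm (v - w) *\<^sub>R \<sigma> - (v - w))"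

definition A_op :: "real \<Rightarrow> (vel \<Rightarrow> real) \<Rightarrow> vel \<Rightarrow> vel \<Rightarrow> real" where
  "A_op zeta \<psi> v w = sphere_avg (\<lambda>\<sigma>. \<psi> (vpost zeta v w \<sigma>) + \<psi> (wpost zeta v w \<sigma>) - \<psi> v - \<psi> w)"

definition vstar :: "real \<Rightarrow> real \<Rightarrow> vel \<Rightarrow> vel \<Rightarrow> vel \<Rightarrow> vel" where
  "vstar alpha beta v w n = v - (2 * alpha * (1 - beta) * ((v - w) \<bullet> n)) *\<^sub>R n"

text \<open>J_e[psi](v,w) = (1/(2 pi)) \<integral>_{S^2} |qhat.n| (psi(v*) - psi(v)) dn
  = 2 * (normalised sphere average), since |S^2| = 4 pi.
  Here alpha = m1/(1+m1), beta = (1-e)/2.\<close>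
definition J_op :: "real \<Rightarrow> real \<Rightarrow> (vel \<Rightarrow> real) \<Rightarrow> vel \<Rightarrow> vel \<Rightarrow> real" where
  "J_op m1 e \<psi> v w =
     (let alpha = m1 / (1 + m1); beta = (1 - e) / 2; qh = (v - w) /\<^sub>R norm (v - w) in
      2 * sphere_avg (\<lambda>n. \<bar>qh \<bullet> n\<bar> * (\<psi> (vstar alpha beta v w n) - \<psi> v)))"

definition test_fun :: "(vel \<Rightarrow> real) \<Rightarrow> bool" where
  "test_fun \<psi> \<longleftrightarrow> continuous_on UNIV \<psi> \<and> bounded {v. \<psi> v \<noteq> 0}"

definition weak_rhs :: "real \<Rightarrow> real \<Rightarrow> real \<Rightarrow> real \<Rightarrow> real \<Rightarrow> (vel \<Rightarrow> real)
     \<Rightarrow> (vel \<Rightarrow> real) \<Rightarrow> (vel \<Rightarrow> real) \<Rightarrow> real" where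
  "weak_rhs eps m1 e lam tau F1 g \<psi> =
     (let zeta = (1 + eps) / 2 in
      tau / 2 * (\<integral>v. (\<integral>w. g v * g w * norm (v - w) * A_op zeta \<psi> v w \<partial>lborel) \<partial>lborel)
      + 1 / lam * (\<integral>v. (\<integral>w. norm (v - w) * g v * F1 w * J_op m1 e \<psi> v w \<partial>lborel) \<partial>lborel))"

definition host_assumption :: "(vel \<Rightarrow> real) \<Rightarrow> bool" where
  "host_assumption F1 \<longleftrightarrow>
     (\<forall>v. 0 \<le> F1 v) \<and> F1 \<in> borel_measurable lborel \<and> integrable lborel F1
     \<and> (\<integral>v. F1 v \<partial>lborel) = 1
     \<and> (\<forall>s delta. 0 \<le> s \<longrightarrow> 0 \<le> delta \<longrightarrow> Hsw s delta F1)
     \<and> integrable lborel (\<lambda>v. F1 v * ln (F1 v))"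

definition weak_solution ::
  "real \<Rightarrow> real \<Rightarrow> real \<Rightarrow> real \<Rightarrow> real \<Rightarrow> (vel \<Rightarrow> real) \<Rightarrow> (vel \<Rightarrow> real)
     \<Rightarrow> real \<Rightarrow> (real \<Rightarrow> vel \<Rightarrow> real) \<Rightarrow> bool" where
  "weak_solution eps m1 e lam tau F1 f0 T f \<longleftrightarrow>
     (\<forall>t\<in>{0..T}. L1w 2 (f t))
     \<and> (\<forall>t\<in>{0..T}. ((\<lambda>s. L1w_norm 2 (\<lambda>v. f s v - f t v)) \<longlongrightarrow> 0) (at t within {0..T}))
     \<and> (\<exists>M. \<forall>t\<in>{0..T}. L1w 3 (f t) \<and> L1w_norm 3 (f t) \<le> M)
     \<and> (AE v in lborel. f 0 v = f0 v)
     \<and> (\<forall>\<psi>. test_fun \<psi> \<longrightarrow> (\<forall>t\<in>{0..T}.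
          ((\<lambda>s. \<integral>v. f s v * \<psi> v \<partial>lborel) has_real_derivative
             weak_rhs eps m1 e lam tau F1 (f t) \<psi>) (at t within {0..T})))"

end

(* Existence: with the collision kernel truncated to min |q| N the equation is f' = a (G(f,f) - f)
   for a bounded gain operator G, and it is solved explicitly by a Wild sum with all moments up to
   order 4. Energy dissipation gives bounds on the moments 2, 3, 4 that do not see the truncation,
   and pairing the difference of two solutions with sgn(h) (1 + |v|^2) shows that the solutions with
   truncated kernel and truncated datum form a Cauchy sequence in C([0,T]; L^1_2).
   Uniqueness: the same pairing with the weights (1 + |v|^2)^(p/2), p < 2, for which the equation may
   be tested because of continuity in L^1_(p+1), followed by p -> 2. Nonnegativity is needed for one
   of the two solutions only.
   No Jacobian is computed anywhere: for a fixed relative velocity and a fixed scattering parameter,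
   every post-collisional velocity is a translate of the pre-collisional one. *)

theory Submission
  imports Defs
begin

text \<open>The obstacle is the linear growth of the kernel: testing with a weight of order p costs
  moments of order p + 1, so plain Lipschitz bounds never close. Two cancellations help. In moment
  bounds the pure powers of gain and loss cancel, and the highest moment survives only linearly,
  next to a moment already controlled. In differences h of solutions the loss term has the sign of
  h; set against a gain with constant 2^(1 - p/2), it leaves the moment p + 1 of h only next to a
  lower norm of h or to the factor 2^(1 - p/2) - 1, which is 0 at p = 2. Uniqueness has to stay
  below 2, because a bound in weight 3 and continuity in weight 2 interpolate to continuity in
  weights less than 3. In existence the kernel error costs a fourth moment, which the datum need not
  have: damping it at height 2^j creates a fourth moment of order 2^j, the error contains its
  square, and truncation at N = 8^j leaves 4^j / 8^j = 2^(-j). The collision rate is made constant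
  by fictitious collisions that change no velocity, and the host term is made bilinear by a factor
  equal to the mass of the second argument divided by the conserved mass.\<close>

section \<open>The weight \<open>jbr\<close> and elementary inequalities for powers\<close>

lemma jbr_ge_1: "1 \<le> jbr v"
  by (simp add: jbr_def)

lemma jbr_pos [simp]: "0 < jbr v"
  using jbr_ge_1[of v] by linarith

lemma jbr_nonneg [simp]: "0 \<le> jbr v"
  using jbr_ge_1[of v] by linarith

lemma jbr_neq_0 [simp]: "jbr v \<noteq> 0"
  using jbr_pos[of v] by linarith

lemma jbr_sq: "(jbr v)\<^sup>2 = 1 + (norm v)\<^sup>2"
  by (simp add: jbr_def)

lemma norm_le_jbr: "norm v \<le> jbr v"
  unfolding jbr_def by (rule real_le_rsqrt) simp

lemma jbr_le_Suc_norm: "jbr v \<le> 1 + norm v"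
  unfolding jbr_def by (rule real_le_lsqrt) (auto simp: power2_eq_square algebra_simps)

lemma continuous_on_jbr: "continuous_on S jbr"
  unfolding jbr_def [abs_def] by (intro continuous_intros)

lemma jbr_measurable [measurable]: "jbr \<in> borel_measurable borel"
  using continuous_on_jbr by (rule borel_measurable_continuous_onI)

lemma jbr_powr_mono: "p \<le> r \<Longrightarrow> jbr v powr p \<le> jbr v powr r"
  by (rule powr_mono) (auto simp: jbr_ge_1)

lemma jbr_powr_ge_1: "0 \<le> p \<Longrightarrow> 1 \<le> jbr v powr p"
  by (rule ge_one_powr_ge_zero) (auto simp: jbr_ge_1)

lemma jbr_powr_numeral [simp]: "jbr v powr (numeral n) = jbr v ^ (numeral n)"
  by (simp add: powr_numeral)

text \<open>Products are preferred to sums because an integrand bounded by a function of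
  \<open>v\<close> times a function of \<open>w\<close> integrates to a product of weighted
  norms.\<close>

lemma sum_le_twice_prod:
  fixes a b :: real
  assumes "1 \<le> a" "1 \<le> b"
  shows "a + b \<le> 2 * (a * b)"
proof -
  have "a * 1 \<le> a * b" "1 * b \<le> a * b"
    using assms by (auto intro!: mult_mono)
  then show ?thesis by simp
qed

lemma norm_diff_le_jbr: "norm (v - w) \<le> jbr v + jbr w"
  using norm_triangle_ineq4[of v w] norm_le_jbr[of v] norm_le_jbr[of w] by linarith

lemma norm_diff_le_jbr_prod: "norm (v - w) \<le> 2 * (jbr v * jbr w)"
  using norm_diff_le_jbr[of v w] sum_le_twice_prod[OF jbr_ge_1 jbr_ge_1, of v w] by linarith

text \<open>8 is 1 + 3 + 4: the triangle inequality gives \<open>1 + 3 * jbr v + 4 * jbr w\<close>,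
  and each term is at most its coefficient times the product. The radius 3 is a common bound for all
  displacements that occur.\<close>

lemma jbr_shift_le:
  assumes "norm r \<le> 3 * norm (v - w)"
  shows "jbr (w + r) \<le> 8 * (jbr v * jbr w)"
proof -
  have "norm (w + r) \<le> norm w + 3 * (norm v + norm w)"
    using norm_triangle_ineq[of w r] norm_triangle_ineq4[of v w] assms by (smt (verit))
  then have "jbr (w + r) \<le> 1 + 3 * jbr v + 4 * jbr w"
    using jbr_le_Suc_norm[of "w + r"] norm_le_jbr[of v] norm_le_jbr[of w] by (smt (verit))
  moreover have "jbr v * 1 \<le> jbr v * jbr w" "1 * jbr w \<le> jbr v * jbr w"
    using jbr_ge_1[of v] jbr_ge_1[of w] by (auto intro!: mult_mono)
  ultimately show ?thesis using jbr_ge_1[of v] by (smt (verit))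
qed

text \<open>After division by \<open>(x + y) powr r\<close> the two quotients lie in the unit
  interval and add up to 1; a power \<open>r \<le> 1\<close> can only enlarge them.\<close>

lemma powr_add_le_add_powr:
  fixes x y r :: real
  assumes "0 \<le> x" "0 \<le> y" "0 \<le> r" "r \<le> 1"
  shows "(x + y) powr r \<le> x powr r + y powr r"
proof (cases "x = 0 \<or> y = 0")
  case False
  then have pos: "0 < x" "0 < y" "0 < x + y" using assms by auto
  have mono: "u / (x + y) \<le> (u / (x + y)) powr r" if "0 < u" "u \<le> x + y" for u
  proof -
    have "(u / (x + y)) powr 1 \<le> (u / (x + y)) powr r"
      using that assms pos by (intro powr_mono') auto
    then show ?thesis using that pos by simp
  qed
  have "1 = x / (x + y) + y / (x + y)"
    using pos by (simp add: add_divide_distrib [symmetric])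
  also have "\<dots> \<le> (x / (x + y)) powr r + (y / (x + y)) powr r"
    using mono[of x] mono[of y] pos by auto
  also have "\<dots> = (x powr r + y powr r) / (x + y) powr r"
    using pos by (simp add: powr_divide add_divide_distrib)
  finally show ?thesis using pos by (simp add: field_simps)
qed auto

text \<open>Concavity at the midpoint. With \<open>r = p / 2\<close> the constant becomes
  \<open>2 powr (1 - p / 2)\<close>, whose value 1 at \<open>p = 2\<close> is what the stability
  estimates live on.\<close>

lemma add_powr_le_powr_add:
  fixes x y r :: real
  assumes "0 < x" "0 < y" "0 \<le> r" "r \<le> 1"
  shows "x powr r + y powr r \<le> 2 powr (1 - r) * (x + y) powr r"
proof -
  define m where "m = (x + y) / 2"
  have m: "0 < m" using assms by (simp add: m_def)
  \<comment> \<open>Young's inequality with second factor 1 is the tangent line of the power at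
    \<open>m\<close>.\<close>
  have tangent: "(u / m) powr r \<le> 1 - r + r * (u / m)" if "0 < u" for u
    using Youngs_inequality_0[of r "1 - r" "u / m" 1] that m assms by simp
  have "(x / m) powr r + (y / m) powr r \<le> 2 - 2 * r + r * ((x + y) / m)"
    using tangent[OF assms(1)] tangent[OF assms(2)] by (simp add: add_divide_distrib algebra_simps)
  also have "(x + y) / m = 2" using m unfolding m_def by (simp add: divide_simps)
  finally have "(x powr r + y powr r) / m powr r \<le> 2"
    using assms m by (simp add: powr_divide add_divide_distrib)
  then have "x powr r + y powr r \<le> 2 * m powr r"
    using m by (simp add: field_simps)
  also have "\<dots> = 2 powr (1 - r) * (x + y) powr r"
    using assms by (simp add: m_def powr_divide powr_diff)
  finally show ?thesis .
qed

subsection \<open>Collision geometry\<close>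

text \<open>At the origin the convention \<open>inverse 0 = 0\<close> gives the value 0, so unit
  length fails there. The geometric estimates below use only \<open>norm_dir_le\<close> and thus
  hold for every parameter, without exceptional sets.\<close>

definition dir :: "vel \<Rightarrow> vel" where
  "dir x = x /\<^sub>R norm x"

lemma norm_dir_le: "norm (dir x) \<le> 1"
  by (cases "x = 0") (auto simp: dir_def)

lemma dir_measurable [measurable]: "dir \<in> borel_measurable borel"
  unfolding dir_def [abs_def] by measurable

text \<open>Every velocity produced by a collision of \<open>v\<close> and \<open>w\<close> has the form
  \<open>w + R (v - w) x\<close>, where \<open>x\<close> is a point of the unit ball whose direction is the scattering
  parameter. The five displacements \<open>R\<close> below give \<open>v'\<close>, \<open>w'\<close>, \<open>v\<^sup>\<star>\<close>, \<open>v\<close> and \<open>w\<close>.\<close>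

definition disp_v :: "real \<Rightarrow> vel \<Rightarrow> vel \<Rightarrow> vel" where
  "disp_v z q x = q + (z / 2) *\<^sub>R (norm q *\<^sub>R dir x - q)"

definition disp_w :: "real \<Rightarrow> vel \<Rightarrow> vel \<Rightarrow> vel" where
  "disp_w z q x = - ((z / 2) *\<^sub>R (norm q *\<^sub>R dir x - q))"

definition disp_star :: "real \<Rightarrow> vel \<Rightarrow> vel \<Rightarrow> vel" where
  "disp_star c q x = q - (c * (q \<bullet> dir x)) *\<^sub>R dir x"

definition disp_id :: "vel \<Rightarrow> vel \<Rightarrow> vel" where
  "disp_id q x = q"

definition disp_zero :: "vel \<Rightarrow> vel \<Rightarrow> vel" where
  "disp_zero q x = 0"

lemmas disp_defs = disp_v_def disp_w_def disp_star_def disp_id_def disp_zero_def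

lemma vpost_eq: "vpost z v w (dir x) = w + disp_v z (v - w) x"
  by (simp add: vpost_def disp_v_def)

lemma wpost_eq: "wpost z v w (dir x) = w + disp_w z (v - w) x"
  by (simp add: wpost_def disp_w_def)

lemma vstar_eq: "vstar a b v w (dir x) = w + disp_star (2 * a * (1 - b)) (v - w) x"
  by (simp add: vstar_def disp_star_def)

lemma norm_scatter_le:
  assumes "0 \<le> z" "z \<le> 1"
  shows "norm ((z / 2) *\<^sub>R (norm q *\<^sub>R dir x - q)) \<le> norm q"
proof -
  have "norm (norm q *\<^sub>R dir x - q) \<le> norm (norm q *\<^sub>R dir x) + norm q"
    by (rule norm_triangle_ineq4)
  also have "\<dots> \<le> norm q * 1 + norm q"
    using mult_left_mono[OF norm_dir_le[of x], of "norm q"] by simp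
  finally have 1: "norm (norm q *\<^sub>R dir x - q) \<le> 2 * norm q" by simp
  have "norm ((z / 2) *\<^sub>R (norm q *\<^sub>R dir x - q)) = z / 2 * norm (norm q *\<^sub>R dir x - q)"
    using assms by simp
  also have "\<dots> \<le> 1 / 2 * (2 * norm q)"
    by (rule mult_mono) (use assms 1 in auto)
  finally show ?thesis by simp
qed

lemma norm_disp_v_le: "0 \<le> z \<Longrightarrow> z \<le> 1 \<Longrightarrow> norm (disp_v z q x) \<le> 3 * norm q"
  unfolding disp_v_def
  using norm_scatter_le[of z q x] norm_triangle_ineq[of q "(z / 2) *\<^sub>R (norm q *\<^sub>R dir x - q)"]
  by (smt (verit) norm_ge_zero)

lemma norm_disp_w_le: "0 \<le> z \<Longrightarrow> z \<le> 1 \<Longrightarrow> norm (disp_w z q x) \<le> 3 * norm q"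
  unfolding disp_w_def norm_minus_cancel
  using norm_scatter_le[of z q x] by (smt (verit) norm_ge_zero)

lemma abs_inner_dir_le: "\<bar>q \<bullet> dir x\<bar> \<le> norm q"
  using Cauchy_Schwarz_ineq2[of q "dir x"] mult_left_mono[OF norm_dir_le[of x], of "norm q"]
  by simp

lemma norm_disp_star_le:
  assumes "0 \<le> c" "c \<le> 2"
  shows "norm (disp_star c q x) \<le> 3 * norm q"
proof -
  have "norm ((c * (q \<bullet> dir x)) *\<^sub>R dir x) = c * (\<bar>q \<bullet> dir x\<bar> * norm (dir x))"
    using assms by (simp add: abs_mult)
  also have "\<dots> \<le> 2 * (norm q * 1)"
    using assms abs_inner_dir_le norm_dir_le by (intro mult_mono) auto
  finally show ?thesis
    unfolding disp_star_def
    using norm_triangle_ineq4[of q "(c * (q \<bullet> dir x)) *\<^sub>R dir x"] by simp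
qed

lemma norm_disp_id_le: "norm (disp_id q x) \<le> 3 * norm q"
  by (simp add: disp_id_def)

lemma norm_disp_zero_le: "norm (disp_zero q x) \<le> 3 * norm q"
  by (simp add: disp_zero_def)

lemma disp_measurable [measurable]:
  "(\<lambda>(q, x). disp_v z q x) \<in> borel_measurable (borel \<Otimes>\<^sub>M borel)"
  "(\<lambda>(q, x). disp_w z q x) \<in> borel_measurable (borel \<Otimes>\<^sub>M borel)"
  "(\<lambda>(q, x). disp_star c q x) \<in> borel_measurable (borel \<Otimes>\<^sub>M borel)"
  "(\<lambda>(q, x). disp_id q x) \<in> borel_measurable (borel \<Otimes>\<^sub>M borel)"
  "(\<lambda>(q, x). disp_zero q x) \<in> borel_measurable (borel \<Otimes>\<^sub>M borel)"
  unfolding disp_defs by measurable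

text \<open>In the centre-of-mass frame the relative velocity becomes
  \<open>(1 - z) q + z \<bar>q\<bar> \<sigma>\<close>, which is not longer than \<open>q\<close>.\<close>

lemma energy_dissipation:
  assumes "0 \<le> z" "z \<le> 1"
  shows "(jbr (w + disp_v z (v - w) x))\<^sup>2 + (jbr (w + disp_w z (v - w) x))\<^sup>2 \<le> (jbr v)\<^sup>2 + (jbr w)\<^sup>2"
proof -
  define v' w' where "v' = w + disp_v z (v - w) x" and "w' = w + disp_w z (v - w) x"
  have par: "2 * ((norm a)\<^sup>2 + (norm b)\<^sup>2) = (norm (a + b))\<^sup>2 + (norm (a - b))\<^sup>2" for a b :: vel
    by (simp add: power2_norm_eq_inner inner_simps inner_commute)
  have sum: "v' + w' = v + w"
    by (simp add: v'_def w'_def disp_defs)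
  have diff: "v' - w' = (1 - z) *\<^sub>R (v - w) + (z * norm (v - w)) *\<^sub>R dir x"
  proof -
    have "v' - w' = (v - w) + ((z / 2) *\<^sub>R (norm (v - w) *\<^sub>R dir x - (v - w))
        + (z / 2) *\<^sub>R (norm (v - w) *\<^sub>R dir x - (v - w)))"
      by (simp add: v'_def w'_def disp_defs)
    also have "\<dots> = (v - w) + z *\<^sub>R (norm (v - w) *\<^sub>R dir x - (v - w))"
      by (simp flip: scaleR_left.add)
    finally show ?thesis by (simp add: algebra_simps)
  qed
  have "norm (v' - w') \<le> (1 - z) * norm (v - w) + z * norm (v - w) * norm (dir x)"
    unfolding diff using norm_triangle_ineq[of "(1 - z) *\<^sub>R (v - w)" "(z * norm (v - w)) *\<^sub>R dir x"] assms
    by simp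
  also have "\<dots> \<le> (1 - z) * norm (v - w) + z * norm (v - w) * 1"
    using assms norm_dir_le by (intro add_left_mono mult_left_mono) auto
  finally have "norm (v' - w') \<le> norm (v - w)" by (simp add: algebra_simps)
  then have "(norm (v' - w'))\<^sup>2 \<le> (norm (v - w))\<^sup>2" by (intro power_mono) auto
  then have "(norm v')\<^sup>2 + (norm w')\<^sup>2 \<le> (norm v)\<^sup>2 + (norm w)\<^sup>2"
    using par[of v' w'] par[of v w] unfolding sum by (smt (verit))
  then show ?thesis by (simp add: jbr_sq v'_def w'_def)
qed

text \<open>The energy gained by a particle scattered off a host particle is controlled by the
  energy of the host particle: the quadratic form in \<open>v \<bullet> n\<close>, \<open>w \<bullet> n\<close> is negative in its first
  variable because \<open>c < 2\<close>.\<close>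

lemma energy_star_le:
  assumes "0 < c" "c < 2"
  defines "K \<equiv> c * ((1 - c)\<^sup>2 / (2 - c) + c)"
  shows "(jbr (w + disp_star c (v - w) x))\<^sup>2 \<le> (jbr v)\<^sup>2 + K * (jbr w)\<^sup>2"
proof -
  define n where "n = dir x"
  define a b where "a = v \<bullet> n" and "b = w \<bullet> n"
  have K: "0 \<le> K" using assms by (auto simp: K_def)
  have eq: "w + disp_star c (v - w) x = v - (c * (a - b)) *\<^sub>R n"
    by (simp add: disp_star_def n_def a_def b_def inner_diff_left)
  have nn: "n \<bullet> n \<le> 1"
    using norm_dir_le[of x] by (simp add: n_def norm_eq_sqrt_inner)
  have "(norm (v - (c * (a - b)) *\<^sub>R n))\<^sup>2 = (norm v)\<^sup>2 - 2 * (c * (a - b)) * a + (c * (a - b))\<^sup>2 * (n \<bullet> n)"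
    unfolding power2_norm_eq_inner
    by (simp add: inner_simps a_def inner_commute power2_eq_square algebra_simps)
  also have "\<dots> \<le> (norm v)\<^sup>2 - 2 * (c * (a - b)) * a + (c * (a - b))\<^sup>2 * 1"
    using nn by (intro add_left_mono mult_left_mono) auto
  also have "\<dots> = (norm v)\<^sup>2 + c * (c * b\<^sup>2 + ((2 - 2 * c) * a * b - (2 - c) * a\<^sup>2))"
    by (simp add: power2_eq_square algebra_simps)
  also have "\<dots> \<le> (norm v)\<^sup>2 + c * (c * b\<^sup>2 + (1 - c)\<^sup>2 / (2 - c) * b\<^sup>2)"
  proof -
    have "0 \<le> ((1 - c) * b - (2 - c) * a)\<^sup>2 / (2 - c)" using assms by simp
    also have "\<dots> = (1 - c)\<^sup>2 / (2 - c) * b\<^sup>2 - ((2 - 2 * c) * a * b - (2 - c) * a\<^sup>2)"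
      using assms by (simp add: field_simps power2_eq_square)
    finally show ?thesis using assms by (intro add_left_mono mult_left_mono) auto
  qed
  also have "\<dots> = (norm v)\<^sup>2 + K * b\<^sup>2" by (simp add: K_def algebra_simps)
  also have "\<dots> \<le> (norm v)\<^sup>2 + K * (norm w)\<^sup>2"
  proof -
    have "\<bar>b\<bar> \<le> norm w" unfolding b_def n_def by (rule abs_inner_dir_le)
    then have "b\<^sup>2 \<le> (norm w)\<^sup>2" by (metis abs_ge_zero power2_abs power_mono)
    then show ?thesis using K by (intro add_left_mono mult_left_mono) auto
  qed
  finally show ?thesis
    unfolding eq jbr_sq using K by (simp add: algebra_simps)
qed

subsection \<open>The collision measure\<close>

text \<open>Scattering parameters are points of the ball; the image of this measure under
  \<open>dir\<close> is the normalised surface measure, in agreement with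
  \<open>sphere_avg\<close>.\<close>

definition sphU :: "vel measure" where
  "sphU = uniform_measure lborel (ball 0 1)"

lemma sets_sphU [measurable_cong, simp]: "sets sphU = sets borel"
  by (simp add: sphU_def)

lemma space_sphU [simp]: "space sphU = UNIV"
  by (simp add: sphU_def)

lemma emeasure_unit_ball:
  "emeasure lborel (ball (0::vel) 1) \<noteq> 0" "emeasure lborel (ball (0::vel) 1) \<noteq> \<infinity>"
  "0 < measure lborel (ball (0::vel) 1)"
proof -
  have "0 < measure lborel (ball (0::vel) 1)"
    using content_ball_pos[of 1 "0::vel"] by simp
  then show "emeasure lborel (ball (0::vel) 1) \<noteq> 0" "0 < measure lborel (ball (0::vel) 1)"
    by (auto simp: measure_def)
  show "emeasure lborel (ball (0::vel) 1) \<noteq> \<infinity>"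
    using emeasure_lborel_ball_finite[of "0::vel" 1] by simp
qed

lemma emeasure_sphU_UNIV: "emeasure sphU UNIV = 1"
  using emeasure_uniform_measure_1[of lborel "ball (0::vel) 1"] emeasure_unit_ball
  by (simp add: sphU_def)

interpretation sphU: finite_measure sphU
  by (rule finite_measureI) (simp add: emeasure_sphU_UNIV)

lemma measure_sphU_UNIV: "measure sphU UNIV = 1"
  by (simp add: measure_def emeasure_sphU_UNIV)

text \<open>\<open>uniform_measure\<close> carries a density that is a quotient in
  \<open>ennreal\<close>; rewritten as a real quotient it becomes accessible to
  \<open>integral_density\<close>.\<close>

lemma sphere_avg_eq:
  assumes "(\<lambda>x. g (dir x)) \<in> borel_measurable borel"
  shows "sphere_avg g = (\<integral>x. g (dir x) \<partial>sphU)"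
proof -
  let ?B = "ball (0::vel) 1"
  have "sphU = density lborel (\<lambda>x. ennreal (indicator ?B x / measure lborel ?B))"
    unfolding sphU_def uniform_measure_def
  proof (rule density_cong)
    show "AE x in lborel. indicator ?B x / emeasure lborel ?B = ennreal (indicator ?B x / measure lborel ?B)"
    proof (rule AE_I2)
      fix x :: vel
      have "indicator ?B x / emeasure lborel ?B = ennreal (indicator ?B x) / ennreal (measure lborel ?B)"
        using emeasure_unit_ball(2) by (simp add: emeasure_eq_ennreal_measure ennreal_indicator)
      also have "\<dots> = ennreal (indicator ?B x / measure lborel ?B)"
        using emeasure_unit_ball(3) by (intro divide_ennreal) auto
      finally show "indicator ?B x / emeasure lborel ?B = ennreal (indicator ?B x / measure lborel ?B)" .
    qed
  qed (intro measurable_compose[OF _ measurable_ennreal] borel_measurable_divide_ennreal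
      borel_measurable_divide borel_measurable_const borel_measurable_indicator; simp)+
  then have "(\<integral>x. g (dir x) \<partial>sphU) = (\<integral>x. g (dir x) \<partial>density lborel (\<lambda>x. ennreal (indicator ?B x / measure lborel ?B)))"
    by simp
  also have "\<dots> = (\<integral>x. (indicator ?B x / measure lborel ?B) *\<^sub>R g (dir x) \<partial>lborel)"
  proof (rule integral_density)
    show "(\<lambda>x. indicator ?B x / measure lborel ?B) \<in> borel_measurable lborel"
      by (intro borel_measurable_divide borel_measurable_const borel_measurable_indicator) auto
  qed (use assms emeasure_unit_ball in auto)
  also have "\<dots> = (\<integral>x. indicator ?B x *\<^sub>R g (dir x) \<partial>lborel) / measure lborel ?B"
    by simp
  finally show ?thesis
    by (simp add: sphere_avg_def set_lebesgue_integral_def dir_def)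
qed

interpretation lborel_sphU: pair_sigma_finite "lborel :: vel measure" sphU ..

interpretation sphU_lborel: pair_sigma_finite sphU "lborel :: vel measure" ..

text \<open>The components are the incoming velocities \<open>v\<close>, \<open>w\<close> and the
  scattering parameter. One product measure lets Fubini and dominated convergence act on all three
  variables at once.\<close>

definition colM :: "(vel \<times> vel \<times> vel) measure" where
  "colM = lborel \<Otimes>\<^sub>M (lborel \<Otimes>\<^sub>M sphU)"

interpretation colM: pair_sigma_finite "lborel :: vel measure" "(lborel :: vel measure) \<Otimes>\<^sub>M sphU" ..

lemma sets_colM [measurable_cong]: "sets colM = sets (borel \<Otimes>\<^sub>M (borel \<Otimes>\<^sub>M borel))"
  unfolding colM_def by (intro sets_pair_measure_cong) auto

lemma space_colM [simp]: "space colM = UNIV"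
  by (simp add: colM_def space_pair_measure)

lemma nn_integral_lborel_shift:
  fixes f :: "vel \<Rightarrow> ennreal"
  assumes [measurable]: "f \<in> borel_measurable borel"
  shows "(\<integral>\<^sup>+x. f (c + x) \<partial>lborel) = (\<integral>\<^sup>+x. f x \<partial>lborel)"
proof -
  have "(\<integral>\<^sup>+x. f x \<partial>lborel) = (\<integral>\<^sup>+x. f x \<partial>(distr lborel borel ((+) c)))"
    by (simp add: lborel_distr_plus)
  also have "\<dots> = (\<integral>\<^sup>+x. f (c + x) \<partial>lborel)"
    by (subst nn_integral_distr) auto
  finally show ?thesis by simp
qed

text \<open>For a fixed relative velocity \<open>q\<close> and scattering parameter \<open>x\<close> the map
  \<open>w \<mapsto> w + R q x\<close> is a translation, so passing to the variables \<open>(w + R q x, q, x)\<close>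
  has unit Jacobian, whatever \<open>R\<close> is.\<close>

lemma nn_integral_colM_shift:
  fixes H :: "vel \<times> vel \<times> vel \<Rightarrow> ennreal" and R :: "vel \<Rightarrow> vel \<Rightarrow> vel"
  assumes [measurable]: "H \<in> borel_measurable (borel \<Otimes>\<^sub>M (borel \<Otimes>\<^sub>M borel))"
    and [measurable]: "(\<lambda>(q, x). R q x) \<in> borel_measurable (borel \<Otimes>\<^sub>M borel)"
  shows "(\<integral>\<^sup>+z. H z \<partial>colM) =
    (\<integral>\<^sup>+y. (\<integral>\<^sup>+z. (case z of (q, x) \<Rightarrow> H (y - R q x + q, y - R q x, x)) \<partial>(lborel \<Otimes>\<^sub>M sphU)) \<partial>lborel)"
proof -
  have "(\<integral>\<^sup>+z. H z \<partial>colM) = (\<integral>\<^sup>+z. (\<integral>\<^sup>+v. H (v, z) \<partial>lborel) \<partial>(lborel \<Otimes>\<^sub>M sphU))"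
    unfolding colM_def by (subst colM.nn_integral_snd[symmetric]) auto
  also have "\<dots> = (\<integral>\<^sup>+z. (\<integral>\<^sup>+q. H (fst z + q, z) \<partial>lborel) \<partial>(lborel \<Otimes>\<^sub>M sphU))"
    by (intro nn_integral_cong nn_integral_lborel_shift[symmetric]) auto
  also have "\<dots> = (\<integral>\<^sup>+q. (\<integral>\<^sup>+z. H (fst z + q, z) \<partial>(lborel \<Otimes>\<^sub>M sphU)) \<partial>lborel)"
    by (rule colM.Fubini') auto
  also have "\<dots> = (\<integral>\<^sup>+q. (\<integral>\<^sup>+x. (\<integral>\<^sup>+w. H (w + q, w, x) \<partial>lborel) \<partial>sphU) \<partial>lborel)"
    by (intro nn_integral_cong, subst lborel_sphU.nn_integral_snd[symmetric]) auto
  also have "\<dots> = (\<integral>\<^sup>+q. (\<integral>\<^sup>+x. (\<integral>\<^sup>+w. H (- R q x + w + q, - R q x + w, x) \<partial>lborel) \<partial>sphU) \<partial>lborel)"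
    by (intro nn_integral_cong nn_integral_lborel_shift[symmetric]) auto
  also have "\<dots> = (\<integral>\<^sup>+z. (\<integral>\<^sup>+w. (case z of (q, x) \<Rightarrow> H (w - R q x + q, w - R q x, x)) \<partial>lborel) \<partial>(lborel \<Otimes>\<^sub>M sphU))"
    by (subst sphU.nn_integral_fst[symmetric]) (auto simp: algebra_simps)
  also have "\<dots> = (\<integral>\<^sup>+y. (\<integral>\<^sup>+z. (case z of (q, x) \<Rightarrow> H (y - R q x + q, y - R q x, x)) \<partial>(lborel \<Otimes>\<^sub>M sphU)) \<partial>lborel)"
    by (rule colM.Fubini') auto
  finally show ?thesis .
qed

text \<open>In the shifted variables the indicator of a null set \<open>N\<close> depends on
  \<open>y\<close> alone. The remaining variables have infinite mass, but for almost every
  \<open>y\<close> the integrand over them is identically 0.\<close>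

lemma AE_colM_shift:
  assumes R[measurable]: "(\<lambda>(q, x). R q x) \<in> borel_measurable (borel \<Otimes>\<^sub>M borel)"
    and P: "AE y in lborel. P y"
  shows "AE (v, w, x) in colM. P (w + R (v - w) x)"
proof -
  obtain N where N: "{y. \<not> P y} \<subseteq> N" "N \<in> sets borel" "emeasure lborel N = 0"
    using P by (auto elim!: AE_E)
  note [measurable] = N(2)
  have [measurable]: "(\<lambda>(v, w, x). w + R (v - w) x) \<in> borel_measurable (borel \<Otimes>\<^sub>M (borel \<Otimes>\<^sub>M borel))"
    by measurable
  have "(\<integral>\<^sup>+z. (case z of (v, w, x) \<Rightarrow> indicator N (w + R (v - w) x)) \<partial>colM) =
    (\<integral>\<^sup>+y. (\<integral>\<^sup>+z. (case z of (q, x) \<Rightarrow> indicator N y) \<partial>((lborel :: vel measure) \<Otimes>\<^sub>M sphU)) \<partial>lborel)"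
    by (subst nn_integral_colM_shift[OF _ R]) (auto intro!: nn_integral_cong)
  also have "\<dots> = (\<integral>\<^sup>+y. 0 \<partial>(lborel :: vel measure))"
  proof (rule nn_integral_cong_AE)
    show "AE y in lborel. (\<integral>\<^sup>+z. (case z of (q, x) \<Rightarrow> indicator N y) \<partial>((lborel :: vel measure) \<Otimes>\<^sub>M sphU)) = 0"
      using AE_not_in[of N lborel] N by (auto simp: null_sets_def case_prod_beta)
  qed
  finally have "(\<integral>\<^sup>+z. (case z of (v, w, x) \<Rightarrow> indicator N (w + R (v - w) x)) \<partial>colM) = 0"
    by simp
  then have "AE z in colM. (case z of (v, w, x) \<Rightarrow> indicator N (w + R (v - w) x)) = (0::ennreal)"
    by (subst (asm) nn_integral_0_iff_AE) auto
  then show ?thesis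
    by eventually_elim (use N(1) in \<open>auto simp: indicator_def split: if_splits\<close>)
qed

lemma integrable_integral_pair_mult:
  fixes F :: "'a \<Rightarrow> real" and G :: "'b \<Rightarrow> real"
  assumes "sigma_finite_measure M1" "sigma_finite_measure M2"
    and F: "integrable M1 F" and G: "integrable M2 G"
  shows "integrable (M1 \<Otimes>\<^sub>M M2) (\<lambda>(x, y). F x * G y)"
    and "(\<integral>z. (case z of (x, y) \<Rightarrow> F x * G y) \<partial>(M1 \<Otimes>\<^sub>M M2)) = (\<integral>x. F x \<partial>M1) * (\<integral>y. G y \<partial>M2)"
proof -
  interpret pair_sigma_finite M1 M2 using assms by (simp add: pair_sigma_finite_def)
  have [measurable]: "F \<in> borel_measurable M1" "G \<in> borel_measurable M2" using F G by auto
  show 1: "integrable (M1 \<Otimes>\<^sub>M M2) (\<lambda>(x, y). F x * G y)"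
    by (rule Fubini_integrable) (use F G in \<open>auto simp: abs_mult\<close>)
  show "(\<integral>z. (case z of (x, y) \<Rightarrow> F x * G y) \<partial>(M1 \<Otimes>\<^sub>M M2)) = (\<integral>x. F x \<partial>M1) * (\<integral>y. G y \<partial>M2)"
    using integral_fst'[OF 1] by simp
qed

text \<open>The scattering parameter has total mass 1 and drops out. All bounds on collision
  integrals come from tensor majorants of this kind.\<close>

lemma integrable_integral_colM_mult:
  fixes F G :: "vel \<Rightarrow> real"
  assumes F: "integrable lborel F" and G: "integrable lborel G"
  shows "integrable colM (\<lambda>(v, w, x). F v * G w)"
    and "(\<integral>z. (case z of (v, w, x) \<Rightarrow> F v * G w) \<partial>colM) = (\<integral>v. F v \<partial>lborel) * (\<integral>w. G w \<partial>lborel)"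
proof -
  have 1: "integrable (lborel \<Otimes>\<^sub>M sphU) (\<lambda>(w, x). G w)"
    "(\<integral>z. (case z of (w, x) \<Rightarrow> G w) \<partial>(lborel \<Otimes>\<^sub>M sphU)) = (\<integral>w. G w \<partial>lborel)"
    using integrable_integral_pair_mult[OF lborel.sigma_finite_measure_axioms sphU.sigma_finite_measure_axioms G,
      of "\<lambda>_. 1"] by (auto simp: measure_sphU_UNIV)
  show "integrable colM (\<lambda>(v, w, x). F v * G w)"
    "(\<integral>z. (case z of (v, w, x) \<Rightarrow> F v * G w) \<partial>colM) = (\<integral>v. F v \<partial>lborel) * (\<integral>w. G w \<partial>lborel)"
    using integrable_integral_pair_mult[OF lborel.sigma_finite_measure_axioms lborel_sphU.P.sigma_finite_measure_axioms F 1(1)] 1(2)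
    by (simp_all add: colM_def case_prod_beta')
qed

subsection \<open>Weighted spaces\<close>

lemma L1wD:
  assumes "L1w p f"
  shows "f \<in> borel_measurable borel" "integrable lborel (\<lambda>v. \<bar>f v\<bar> * jbr v powr p)"
  using assms by (auto simp: L1w_def)

lemma L1w_norm_nonneg: "0 \<le> L1w_norm p f"
  by (simp add: L1w_norm_def)

lemma integrable_bound_L1w:
  assumes "L1w p f" "\<psi> \<in> borel_measurable borel" "\<And>v. \<bar>\<psi> v\<bar> \<le> C * jbr v powr p"
  shows "integrable lborel (\<lambda>v. f v * \<psi> v)" "\<bar>\<integral>v. f v * \<psi> v \<partial>lborel\<bar> \<le> C * L1w_norm p f"
proof -
  note [measurable] = L1wD(1)[OF assms(1)] assms(2)
  have 1: "integrable lborel (\<lambda>v. C * (\<bar>f v\<bar> * jbr v powr p))"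
    using L1wD(2)[OF assms(1)] by simp
  have le: "\<bar>f v * \<psi> v\<bar> \<le> C * (\<bar>f v\<bar> * jbr v powr p)" for v
    using mult_left_mono[OF assms(3)[of v], of "\<bar>f v\<bar>"] by (simp add: abs_mult algebra_simps)
  show int: "integrable lborel (\<lambda>v. f v * \<psi> v)"
    by (rule Bochner_Integration.integrable_bound[OF 1]) (use le in \<open>auto intro!: order_trans[OF _ abs_ge_self]\<close>)
  have "\<bar>\<integral>v. f v * \<psi> v \<partial>lborel\<bar> \<le> (\<integral>v. \<bar>f v * \<psi> v\<bar> \<partial>lborel)"
    by (rule integral_abs_bound)
  also have "\<dots> \<le> (\<integral>v. C * (\<bar>f v\<bar> * jbr v powr p) \<partial>lborel)"
    by (rule integral_mono) (use int 1 le in \<open>auto intro!: integrable_abs\<close>)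
  finally show "\<bar>\<integral>v. f v * \<psi> v \<partial>lborel\<bar> \<le> C * L1w_norm p f"
    by (simp add: L1w_norm_def)
qed

lemma L1w_mono:
  assumes "L1w p f" "r \<le> p"
  shows "L1w r f" "L1w_norm r f \<le> L1w_norm p f"
proof -
  note [measurable] = L1wD(1)[OF assms(1)]
  have le: "\<bar>f v\<bar> * jbr v powr r \<le> \<bar>f v\<bar> * jbr v powr p" for v
    by (intro mult_left_mono jbr_powr_mono assms) auto
  have "integrable lborel (\<lambda>v. \<bar>f v\<bar> * jbr v powr r)"
    by (rule Bochner_Integration.integrable_bound[OF L1wD(2)[OF assms(1)]]) (use le in auto)
  then show "L1w r f" by (simp add: L1w_def)
  then show "L1w_norm r f \<le> L1w_norm p f"
    unfolding L1w_norm_def by (intro integral_mono) (use le assms in \<open>auto simp: L1w_def\<close>)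
qed

lemma L1w_add:
  assumes "L1w p f" "L1w p g"
  shows "L1w p (\<lambda>v. f v + g v)" "L1w_norm p (\<lambda>v. f v + g v) \<le> L1w_norm p f + L1w_norm p g"
proof -
  note [measurable] = L1wD(1)[OF assms(1)] L1wD(1)[OF assms(2)]
  have int: "integrable lborel (\<lambda>v. \<bar>f v\<bar> * jbr v powr p + \<bar>g v\<bar> * jbr v powr p)"
    using assms by (auto simp: L1w_def)
  have le: "\<bar>f v + g v\<bar> * jbr v powr p \<le> \<bar>f v\<bar> * jbr v powr p + \<bar>g v\<bar> * jbr v powr p" for v
    by (metis abs_triangle_ineq distrib_right mult_right_mono powr_ge_zero)
  have "integrable lborel (\<lambda>v. \<bar>f v + g v\<bar> * jbr v powr p)"
    by (rule Bochner_Integration.integrable_bound[OF int]) (use le in auto)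
  then show "L1w p (\<lambda>v. f v + g v)" by (simp add: L1w_def)
  then have "L1w_norm p (\<lambda>v. f v + g v) \<le> (\<integral>v. \<bar>f v\<bar> * jbr v powr p + \<bar>g v\<bar> * jbr v powr p \<partial>lborel)"
    unfolding L1w_norm_def by (intro integral_mono) (use le int in \<open>auto simp: L1w_def\<close>)
  then show "L1w_norm p (\<lambda>v. f v + g v) \<le> L1w_norm p f + L1w_norm p g"
    using assms by (simp add: L1w_norm_def L1w_def)
qed

lemma L1w_cmult:
  assumes "L1w p f"
  shows "L1w p (\<lambda>v. c * f v)" "L1w_norm p (\<lambda>v. c * f v) = \<bar>c\<bar> * L1w_norm p f"
  using assms by (auto simp: L1w_def L1w_norm_def abs_mult mult.assoc)

lemma L1w_diff:
  assumes "L1w p f" "L1w p g"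
  shows "L1w p (\<lambda>v. f v - g v)" "L1w_norm p (\<lambda>v. f v - g v) \<le> L1w_norm p f + L1w_norm p g"
  using L1w_add[OF assms(1) L1w_cmult(1)[OF assms(2), of "-1"]] L1w_cmult(2)[OF assms(2), of "-1"] by auto

lemma L1w_zero [simp]: "L1w p (\<lambda>v. 0)" "L1w_norm p (\<lambda>v. 0) = 0"
  by (auto simp: L1w_def L1w_norm_def)

lemma L1w_norm_minus_commute: "L1w_norm p (\<lambda>v. f v - g v) = L1w_norm p (\<lambda>v. g v - f v)"
  by (simp add: L1w_norm_def abs_minus_commute)

lemma L1w_norm_triangle:
  assumes "L1w p f" "L1w p g" "L1w p h"
  shows "L1w_norm p (\<lambda>v. f v - h v) \<le> L1w_norm p (\<lambda>v. f v - g v) + L1w_norm p (\<lambda>v. g v - h v)"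
  using L1w_add(2)[OF L1w_diff(1)[OF assms(1,2)] L1w_diff(1)[OF assms(2,3)]] by simp

subsection \<open>Collision integrals\<close>

text \<open>A list of pairs \<open>(k, R)\<close> encodes the observable change \<open>\<Sum> k (v - w) x \<psi> (w + R (v - w) x)\<close>,
  with positive weights for post-collisional and negative ones for pre-collisional velocities.\<close>

type_synonym coll = "((vel \<Rightarrow> vel \<Rightarrow> real) \<times> (vel \<Rightarrow> vel \<Rightarrow> vel)) list"

definition dev :: "coll \<Rightarrow> (vel \<Rightarrow> real) \<Rightarrow> vel \<Rightarrow> vel \<Rightarrow> vel \<Rightarrow> real" where
  "dev ts \<psi> v w x = (\<Sum>(k, R)\<leftarrow>ts. k (v - w) x * \<psi> (w + R (v - w) x))"

definition coll_wf :: "real \<Rightarrow> coll \<Rightarrow> bool" where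
  "coll_wf K ts \<longleftrightarrow> (\<forall>(k, R) \<in> set ts.
     (\<lambda>(q, x). k q x) \<in> borel_measurable (borel \<Otimes>\<^sub>M borel) \<and>
     (\<lambda>(q, x). R q x) \<in> borel_measurable (borel \<Otimes>\<^sub>M borel) \<and>
     (\<forall>q x. \<bar>k q x\<bar> \<le> K) \<and> (\<forall>q x. norm (R q x) \<le> 3 * norm q))"

definition cint :: "(vel \<Rightarrow> real) \<Rightarrow> coll \<Rightarrow> (vel \<Rightarrow> real) \<Rightarrow> (vel \<Rightarrow> real) \<Rightarrow> (vel \<Rightarrow> real) \<Rightarrow> real" where
  "cint b ts f g \<psi> = (\<integral>z. (case z of (v, w, x) \<Rightarrow> f v * g w * b (v - w) * dev ts \<psi> v w x) \<partial>colM)"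

text \<open>The product form makes majorants factor. The exponent \<open>r\<close> counts the
  weights that the kernel costs in each variable: 1 for the full kernel, 0 for a truncated one, 2
  for the error of a truncation.\<close>

definition kernel_bound :: "real \<Rightarrow> real \<Rightarrow> (vel \<Rightarrow> real) \<Rightarrow> bool" where
  "kernel_bound C r b \<longleftrightarrow> b \<in> borel_measurable borel \<and> (\<forall>v w. \<bar>b (v - w)\<bar> \<le> C * (jbr v * jbr w) powr r)"

lemma dev_Nil [simp]: "dev [] \<psi> v w x = 0"
  by (simp add: dev_def)

lemma dev_Cons [simp]: "dev ((k, R) # ts) \<psi> v w x = k (v - w) x * \<psi> (w + R (v - w) x) + dev ts \<psi> v w x"
  by (simp add: dev_def)

lemma coll_wf_Nil [simp]: "coll_wf K []"
  by (simp add: coll_wf_def)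

lemma coll_wf_Cons:
  "coll_wf K ((k, R) # ts) \<longleftrightarrow>
     (\<lambda>(q, x). k q x) \<in> borel_measurable (borel \<Otimes>\<^sub>M borel) \<and>
     (\<lambda>(q, x). R q x) \<in> borel_measurable (borel \<Otimes>\<^sub>M borel) \<and>
     (\<forall>q x. \<bar>k q x\<bar> \<le> K) \<and> (\<forall>q x. norm (R q x) \<le> 3 * norm q) \<and> coll_wf K ts"
  by (auto simp: coll_wf_def)

text \<open>Lets the method \<open>measurable\<close> compose curried functions of three arguments
  whose joint measurability is known.\<close>

lemma measurable_triple:
  assumes "(\<lambda>(v, w, x). F v w x) \<in> borel_measurable (borel \<Otimes>\<^sub>M (borel \<Otimes>\<^sub>M borel))"
    and [measurable]: "f1 \<in> borel_measurable M" "f2 \<in> borel_measurable M" "f3 \<in> borel_measurable M"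
  shows "(\<lambda>z. F (f1 z) (f2 z) (f3 z)) \<in> borel_measurable M"
proof -
  have "(\<lambda>z. (f1 z, f2 z, f3 z)) \<in> M \<rightarrow>\<^sub>M (borel \<Otimes>\<^sub>M (borel \<Otimes>\<^sub>M borel))" by measurable
  from measurable_compose[OF this assms(1)] show ?thesis by simp
qed

lemma dev_measurable:
  assumes "coll_wf K ts" and [measurable]: "\<psi> \<in> borel_measurable borel"
  shows "(\<lambda>(v, w, x). dev ts \<psi> v w x) \<in> borel_measurable (borel \<Otimes>\<^sub>M (borel \<Otimes>\<^sub>M borel))"
  using assms(1)
proof (induction ts)
  case Nil
  have "dev [] \<psi> = (\<lambda>_ _ _. 0)" by (intro ext) simp
  then show ?case by simp
next
  case (Cons t ts)
  obtain k R where t: "t = (k, R)" by fastforce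
  with Cons have dev: "(\<lambda>(v, w, x). dev ts \<psi> v w x) \<in> borel_measurable (borel \<Otimes>\<^sub>M (borel \<Otimes>\<^sub>M borel))"
    and [measurable]: "(\<lambda>(q, x). k q x) \<in> borel_measurable (borel \<Otimes>\<^sub>M borel)"
    "(\<lambda>(q, x). R q x) \<in> borel_measurable (borel \<Otimes>\<^sub>M borel)"
    by (auto simp: coll_wf_Cons)
  note [measurable (raw)] = measurable_triple[OF dev]
  show ?case unfolding t dev_Cons by measurable
qed

lemma dev_linear:
  "dev ts (\<lambda>v. a * \<psi> v + c * \<phi> v) v w x = a * dev ts \<psi> v w x + c * dev ts \<phi> v w x"
  by (induction ts) (auto simp: algebra_simps)

lemma dev_bound:
  assumes "coll_wf K ts" "0 \<le> p" "0 \<le> C" "\<And>v. \<bar>\<psi> v\<bar> \<le> C * jbr v powr p"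
  shows "\<bar>dev ts \<psi> v w x\<bar> \<le> real (length ts) * (K * (C * 8 powr p)) * (jbr v * jbr w) powr p"
  using assms(1)
proof (induction ts)
  case (Cons t ts)
  obtain k R where t: "t = (k, R)" by fastforce
  with Cons.prems have k: "\<bar>k (v - w) x\<bar> \<le> K" "norm (R (v - w) x) \<le> 3 * norm (v - w)" "coll_wf K ts"
    by (auto simp: coll_wf_Cons)
  have "\<bar>\<psi> (w + R (v - w) x)\<bar> \<le> C * jbr (w + R (v - w) x) powr p" by (rule assms)
  also have "\<dots> \<le> C * (8 * (jbr v * jbr w)) powr p"
    using jbr_shift_le[OF k(2)] assms by (intro mult_left_mono powr_mono2) auto
  also have "\<dots> = (C * 8 powr p) * (jbr v * jbr w) powr p"
    by (simp add: powr_mult)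
  finally have "\<bar>k (v - w) x * \<psi> (w + R (v - w) x)\<bar> \<le> K * ((C * 8 powr p) * (jbr v * jbr w) powr p)"
    unfolding abs_mult by (intro mult_mono k) (use k in auto)
  then show ?case using Cons.IH[OF k(3)] by (simp add: t algebra_simps)
qed simp

lemma cint_integrand_bound:
  assumes "coll_wf K ts" "0 \<le> p" "0 \<le> C" "\<And>v. \<bar>\<psi> v\<bar> \<le> C * jbr v powr p" "kernel_bound B r b"
  shows "\<bar>f v * g w * b (v - w) * dev ts \<psi> v w x\<bar> \<le>
    B * (real (length ts) * (K * (C * 8 powr p))) * ((\<bar>f v\<bar> * jbr v powr (p + r)) * (\<bar>g w\<bar> * jbr w powr (p + r)))"
proof -
  let ?D = "real (length ts) * (K * (C * 8 powr p))"
  have b: "\<bar>b (v - w)\<bar> \<le> B * (jbr v * jbr w) powr r"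
    using assms(5) by (auto simp: kernel_bound_def)
  have d: "\<bar>dev ts \<psi> v w x\<bar> \<le> ?D * (jbr v * jbr w) powr p"
    by (rule dev_bound) (use assms in auto)
  have "\<bar>b (v - w)\<bar> * \<bar>dev ts \<psi> v w x\<bar> \<le> (B * (jbr v * jbr w) powr r) * (?D * (jbr v * jbr w) powr p)"
    by (rule mult_mono[OF b d]) (use order_trans[OF abs_ge_zero b] in auto)
  also have "\<dots> = B * ?D * (jbr v powr (p + r) * jbr w powr (p + r))"
    by (simp add: powr_mult powr_add)
  finally have "(\<bar>f v\<bar> * \<bar>g w\<bar>) * (\<bar>b (v - w)\<bar> * \<bar>dev ts \<psi> v w x\<bar>)
    \<le> (\<bar>f v\<bar> * \<bar>g w\<bar>) * (B * ?D * (jbr v powr (p + r) * jbr w powr (p + r)))"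
    by (rule mult_left_mono) auto
  then show ?thesis by (simp add: abs_mult mult_ac)
qed

lemma cint_integrand_measurable:
  assumes "coll_wf K ts" and [measurable]: "\<psi> \<in> borel_measurable borel" "f \<in> borel_measurable borel"
    "g \<in> borel_measurable borel" and "kernel_bound B r b"
  shows "(\<lambda>(v, w, x). f v * g w * b (v - w) * dev ts \<psi> v w x) \<in> borel_measurable colM"
proof -
  have [measurable]: "b \<in> borel_measurable borel" using assms by (simp add: kernel_bound_def)
  note [measurable (raw)] = measurable_triple[OF dev_measurable[OF assms(1,2)]]
  show ?thesis by measurable
qed

text \<open>A post-collisional weight of order \<open>p\<close> is at most a constant times the
  product of the incoming weights, so observable and kernel together cost \<open>p + r\<close>
  weights in each factor.\<close>

lemma cint_integrable:
  assumes "coll_wf K ts" "0 \<le> p" "\<psi> \<in> borel_measurable borel" "\<And>v. \<bar>\<psi> v\<bar> \<le> C * jbr v powr p"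
    and "kernel_bound B r b" "L1w (p + r) f" "L1w (p + r) g"
  shows "integrable colM (\<lambda>(v, w, x). f v * g w * b (v - w) * dev ts \<psi> v w x)"
    and "\<bar>cint b ts f g \<psi>\<bar> \<le> B * (real (length ts) * (K * (C * 8 powr p))) * (L1w_norm (p + r) f * L1w_norm (p + r) g)"
proof -
  \<comment> \<open>One point suffices: the weight is positive and the left-hand side
    nonnegative.\<close>
  have C: "0 \<le> C" using assms(4)[of 0] by (smt (verit) mult_neg_pos jbr_pos powr_gt_zero)
  let ?D = "B * (real (length ts) * (K * (C * 8 powr p)))"
  let ?G = "\<lambda>(v, w, x). ?D * ((\<bar>f v\<bar> * jbr v powr (p + r)) * (\<bar>g w\<bar> * jbr w powr (p + r)))"
  note fg = integrable_integral_colM_mult[OF L1wD(2)[OF assms(6)] L1wD(2)[OF assms(7)]]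
  have G: "integrable colM ?G" "integral\<^sup>L colM ?G = ?D * (L1w_norm (p + r) f * L1w_norm (p + r) g)"
    using integrable_mult_right[OF fg(1), of ?D] fg(2)
    by (simp_all add: case_prod_beta' L1w_norm_def)
  have le: "\<bar>case z of (v, w, x) \<Rightarrow> f v * g w * b (v - w) * dev ts \<psi> v w x\<bar> \<le> ?G z" for z
    using cint_integrand_bound[OF assms(1,2) C assms(4,5)] by (auto split: prod.split)
  show int: "integrable colM (\<lambda>(v, w, x). f v * g w * b (v - w) * dev ts \<psi> v w x)"
  proof (rule Bochner_Integration.integrable_bound[OF G(1)])
    show "(\<lambda>(v, w, x). f v * g w * b (v - w) * dev ts \<psi> v w x) \<in> borel_measurable colM"
      using cint_integrand_measurable[OF assms(1,3) L1wD(1)[OF assms(6)] L1wD(1)[OF assms(7)] assms(5)] .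
    show "AE z in colM. norm (case z of (v, w, x) \<Rightarrow> f v * g w * b (v - w) * dev ts \<psi> v w x) \<le> norm (?G z)"
      by (rule AE_I2) (use le in \<open>auto intro: order_trans[OF _ abs_ge_self]\<close>)
  qed
  have "\<bar>cint b ts f g \<psi>\<bar> \<le> (\<integral>z. \<bar>case z of (v, w, x) \<Rightarrow> f v * g w * b (v - w) * dev ts \<psi> v w x\<bar> \<partial>colM)"
    unfolding cint_def by (rule integral_abs_bound)
  also have "\<dots> \<le> integral\<^sup>L colM ?G"
    by (rule integral_mono) (use int G le in \<open>auto intro!: integrable_abs\<close>)
  finally show "\<bar>cint b ts f g \<psi>\<bar> \<le> ?D * (L1w_norm (p + r) f * L1w_norm (p + r) g)"
    using G(2) by simp
qed

text \<open>Almost everywhere convergence of observables suffices because null sets pull back to null sets.\<close>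

lemma cint_tendsto:
  assumes "coll_wf K ts" "0 \<le> p" "0 \<le> C"
    and \<psi>: "\<psi> \<in> borel_measurable borel" "\<And>v. \<bar>\<psi> v\<bar> \<le> C * jbr v powr p"
    and \<psi>n: "\<And>n. \<psi>n n \<in> borel_measurable borel" "\<And>n v. \<bar>\<psi>n n v\<bar> \<le> C * jbr v powr p"
    and lim: "AE v in lborel. (\<lambda>n. \<psi>n n v) \<longlonglongrightarrow> \<psi> v"
    and b: "kernel_bound B r b" and f: "L1w (p + r) f" and g: "L1w (p + r) g"
  shows "(\<lambda>n. cint b ts f g (\<psi>n n)) \<longlonglongrightarrow> cint b ts f g \<psi>"
proof -
  have dev: "AE (v, w, x) in colM. (\<lambda>n. dev ts (\<psi>n n) v w x) \<longlonglongrightarrow> dev ts \<psi> v w x"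
    using assms(1)
  proof (induction ts)
    case (Cons t ts)
    obtain k R where t: "t = (k, R)" by fastforce
    with Cons have IH: "AE (v, w, x) in colM. (\<lambda>n. dev ts (\<psi>n n) v w x) \<longlonglongrightarrow> dev ts \<psi> v w x"
      and R: "(\<lambda>(q, x). R q x) \<in> borel_measurable (borel \<Otimes>\<^sub>M borel)"
      by (auto simp: coll_wf_Cons)
    show ?case
      using IH AE_colM_shift[OF R lim]
      by eventually_elim (auto simp: t intro!: tendsto_intros)
  qed simp
  let ?D = "B * (real (length ts) * (K * (C * 8 powr p)))"
  let ?G = "\<lambda>(v, w, x). ?D * ((\<bar>f v\<bar> * jbr v powr (p + r)) * (\<bar>g w\<bar> * jbr w powr (p + r)))"
  have G: "integrable colM ?G"
    using integrable_mult_right[OF integrable_integral_colM_mult(1)[OF L1wD(2)[OF f] L1wD(2)[OF g]], of ?D]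
    by (simp add: case_prod_beta')
  note m = cint_integrand_measurable[OF assms(1) _ L1wD(1)[OF f] L1wD(1)[OF g] b]
  show ?thesis
    unfolding cint_def
  proof (rule integral_dominated_convergence[OF m[OF \<psi>(1)] m[OF \<psi>n(1)] G])
    show "AE z in colM. (\<lambda>n. case z of (v, w, x) \<Rightarrow> f v * g w * b (v - w) * dev ts (\<psi>n n) v w x)
        \<longlonglongrightarrow> (case z of (v, w, x) \<Rightarrow> f v * g w * b (v - w) * dev ts \<psi> v w x)"
      using dev by eventually_elim (auto intro!: tendsto_intros)
    show "AE z in colM. norm (case z of (v, w, x) \<Rightarrow> f v * g w * b (v - w) * dev ts (\<psi>n n) v w x) \<le> ?G z" for n
      by (rule AE_I2) (auto intro!: cint_integrand_bound[OF assms(1-3) \<psi>n(2) b])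
  qed
qed

text \<open>Fubini in the inner pair is available only for almost every \<open>v\<close>; the
  comparison of the outer integrals therefore needs both inner integrals to be measurable in
  \<open>v\<close>.\<close>

lemma cint_iterated:
  assumes int: "integrable colM (\<lambda>(v, w, x). f v * g w * b (v - w) * dev ts \<psi> v w x)"
  shows "cint b ts f g \<psi> = (\<integral>v. (\<integral>w. f v * g w * b (v - w) * (\<integral>x. dev ts \<psi> v w x \<partial>sphU) \<partial>lborel) \<partial>lborel)"
proof -
  let ?F = "\<lambda>v w x. f v * g w * b (v - w) * dev ts \<psi> v w x"
  have int': "integrable (lborel \<Otimes>\<^sub>M (lborel \<Otimes>\<^sub>M sphU)) (\<lambda>(v, w, x). ?F v w x)"
    using int by (simp add: colM_def)
  have "cint b ts f g \<psi> = (\<integral>v. (\<integral>z. (case z of (w, x) \<Rightarrow> ?F v w x) \<partial>(lborel \<Otimes>\<^sub>M sphU)) \<partial>lborel)"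
    unfolding cint_def colM_def using colM.integral_fst'[OF int'] by (simp add: case_prod_beta')
  also have "\<dots> = (\<integral>v. (\<integral>w. (\<integral>x. ?F v w x \<partial>sphU) \<partial>lborel) \<partial>lborel)"
  proof (rule Bochner_Integration.integral_cong_AE)
    show "AE v in lborel. (\<integral>z. (case z of (w, x) \<Rightarrow> ?F v w x) \<partial>(lborel \<Otimes>\<^sub>M sphU)) = (\<integral>w. (\<integral>x. ?F v w x \<partial>sphU) \<partial>lborel)"
      using colM.AE_integrable_fst'[OF int']
    proof eventually_elim
      case (elim v)
      then have "integrable (lborel \<Otimes>\<^sub>M sphU) (\<lambda>(w, x). ?F v w x)" by (simp add: case_prod_beta')
      from lborel_sphU.integral_fst'[OF this] show ?case by simp
    qed
    show m: "(\<lambda>v. \<integral>z. (case z of (w, x) \<Rightarrow> ?F v w x) \<partial>(lborel \<Otimes>\<^sub>M sphU)) \<in> borel_measurable lborel"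
      using borel_measurable_integrable[OF colM.integrable_fst'[OF int']] by (simp add: case_prod_beta')
    show "(\<lambda>v. \<integral>w. (\<integral>x. ?F v w x \<partial>sphU) \<partial>lborel) \<in> borel_measurable lborel"
    proof -
      have "(\<lambda>p. (fst (fst p), snd (fst p), snd p)) \<in> ((lborel \<Otimes>\<^sub>M lborel) \<Otimes>\<^sub>M sphU) \<rightarrow>\<^sub>M (lborel \<Otimes>\<^sub>M (lborel \<Otimes>\<^sub>M sphU))"
        by measurable
      from measurable_compose[OF this borel_measurable_integrable[OF int']]
      have "(\<lambda>p. case p of ((v, w), x) \<Rightarrow> ?F v w x) \<in> borel_measurable ((lborel \<Otimes>\<^sub>M lborel) \<Otimes>\<^sub>M sphU)"
        by (simp add: case_prod_beta')
      then have "(\<lambda>p. \<integral>x. (case p of (v, w) \<Rightarrow> ?F v w x) \<partial>sphU) \<in> borel_measurable (lborel \<Otimes>\<^sub>M lborel)"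
        by (intro sphU.borel_measurable_lebesgue_integral) (simp add: case_prod_beta')
      then have "(\<lambda>(v, w). \<integral>x. ?F v w x \<partial>sphU) \<in> borel_measurable (lborel \<Otimes>\<^sub>M lborel)"
        by (simp add: case_prod_beta')
      then show ?thesis
        by (rule lborel.borel_measurable_lebesgue_integral)
    qed
  qed
  also have "\<dots> = (\<integral>v. (\<integral>w. f v * g w * b (v - w) * (\<integral>x. dev ts \<psi> v w x \<partial>sphU) \<partial>lborel) \<partial>lborel)"
    by simp
  finally show ?thesis .
qed

lemma cint_diff_left:
  assumes "coll_wf K ts" "0 \<le> p" "\<psi> \<in> borel_measurable borel" "\<And>v. \<bar>\<psi> v\<bar> \<le> C * jbr v powr p"
    and "kernel_bound B r b" "L1w (p + r) f1" "L1w (p + r) f2" "L1w (p + r) g"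
  shows "cint b ts (\<lambda>v. f1 v - f2 v) g \<psi> = cint b ts f1 g \<psi> - cint b ts f2 g \<psi>"
  unfolding cint_def
  by (subst Bochner_Integration.integral_diff[symmetric, OF cint_integrable(1)[OF assms(1-6,8)] cint_integrable(1)[OF assms(1-5,7,8)]])
    (auto intro!: Bochner_Integration.integral_cong simp: algebra_simps)

lemma cint_diff_right:
  assumes "coll_wf K ts" "0 \<le> p" "\<psi> \<in> borel_measurable borel" "\<And>v. \<bar>\<psi> v\<bar> \<le> C * jbr v powr p"
    and "kernel_bound B r b" "L1w (p + r) f" "L1w (p + r) g1" "L1w (p + r) g2"
  shows "cint b ts f (\<lambda>v. g1 v - g2 v) \<psi> = cint b ts f g1 \<psi> - cint b ts f g2 \<psi>"
  unfolding cint_def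
  by (subst Bochner_Integration.integral_diff[symmetric, OF cint_integrable(1)[OF assms(1-7)] cint_integrable(1)[OF assms(1-6,8)]])
    (auto intro!: Bochner_Integration.integral_cong simp: algebra_simps)

lemma cint_add_left:
  assumes "coll_wf K ts" "0 \<le> p" "\<psi> \<in> borel_measurable borel" "\<And>v. \<bar>\<psi> v\<bar> \<le> C * jbr v powr p"
    and "kernel_bound B r b" "L1w (p + r) f1" "L1w (p + r) f2" "L1w (p + r) g"
  shows "cint b ts (\<lambda>v. f1 v + f2 v) g \<psi> = cint b ts f1 g \<psi> + cint b ts f2 g \<psi>"
  unfolding cint_def
  by (subst Bochner_Integration.integral_add[symmetric, OF cint_integrable(1)[OF assms(1-6,8)] cint_integrable(1)[OF assms(1-5,7,8)]])
    (auto intro!: Bochner_Integration.integral_cong simp: algebra_simps)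

lemma cint_add_right:
  assumes "coll_wf K ts" "0 \<le> p" "\<psi> \<in> borel_measurable borel" "\<And>v. \<bar>\<psi> v\<bar> \<le> C * jbr v powr p"
    and "kernel_bound B r b" "L1w (p + r) f" "L1w (p + r) g1" "L1w (p + r) g2"
  shows "cint b ts f (\<lambda>v. g1 v + g2 v) \<psi> = cint b ts f g1 \<psi> + cint b ts f g2 \<psi>"
  unfolding cint_def
  by (subst Bochner_Integration.integral_add[symmetric, OF cint_integrable(1)[OF assms(1-7)] cint_integrable(1)[OF assms(1-6,8)]])
    (auto intro!: Bochner_Integration.integral_cong simp: algebra_simps)

lemma cint_diff_kernel:
  assumes "coll_wf K ts" "0 \<le> p" "\<psi> \<in> borel_measurable borel" "\<And>v. \<bar>\<psi> v\<bar> \<le> C * jbr v powr p"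
    and "kernel_bound B1 r b1" "kernel_bound B2 r b2" "L1w (p + r) f" "L1w (p + r) g"
  shows "cint (\<lambda>q. b1 q - b2 q) ts f g \<psi> = cint b1 ts f g \<psi> - cint b2 ts f g \<psi>"
  unfolding cint_def
  by (subst Bochner_Integration.integral_diff[symmetric, OF cint_integrable(1)[OF assms(1-5,7,8)] cint_integrable(1)[OF assms(1-4,6-8)]])
    (auto intro!: Bochner_Integration.integral_cong simp: algebra_simps)

lemma cint_linear_test:
  assumes "coll_wf K ts" "0 \<le> p" "\<psi>1 \<in> borel_measurable borel" "\<And>v. \<bar>\<psi>1 v\<bar> \<le> C1 * jbr v powr p"
    "\<psi>2 \<in> borel_measurable borel" "\<And>v. \<bar>\<psi>2 v\<bar> \<le> C2 * jbr v powr p"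
    and "kernel_bound B r b" "L1w (p + r) f" "L1w (p + r) g"
  shows "cint b ts f g (\<lambda>v. a1 * \<psi>1 v + a2 * \<psi>2 v) = a1 * cint b ts f g \<psi>1 + a2 * cint b ts f g \<psi>2"
proof -
  note 1 = integrable_mult_right[OF cint_integrable(1)[OF assms(1-4,7-9)], of a1]
  note 2 = integrable_mult_right[OF cint_integrable(1)[OF assms(1,2,5-9)], of a2]
  show ?thesis
    unfolding cint_def integral_mult_right_zero[symmetric]
    by (subst Bochner_Integration.integral_add[symmetric, OF 1 2])
      (auto intro!: Bochner_Integration.integral_cong simp: dev_linear algebra_simps)
qed

text \<open>One-sided, because dissipation and the sign of the loss term give upper bounds only.
  Finitely many tensor terms suffice throughout, and \<open>n = 0\<close> expresses a nonpositive
  integrand.\<close>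

lemma cint_le:
  assumes int: "integrable colM (\<lambda>(v, w, x). f v * g w * b (v - w) * dev ts \<psi> v w x)"
    and FG: "\<And>i. i < n \<Longrightarrow> integrable lborel (F i)" "\<And>i. i < n \<Longrightarrow> integrable lborel (G i)"
    and le: "\<And>v w x. f v * g w * b (v - w) * dev ts \<psi> v w x \<le> (\<Sum>i<n. F i v * G i w)"
  shows "cint b ts f g \<psi> \<le> (\<Sum>i<(n::nat). (\<integral>v. F i v \<partial>lborel) * (\<integral>w. G i w \<partial>lborel))"
proof -
  note FG' = integrable_integral_colM_mult[OF FG]
  have "cint b ts f g \<psi> \<le> (\<integral>z. (\<Sum>i<n. case z of (v, w, x) \<Rightarrow> F i v * G i w) \<partial>colM)"
    unfolding cint_def
    by (rule integral_mono[OF int]) (use FG'(1) le in \<open>auto intro!: Bochner_Integration.integrable_sum\<close>)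
  also have "\<dots> = (\<Sum>i<n. \<integral>z. (case z of (v, w, x) \<Rightarrow> F i v * G i w) \<partial>colM)"
    by (rule Bochner_Integration.integral_sum) (use FG'(1) in auto)
  also have "\<dots> = (\<Sum>i<n. (\<integral>v. F i v \<partial>lborel) * (\<integral>w. G i w \<partial>lborel))"
    by (intro sum.cong refl FG'(2)) auto
  finally show ?thesis .
qed

subsection \<open>A Gronwall lemma for left Dini derivatives\<close>

text \<open>Norms of differences need not be differentiable in time; freezing the sign at the later
  time \<open>t\<close> controls the increments ending at \<open>t\<close>, which is why the
  hypothesis looks to the left. The proof excludes a first contact with a strict
  supersolution.\<close>

lemma dini_gronwall:
  fixes N :: "real \<Rightarrow> real"
  assumes cont: "continuous_on {0..T} N" and AB: "0 \<le> A" "0 \<le> B"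
    and dini: "\<And>t e. 0 < t \<Longrightarrow> t \<le> T \<Longrightarrow> 0 < e \<Longrightarrow>
      \<exists>d>0. \<forall>s. 0 \<le> s \<longrightarrow> s < t \<longrightarrow> t - s < d \<longrightarrow> N t - N s \<le> (t - s) * (A * N t + B + e)"
    and t: "0 \<le> t" "t \<le> T"
  shows "N t \<le> exp (A * t) * (N 0 + B * t)"
proof -
  have strict: "N t < exp (A * t) * (N 0 + e + (B + 2 * e) * t)" if e: "0 < e" and t: "t \<in> {0..T}" for e t
  proof (rule ccontr)
    \<comment> \<open>The summand \<open>e\<close> lifts the curve strictly above \<open>N\<close>
      at time 0. Of the \<open>2 * e\<close> in the slope one half pays for the error in
      \<open>dini\<close>, the other for the difference quotient of \<open>y\<close>.\<close>
    define y where "y t = exp (A * t) * (N 0 + e + (B + 2 * e) * t)" for t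
    assume "\<not> N t < exp (A * t) * (N 0 + e + (B + 2 * e) * t)"
    then have ge: "y t \<le> N t" by (simp add: y_def)
    have ycont: "continuous_on {0..T} y" unfolding y_def by (intro continuous_intros)
    define S where "S = {t \<in> {0..T}. y t \<le> N t}"
    have "compact S"
    proof -
      have "closed S" unfolding S_def
        by (rule continuous_on_closed_Collect_le[OF ycont cont]) auto
      moreover have "bounded S" by (rule bounded_subset[of "{0..T}"]) (auto simp: S_def)
      ultimately show ?thesis by (simp add: compact_eq_bounded_closed)
    qed
    moreover have "S \<noteq> {}" using ge t by (auto simp: S_def)
    ultimately obtain t0 where t0: "t0 \<in> S" "\<And>s. s \<in> S \<Longrightarrow> t0 \<le> s"
      using compact_attains_inf by metis
    have "t0 \<noteq> 0" using t0(1) e by (auto simp: S_def y_def)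
    then have t0': "0 < t0" "t0 \<le> T" "y t0 \<le> N t0" using t0(1) by (auto simp: S_def)
    have less: "N s < y s" if "0 \<le> s" "s < t0" for s
    proof -
      have "s \<notin> S" using t0(2)[of s] that by auto
      then show ?thesis using that t0' by (auto simp: S_def)
    qed
    \<comment> \<open>The inequality before the first contact passes to the limit, so the contact is
      an equality.\<close>
    have eq: "N t0 = y t0"
    proof (rule antisym[OF _ t0'(3)])
      have "continuous_on {0..t0} (\<lambda>s. y s - N s)"
        using cont ycont t0' by (intro continuous_on_diff) (auto intro: continuous_on_subset)
      then have "((\<lambda>s. y s - N s) \<longlongrightarrow> y t0 - N t0) (at t0 within {0..t0})"
        using t0' by (auto simp: continuous_on_def)
      then have "((\<lambda>s. y s - N s) \<longlongrightarrow> y t0 - N t0) (at_left t0)"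
        using t0' by (simp add: at_within_Icc_at_left)
      moreover have "eventually (\<lambda>s. 0 \<le> y s - N s) (at_left t0)"
        unfolding eventually_at_left_field using less t0'
        by (intro exI[of _ 0]) (auto intro: less_imp_le)
      moreover have "at_left t0 \<noteq> bot" by (rule trivial_limit_at_left_real)
      ultimately have "0 \<le> y t0 - N t0" by (rule tendsto_lowerbound)
      then show "N t0 \<le> y t0" by simp
    qed
    obtain d where d: "0 < d" "\<And>s. 0 \<le> s \<Longrightarrow> s < t0 \<Longrightarrow> t0 - s < d \<Longrightarrow> N t0 - N s \<le> (t0 - s) * (A * N t0 + B + e)"
      using dini[OF t0'(1,2) e] by blast
    define D where "D = A * y t0 + exp (A * t0) * (B + 2 * e)"
    have "(y has_real_derivative D) (at t0)"
      unfolding y_def D_def by (auto intro!: derivative_eq_intros simp: algebra_simps)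
    then have "((\<lambda>s. (y s - y t0) / (s - t0)) \<longlongrightarrow> D) (at t0)"
      by (simp add: has_field_derivative_iff)
    then have "eventually (\<lambda>s. (y s - y t0) / (s - t0) > D - e) (at t0)"
      by (rule order_tendstoD) (use e in auto)
    then obtain d' where d': "0 < d'" "\<And>s. s \<noteq> t0 \<Longrightarrow> dist s t0 < d' \<Longrightarrow> (y s - y t0) / (s - t0) > D - e"
      by (auto simp: eventually_at)
    define s where "s = t0 - min (min d d') t0 / 2"
    have s: "0 \<le> s" "s < t0" "t0 - s < d" "t0 - s < d'"
      using d(1) d'(1) t0'(1) by (auto simp: s_def min_def)
    have "(y s - y t0) / (s - t0) > D - e"
      using s by (intro d') (auto simp: dist_real_def)
    then have "y t0 - y s > (t0 - s) * (D - e)"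
      using s by (simp add: field_simps)
    moreover have "N t0 - N s \<le> (t0 - s) * (A * N t0 + B + e)" by (rule d) (use s in auto)
    moreover have "(t0 - s) * (A * N t0 + B + e) \<le> (t0 - s) * (D - e)"
    proof (rule mult_left_mono)
      \<comment> \<open>Since the exponential is at least 1, the slope of \<open>y\<close> beats
        that of \<open>N\<close> at \<open>t0\<close>; going back in time \<open>N\<close> would lie
        above \<open>y\<close>.\<close>
      have "1 * (B + 2 * e) \<le> exp (A * t0) * (B + 2 * e)"
        by (rule mult_right_mono) (use AB e t0' in auto)
      then show "A * N t0 + B + e \<le> D - e" by (simp add: D_def eq)
    qed (use s in auto)
    ultimately show False using less[of s] s eq by linarith
  qed
  have "((\<lambda>e. exp (A * t) * (N 0 + e + (B + 2 * e) * t)) \<longlongrightarrow> exp (A * t) * (N 0 + 0 + (B + 2 * 0) * t)) (at_right 0)"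
    by (intro tendsto_intros)
  moreover have "eventually (\<lambda>e. N t \<le> exp (A * t) * (N 0 + e + (B + 2 * e) * t)) (at_right 0)"
    unfolding eventually_at_right_field using strict[of _ t] t
    by (intro exI[of _ 1]) (auto intro: less_imp_le)
  ultimately have "N t \<le> exp (A * t) * (N 0 + 0 + (B + 2 * 0) * t)"
    by (intro tendsto_lowerbound[where F = "at_right 0"]) auto
  then show ?thesis by simp
qed

lemma has_real_derivative_left_upper:
  assumes "(u has_real_derivative D) (at t within {0..T})" "0 \<le> t" "t \<le> T" "0 < e"
  shows "\<exists>d>0. \<forall>s. 0 \<le> s \<longrightarrow> s < t \<longrightarrow> t - s < d \<longrightarrow> u t - u s \<le> (t - s) * (D + e)"
proof -
  have "((\<lambda>s. (u s - u t) / (s - t)) \<longlongrightarrow> D) (at t within {0..T})"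
    using assms by (simp add: has_field_derivative_iff)
  then have "eventually (\<lambda>s. (u s - u t) / (s - t) < D + e) (at t within {0..T})"
    by (rule order_tendstoD) (use assms in auto)
  then obtain d where d: "0 < d" "\<And>s. s \<in> {0..T} \<Longrightarrow> s \<noteq> t \<Longrightarrow> dist s t < d \<Longrightarrow> (u s - u t) / (s - t) < D + e"
    by (auto simp: eventually_at)
  have "u t - u s \<le> (t - s) * (D + e)" if s: "0 \<le> s" "s < t" "t - s < d" for s
  proof -
    have "(u s - u t) / (s - t) < D + e" using s assms by (intro d) (auto simp: dist_real_def)
    then show ?thesis using s by (simp add: field_simps)
  qed
  with d(1) show ?thesis by blast
qed

section \<open>Admissible kernels and the parameters of the equation\<close>

text \<open>Contains the full kernel and all its truncations, so that constants derived from it do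
  not depend on the truncation level.\<close>

definition admissible :: "(vel \<Rightarrow> real) \<Rightarrow> bool" where
  "admissible b \<longleftrightarrow> b \<in> borel_measurable borel \<and> (\<forall>q. 0 \<le> b q \<and> b q \<le> norm q)"

lemma admissible_bounds: "admissible b \<Longrightarrow> 0 \<le> b q" "admissible b \<Longrightarrow> b q \<le> norm q"
  by (auto simp: admissible_def)

lemma admissible_le: "admissible b \<Longrightarrow> b (v - w) \<le> jbr v + jbr w"
  "admissible b \<Longrightarrow> b (v - w) \<le> 2 * (jbr v * jbr w)"
  using admissible_bounds(2)[of b "v - w"] norm_diff_le_jbr[of v w] norm_diff_le_jbr_prod[of v w] by linarith+

lemma admissible_kernel_bound: "admissible b \<Longrightarrow> kernel_bound 2 1 b"
  using admissible_le(2) admissible_bounds(1) by (auto simp: kernel_bound_def admissible_def)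

lemma admissible_norm: "admissible norm"
  by (auto simp: admissible_def)

lemma admissible_min: "0 \<le> N \<Longrightarrow> admissible (\<lambda>q. min (norm q) N)"
  by (auto simp: admissible_def)

lemma kernel_bound_min: "0 \<le> N \<Longrightarrow> kernel_bound N 0 (\<lambda>q. min (norm q) N)"
  by (auto simp: kernel_bound_def)

text \<open>The loss term of \<open>g + f\<close>, for \<open>f \<ge> 0\<close> and \<open>g\<close> of arbitrary sign, has the wrong sign only
  where \<open>\<bar>g + f\<bar> \<le> \<bar>g - f\<bar>\<close>; this is why uniqueness holds among signed solutions.\<close>

lemma loss_term_le:
  fixes f g :: real
  assumes "0 \<le> f"
  shows "- (g + f) \<le> - \<bar>g + f\<bar> + 2 * \<bar>g - f\<bar>"
  using assms by (auto simp: abs_if)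

text \<open>\<open>c\<close> stands for \<open>2 * alpha * (1 - beta)\<close> in the host collision
  rule. Five host moments are what an observable of order 4 costs against a kernel of linear
  growth.\<close>

locale granular =
  fixes zeta c tau lam :: real and F1 :: "vel \<Rightarrow> real"
  assumes zeta: "0 \<le> zeta" "zeta \<le> 1" and c: "0 < c" "c < 2"
    and tau: "0 \<le> tau" and lam: "0 < lam"
    and F1_nonneg: "\<And>v. 0 \<le> F1 v" and F1_L1w: "L1w 5 F1" and F1_mass: "(\<integral>v. F1 v \<partial>lborel) = 1"
begin

text \<open>The factor 2 converts the prefactor 1 / (2 pi) of the host collision average into a
  normalised average over the sphere.\<close>

definition wt :: "vel \<Rightarrow> vel \<Rightarrow> real" where
  "wt q x = 2 * \<bar>(q /\<^sub>R norm q) \<bullet> dir x\<bar>"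

definition tsQ :: coll where
  "tsQ = [(\<lambda>_ _. 1, disp_v zeta), (\<lambda>_ _. 1, disp_w zeta), (\<lambda>_ _. -1, disp_id), (\<lambda>_ _. -1, disp_zero)]"

definition tsL :: coll where
  "tsL = [(wt, disp_star c), (\<lambda>q x. - wt q x, disp_id)]"

text \<open>The right-hand side of the weak equation with collision kernel \<open>b\<close>; the
  original equation is the case \<open>b = norm\<close>, by \<open>weak_form_eq_W\<close>.\<close>

definition W :: "(vel \<Rightarrow> real) \<Rightarrow> (vel \<Rightarrow> real) \<Rightarrow> (vel \<Rightarrow> real) \<Rightarrow> real" where
  "W b f \<psi> = tau / 2 * cint b tsQ f f \<psi> + 1 / lam * cint b tsL f F1 \<psi>"

lemma wt_bounds: "0 \<le> wt q x" "wt q x \<le> 2"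
proof -
  have "\<bar>(q /\<^sub>R norm q) \<bullet> dir x\<bar> \<le> norm (q /\<^sub>R norm q)" by (rule abs_inner_dir_le)
  also have "\<dots> \<le> 1" by (cases "q = 0") auto
  finally show "0 \<le> wt q x" "wt q x \<le> 2" by (auto simp: wt_def)
qed

lemma wt_measurable [measurable]: "(\<lambda>(q, x). wt q x) \<in> borel_measurable (borel \<Otimes>\<^sub>M borel)"
  unfolding wt_def by measurable

lemma coll_wf_tsQ: "coll_wf 2 tsQ"
  unfolding tsQ_def
  by (simp add: coll_wf_Cons norm_disp_v_le norm_disp_w_le norm_disp_id_le norm_disp_zero_le zeta disp_measurable)

lemma coll_wf_tsL: "coll_wf 2 tsL"
proof -
  have "(\<lambda>(q, x). - wt q x) \<in> borel_measurable (borel \<Otimes>\<^sub>M borel)" by measurable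
  moreover have "\<bar>wt q x\<bar> \<le> 2" for q x using wt_bounds[of q x] by linarith
  ultimately show ?thesis
    unfolding tsL_def using c wt_measurable
    by (simp add: coll_wf_Cons norm_disp_star_le norm_disp_id_le disp_measurable)
qed

lemma length_ts: "length tsQ = 4" "length tsL = 2"
  by (simp_all add: tsQ_def tsL_def)

lemma dev_tsQ: "dev tsQ \<psi> v w x = \<psi> (w + disp_v zeta (v - w) x) + \<psi> (w + disp_w zeta (v - w) x) - \<psi> v - \<psi> w"
  by (simp add: tsQ_def disp_id_def disp_zero_def)

lemma dev_tsL: "dev tsL \<psi> v w x = wt (v - w) x * (\<psi> (w + disp_star c (v - w) x) - \<psi> v)"
  by (simp add: tsL_def disp_id_def algebra_simps)

lemma F1_L1w': "p \<le> 5 \<Longrightarrow> L1w p F1"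
  using L1w_mono(1)[OF F1_L1w] by blast

lemma F1_norm_le: "p \<le> 5 \<Longrightarrow> L1w_norm p F1 \<le> L1w_norm 5 F1"
  using L1w_mono(2)[OF F1_L1w] by blast

text \<open>One more than the constant of \<open>energy_star_le\<close>, so that it is at least 1
  and its powers are ordered.\<close>

definition Kc :: real where
  "Kc = 1 + c * ((1 - c)\<^sup>2 / (2 - c) + c)"

lemma Kc_ge_1: "1 \<le> Kc"
  using c by (auto simp: Kc_def)

lemma jbr_star_sq_le: "(jbr (w + disp_star c (v - w) x))\<^sup>2 \<le> (jbr v)\<^sup>2 + Kc * (jbr w)\<^sup>2"
proof -
  have "(jbr (w + disp_star c (v - w) x))\<^sup>2 \<le> (jbr v)\<^sup>2 + (Kc - 1) * (jbr w)\<^sup>2"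
    using energy_star_le[OF c, of w v x] by (simp add: Kc_def)
  also have "\<dots> \<le> (jbr v)\<^sup>2 + Kc * (jbr w)\<^sup>2"
    by (intro add_left_mono mult_right_mono) auto
  finally show ?thesis .
qed

lemma jbr_star_le: "jbr (w + disp_star c (v - w) x) \<le> jbr v + Kc * jbr w"
proof (rule power2_le_imp_le)
  have "Kc * (jbr w)\<^sup>2 \<le> Kc\<^sup>2 * (jbr w)\<^sup>2"
    using Kc_ge_1 by (intro mult_right_mono) (auto simp: power2_eq_square)
  moreover have "0 \<le> 2 * jbr v * (Kc * jbr w)" using Kc_ge_1 by simp
  ultimately show "(jbr (w + disp_star c (v - w) x))\<^sup>2 \<le> (jbr v + Kc * jbr w)\<^sup>2"
    using jbr_star_sq_le[of w v x] unfolding power2_sum power_mult_distrib by linarith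
qed (use Kc_ge_1 in simp)

subsection \<open>Bounds on the collision operator\<close>

text \<open>16 is the product of the kernel constant 2, the four terms of \<open>tsQ\<close> and the
  bound 2 on their weights; \<open>8 powr p\<close> comes from \<open>jbr_shift_le\<close>.\<close>

definition CW :: "real \<Rightarrow> real" where
  "CW p = 16 * 8 powr p * (tau + 1 / lam) * (1 + L1w_norm 5 F1)"

lemma CW_nonneg: "0 \<le> CW p"
  using tau lam L1w_norm_nonneg[of 5 F1] by (simp add: CW_def)

lemma abs_collision_sum_le:
  assumes "\<bar>A\<bar> \<le> a" "\<bar>B\<bar> \<le> b"
  shows "\<bar>tau / 2 * A + 1 / lam * B\<bar> \<le> tau / 2 * a + 1 / lam * b"
proof -
  have "\<bar>tau / 2 * A + 1 / lam * B\<bar> \<le> tau / 2 * \<bar>A\<bar> + 1 / lam * \<bar>B\<bar>"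
    using abs_triangle_ineq[of "tau / 2 * A" "1 / lam * B"] tau lam by (simp add: abs_mult)
  also have "\<dots> \<le> tau / 2 * a + 1 / lam * b"
    using tau lam assms by (intro add_mono mult_left_mono) auto
  finally show ?thesis .
qed

text \<open>Bilinearity: the difference of the quadratic terms is the form at (f - g, f) plus the
  form at (g, f - g). One weight is lost, so this cannot close a Gronwall argument; it supplies
  continuity of the right-hand side in the solution.\<close>

lemma W_diff_le:
  assumes "admissible b" "0 \<le> p" "p \<le> 4" "\<psi> \<in> borel_measurable borel" "\<And>v. \<bar>\<psi> v\<bar> \<le> jbr v powr p"
    and f: "L1w (p + 1) f" and g: "L1w (p + 1) g"
  shows "\<bar>W b f \<psi> - W b g \<psi>\<bar> \<le> CW p * (1 + L1w_norm (p + 1) f + L1w_norm (p + 1) g) * L1w_norm (p + 1) (\<lambda>v. f v - g v)"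
proof -
  let ?n = "L1w_norm (p + 1)" and ?h = "\<lambda>v. f v - g v"
  have \<psi>: "\<bar>\<psi> v\<bar> \<le> 1 * jbr v powr p" for v using assms by simp
  note b = admissible_kernel_bound[OF assms(1)]
  note h = L1w_diff(1)[OF f g]
  have F: "L1w (p + 1) F1" "?n F1 \<le> L1w_norm 5 F1" using assms by (auto intro: F1_L1w' F1_norm_le)
  have nn: "0 \<le> ?n f" "0 \<le> ?n g" "0 \<le> ?n ?h" "0 \<le> ?n F1" by (auto simp: L1w_norm_nonneg)
  let ?E = "16 * 8 powr p"
  have Q1: "\<bar>cint b tsQ ?h f \<psi>\<bar> \<le> ?E * (?n ?h * ?n f)"
    using cint_integrable(2)[OF coll_wf_tsQ assms(2,4) \<psi> b h f] by (simp add: length_ts)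
  have Q2: "\<bar>cint b tsQ g ?h \<psi>\<bar> \<le> ?E * (?n g * ?n ?h)"
    using cint_integrable(2)[OF coll_wf_tsQ assms(2,4) \<psi> b g h] by (simp add: length_ts)
  have "\<bar>cint b tsL ?h F1 \<psi>\<bar> \<le> 8 * 8 powr p * (?n ?h * ?n F1)"
    using cint_integrable(2)[OF coll_wf_tsL assms(2,4) \<psi> b h F(1)] by (simp add: length_ts)
  also have "\<dots> \<le> ?E * (?n ?h * L1w_norm 5 F1)"
    using F nn by (intro mult_mono) auto
  finally have L: "\<bar>cint b tsL ?h F1 \<psi>\<bar> \<le> ?E * (?n ?h * L1w_norm 5 F1)" .
  have "cint b tsQ f f \<psi> - cint b tsQ g g \<psi> = cint b tsQ ?h f \<psi> + cint b tsQ g ?h \<psi>"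
    using cint_diff_left[OF coll_wf_tsQ assms(2,4) \<psi> b f g f] cint_diff_right[OF coll_wf_tsQ assms(2,4) \<psi> b g f g]
    by simp
  then have Q: "\<bar>cint b tsQ f f \<psi> - cint b tsQ g g \<psi>\<bar> \<le> ?E * (?n f + ?n g) * ?n ?h"
    using Q1 Q2 by (simp add: algebra_simps)
  have "W b f \<psi> - W b g \<psi> = tau / 2 * (cint b tsQ f f \<psi> - cint b tsQ g g \<psi>) + 1 / lam * cint b tsL ?h F1 \<psi>"
    unfolding W_def cint_diff_left[OF coll_wf_tsL assms(2,4) \<psi> b f g F(1)] by (simp add: algebra_simps diff_divide_distrib)
  then have "\<bar>W b f \<psi> - W b g \<psi>\<bar> \<le> tau / 2 * (?E * (?n f + ?n g) * ?n ?h) + 1 / lam * (?E * (?n ?h * L1w_norm 5 F1))"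
    using abs_collision_sum_le[OF Q L] by (simp only:)
  also have "\<dots> \<le> CW p * (1 + ?n f + ?n g) * ?n ?h"
  proof -
    let ?F = "L1w_norm 5 F1" and ?s = "?n f + ?n g"
    have F0: "0 \<le> ?F" by (rule L1w_norm_nonneg)
    have "tau / 2 * ?s + 1 / lam * ?F \<le> tau * (1 + ?F) * (1 + ?s) + 1 / lam * (1 + ?F) * (1 + ?s)"
    proof (rule add_mono)
      have "1 / 2 * ?s \<le> (1 + ?F) * (1 + ?s)"
        using nn F0 by (intro mult_mono) auto
      from mult_left_mono[OF this tau] show "tau / 2 * ?s \<le> tau * (1 + ?F) * (1 + ?s)" by (simp add: algebra_simps)
      have "?F * 1 \<le> (1 + ?F) * (1 + ?s)"
        using nn F0 by (intro mult_mono) auto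
      from mult_left_mono[OF this, of "1 / lam"] lam show "1 / lam * ?F \<le> 1 / lam * (1 + ?F) * (1 + ?s)"
        by (simp add: algebra_simps)
    qed
    also have "\<dots> = (tau + 1 / lam) * (1 + ?F) * (1 + ?s)" by (simp add: algebra_simps)
    finally have "(?E * ?n ?h) * (tau / 2 * ?s + 1 / lam * ?F) \<le> (?E * ?n ?h) * ((tau + 1 / lam) * (1 + ?F) * (1 + ?s))"
      using nn by (intro mult_left_mono) auto
    moreover have "tau / 2 * (?E * ?s * ?n ?h) + 1 / lam * (?E * (?n ?h * ?F)) = (?E * ?n ?h) * (tau / 2 * ?s + 1 / lam * ?F)"
      by (simp add: algebra_simps)
    moreover have "(?E * ?n ?h) * ((tau + 1 / lam) * (1 + ?F) * (1 + ?s)) = CW p * (1 + ?n f + ?n g) * ?n ?h"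
      unfolding CW_def by (simp only: mult_ac add_ac)
    ultimately show ?thesis by (simp only:)
  qed
  finally show ?thesis .
qed

lemma W_zero [simp]: "W b (\<lambda>v. 0) \<psi> = 0"
  by (simp add: W_def cint_def case_prod_beta')

lemma W_le:
  assumes "admissible b" "0 \<le> p" "p \<le> 4" "\<psi> \<in> borel_measurable borel" "\<And>v. \<bar>\<psi> v\<bar> \<le> jbr v powr p"
    and f: "L1w (p + 1) f"
  shows "\<bar>W b f \<psi>\<bar> \<le> CW p * (1 + L1w_norm (p + 1) f) * L1w_norm (p + 1) f"
  using W_diff_le[OF assms L1w_zero(1)] by simp

text \<open>Here \<open>N\<close> is the size of the kernel error, small in applications, and not a
  truncation level. The smallness is bought with two weights instead of one.\<close>

lemma W_kernel_diff_le:
  assumes "admissible b1" "admissible b2" "0 \<le> N" "\<And>v w. \<bar>b1 (v - w) - b2 (v - w)\<bar> \<le> N * (jbr v * jbr w) powr 2"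
    and "0 \<le> p" "p \<le> 3" "\<psi> \<in> borel_measurable borel" "\<And>v. \<bar>\<psi> v\<bar> \<le> jbr v powr p"
    and f: "L1w (p + 2) f"
  shows "\<bar>W b1 f \<psi> - W b2 f \<psi>\<bar> \<le> N * CW p * (1 + L1w_norm (p + 2) f) * L1w_norm (p + 2) f"
proof -
  let ?n = "L1w_norm (p + 2)" and ?b = "\<lambda>q. b1 q - b2 q"
  have \<psi>: "\<bar>\<psi> v\<bar> \<le> 1 * jbr v powr p" for v using assms by simp
  have f1: "L1w (p + 1) f" using L1w_mono(1)[OF f] by simp
  have F: "L1w (p + 1) F1" "L1w (p + 2) F1" "?n F1 \<le> L1w_norm 5 F1"
    using assms by (auto intro: F1_L1w' F1_norm_le)
  note b1 = admissible_kernel_bound[OF assms(1)] and b2 = admissible_kernel_bound[OF assms(2)]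
  have b: "kernel_bound N 2 ?b"
    using assms(1,2,4) by (auto simp: kernel_bound_def admissible_def)
  have nn: "0 \<le> ?n f" "0 \<le> ?n F1" "0 \<le> L1w_norm 5 F1" by (auto simp: L1w_norm_nonneg)
  have Q: "\<bar>cint ?b tsQ f f \<psi>\<bar> \<le> N * (8 * 8 powr p) * (?n f * ?n f)"
    using cint_integrable(2)[OF coll_wf_tsQ assms(5,7) \<psi> b f f] by (simp add: length_ts)
  have "\<bar>cint ?b tsL f F1 \<psi>\<bar> \<le> N * (4 * 8 powr p) * (?n f * ?n F1)"
    using cint_integrable(2)[OF coll_wf_tsL assms(5,7) \<psi> b f F(2)] by (simp add: length_ts)
  also have "\<dots> \<le> N * (8 * 8 powr p) * (?n f * L1w_norm 5 F1)"
    using F nn assms(3) by (intro mult_mono) auto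
  finally have L: "\<bar>cint ?b tsL f F1 \<psi>\<bar> \<le> N * (8 * 8 powr p) * (?n f * L1w_norm 5 F1)" .
  have "W b1 f \<psi> - W b2 f \<psi> = tau / 2 * cint ?b tsQ f f \<psi> + 1 / lam * cint ?b tsL f F1 \<psi>"
    unfolding W_def cint_diff_kernel[OF coll_wf_tsL assms(5,7) \<psi> b1 b2 f1 F(1)]
      cint_diff_kernel[OF coll_wf_tsQ assms(5,7) \<psi> b1 b2 f1 f1] by (simp add: algebra_simps diff_divide_distrib)
  then have "\<bar>W b1 f \<psi> - W b2 f \<psi>\<bar> \<le> tau / 2 * (N * (8 * 8 powr p) * (?n f * ?n f)) + 1 / lam * (N * (8 * 8 powr p) * (?n f * L1w_norm 5 F1))"
    using abs_collision_sum_le[OF Q L] by (simp only:)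
  also have "\<dots> = N * (8 * 8 powr p) * ?n f * (tau / 2 * ?n f + 1 / lam * L1w_norm 5 F1)"
    by (simp add: algebra_simps)
  also have "\<dots> \<le> N * (16 * 8 powr p) * ?n f * ((tau + 1 / lam) * (1 + L1w_norm 5 F1) * (1 + ?n f))"
  proof (rule mult_mono)
    let ?F = "L1w_norm 5 F1"
    have "tau / 2 * ?n f + 1 / lam * ?F \<le> tau * ((1 + ?F) * (1 + ?n f)) + 1 / lam * ((1 + ?F) * (1 + ?n f))"
    proof (rule add_mono)
      have "1 / 2 * ?n f \<le> (1 + ?F) * (1 + ?n f)"
        using nn by (intro mult_mono) auto
      from mult_left_mono[OF this tau] show "tau / 2 * ?n f \<le> tau * ((1 + ?F) * (1 + ?n f))" by simp
      have "?F * 1 \<le> (1 + ?F) * (1 + ?n f)"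
        using nn by (intro mult_mono) auto
      from mult_left_mono[OF this, of "1 / lam"] lam show "1 / lam * ?F \<le> 1 / lam * ((1 + ?F) * (1 + ?n f))"
        by simp
    qed
    then show "tau / 2 * ?n f + 1 / lam * ?F \<le> (tau + 1 / lam) * (1 + ?F) * (1 + ?n f)"
      by (simp only: distrib_right mult.assoc)
  qed (use nn assms(3) tau lam in \<open>auto intro!: mult_right_mono\<close>)
  also have "\<dots> = N * CW p * (1 + ?n f) * ?n f"
    unfolding CW_def by (simp only: mult_ac)
  finally show ?thesis .
qed

lemma W_tendsto:
  assumes "admissible b" "0 \<le> p" "p \<le> 4" "\<psi> \<in> borel_measurable borel" "\<And>v. \<bar>\<psi> v\<bar> \<le> jbr v powr p"
    and \<psi>n: "\<And>n. \<psi>n n \<in> borel_measurable borel" "\<And>n v. \<bar>\<psi>n n v\<bar> \<le> jbr v powr p"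
    and lim: "AE v in lborel. (\<lambda>n. \<psi>n n v) \<longlonglongrightarrow> \<psi> v"
    and f: "L1w (p + 1) f"
  shows "(\<lambda>n. W b f (\<psi>n n)) \<longlonglongrightarrow> W b f \<psi>"
proof -
  have \<psi>: "\<bar>\<psi> v\<bar> \<le> 1 * jbr v powr p" "\<bar>\<psi>n n v\<bar> \<le> 1 * jbr v powr p" for v n using assms by auto
  have F: "L1w (p + 1) F1" using assms by (auto intro: F1_L1w')
  show ?thesis
    unfolding W_def
    using cint_tendsto[OF coll_wf_tsQ assms(2) _ assms(4) \<psi>(1) \<psi>n(1) \<psi>(2) lim admissible_kernel_bound[OF assms(1)] f f]
      cint_tendsto[OF coll_wf_tsL assms(2) _ assms(4) \<psi>(1) \<psi>n(1) \<psi>(2) lim admissible_kernel_bound[OF assms(1)] f F]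
    by (intro tendsto_intros) auto
qed

lemma W_linear_test:
  assumes "admissible b" "0 \<le> p" "p \<le> 4" "\<psi>1 \<in> borel_measurable borel" "\<And>v. \<bar>\<psi>1 v\<bar> \<le> C1 * jbr v powr p"
    "\<psi>2 \<in> borel_measurable borel" "\<And>v. \<bar>\<psi>2 v\<bar> \<le> C2 * jbr v powr p" and f: "L1w (p + 1) f"
  shows "W b f (\<lambda>v. a1 * \<psi>1 v + a2 * \<psi>2 v) = a1 * W b f \<psi>1 + a2 * W b f \<psi>2"
proof -
  have F: "L1w (p + 1) F1" using assms by (auto intro: F1_L1w')
  note b = admissible_kernel_bound[OF assms(1)]
  show ?thesis
    unfolding W_def cint_linear_test[OF coll_wf_tsQ assms(2,4-7) b f f] cint_linear_test[OF coll_wf_tsL assms(2,4-7) b f F]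
    by (simp add: algebra_simps)
qed

end

section \<open>Povzner-type inequalities and the growth of moments\<close>

lemma jbr_powr_eq_sq: "jbr u powr p = ((jbr u)\<^sup>2) powr (p / 2)"
proof -
  have "((jbr u)\<^sup>2) powr (p / 2) = (jbr u powr 2) powr (p / 2)" by simp
  also have "\<dots> = jbr u powr p" unfolding powr_powr by simp
  finally show ?thesis by simp
qed

text \<open>The energy inequality bounds \<open>x\<close> and \<open>y\<close> by
  \<open>a + b\<close>, so one factor of each cube can be replaced; expanding
  \<open>(a + b) * (a\<^sup>2 + b\<^sup>2)\<close> leaves the two cubes and mixed terms
  only.\<close>

lemma cube_gain_le:
  fixes a b x y :: real
  assumes "0 \<le> x" "0 \<le> y" "0 \<le> a" "0 \<le> b" "x\<^sup>2 + y\<^sup>2 \<le> a\<^sup>2 + b\<^sup>2"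
  shows "x ^ 3 + y ^ 3 \<le> a ^ 3 + b ^ 3 + a\<^sup>2 * b + a * b\<^sup>2"
proof -
  have le: "u \<le> a + b" if "u\<^sup>2 \<le> x\<^sup>2 + y\<^sup>2" for u
  proof (rule power2_le_imp_le)
    have "u\<^sup>2 \<le> a\<^sup>2 + b\<^sup>2" using that assms(5) by (rule order_trans)
    also have "\<dots> \<le> (a + b)\<^sup>2" using assms by (simp add: power2_sum)
    finally show "u\<^sup>2 \<le> (a + b)\<^sup>2" .
  qed (use assms in simp)
  have "x \<le> a + b" "y \<le> a + b" by (auto intro!: le)
  then have "x * x\<^sup>2 + y * y\<^sup>2 \<le> (a + b) * x\<^sup>2 + (a + b) * y\<^sup>2"
    by (intro add_mono mult_right_mono) auto
  also have "\<dots> = (a + b) * (x\<^sup>2 + y\<^sup>2)" by (simp add: algebra_simps)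
  also have "\<dots> \<le> (a + b) * (a\<^sup>2 + b\<^sup>2)"
    using assms by (intro mult_left_mono) auto
  finally show ?thesis by (simp add: power2_eq_square power3_eq_cube algebra_simps)
qed

text \<open>The square of the energy inequality, with the nonnegative mixed term on the left
  dropped.\<close>

lemma fourth_gain_le:
  fixes a b x y :: real
  assumes "x\<^sup>2 + y\<^sup>2 \<le> a\<^sup>2 + b\<^sup>2"
  shows "x ^ 4 + y ^ 4 \<le> a ^ 4 + b ^ 4 + 2 * a\<^sup>2 * b\<^sup>2"
proof -
  have "(x\<^sup>2 + y\<^sup>2)\<^sup>2 \<le> (a\<^sup>2 + b\<^sup>2)\<^sup>2" using assms by (intro power_mono) auto
  then have "x ^ 4 + y ^ 4 + 2 * (x\<^sup>2 * y\<^sup>2) \<le> a ^ 4 + b ^ 4 + 2 * (a\<^sup>2 * b\<^sup>2)"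
    by (simp add: power2_sum flip: power_mult)
  moreover have "0 \<le> 2 * (x\<^sup>2 * y\<^sup>2)" by simp
  ultimately show ?thesis by linarith
qed

context granular
begin

lemma povzner2:
  assumes "admissible b"
  shows "b (v - w) * dev tsQ (\<lambda>v. jbr v ^ 2) v w x \<le> 0"
  using energy_dissipation[OF zeta, of w v x] admissible_bounds(1)[OF assms, of "v - w"]
  by (auto simp: dev_tsQ intro: mult_nonneg_nonpos)

text \<open>Once gain and loss have lost their pure cubes, even after multiplication by the kernel
  no variable has a power above 3, and the other one then has at most the power 2. The third moment
  therefore enters linearly, with the second moment as coefficient.\<close>

lemma povzner3:
  assumes "admissible b"
  shows "b (v - w) * dev tsQ (\<lambda>v. jbr v ^ 3) v w x \<le> 2 * (jbr v ^ 3 * jbr w ^ 2 + jbr v ^ 2 * jbr w ^ 3)"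
proof -
  define \<alpha> \<beta> where "\<alpha> = jbr v" and "\<beta> = jbr w"
  have ab: "1 \<le> \<alpha>" "1 \<le> \<beta>" by (auto simp: \<alpha>_def \<beta>_def jbr_ge_1)
  have "dev tsQ (\<lambda>v. jbr v ^ 3) v w x \<le> \<alpha>\<^sup>2 * \<beta> + \<alpha> * \<beta>\<^sup>2"
    using cube_gain_le[OF _ _ _ _ energy_dissipation[OF zeta, of w v x]] by (simp add: dev_tsQ \<alpha>_def \<beta>_def)
  then have "b (v - w) * dev tsQ (\<lambda>v. jbr v ^ 3) v w x \<le> b (v - w) * (\<alpha>\<^sup>2 * \<beta> + \<alpha> * \<beta>\<^sup>2)"
    using admissible_bounds(1)[OF assms] by (intro mult_left_mono) auto
  also have "\<dots> \<le> (\<alpha> + \<beta>) * (\<alpha>\<^sup>2 * \<beta> + \<alpha> * \<beta>\<^sup>2)"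
    using admissible_le(1)[OF assms] ab by (intro mult_right_mono) (auto simp: \<alpha>_def \<beta>_def)
  \<comment> \<open>The explicit factors 1 are the places where \<open>\<alpha>\<close> or
    \<open>\<beta>\<close> is inserted next.\<close>
  also have "\<dots> = \<alpha> ^ 3 * \<beta> * 1 + 2 * (\<alpha>\<^sup>2 * \<beta>\<^sup>2 * 1) + \<alpha> * \<beta> ^ 3 * 1"
    by (simp add: power2_eq_square power3_eq_cube algebra_simps)
  also have "\<dots> \<le> \<alpha> ^ 3 * \<beta> * \<beta> + (\<alpha>\<^sup>2 * \<beta>\<^sup>2 * \<alpha> + \<alpha>\<^sup>2 * \<beta>\<^sup>2 * \<beta>) + \<alpha> * \<beta> ^ 3 * \<alpha>"
    unfolding mult_2 using ab by (intro add_mono mult_left_mono) auto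
  finally show ?thesis unfolding \<alpha>_def[symmetric] \<beta>_def[symmetric]
    by (simp add: power2_eq_square power3_eq_cube algebra_simps)
qed

lemma povzner4:
  assumes "admissible b"
  shows "b (v - w) * dev tsQ (\<lambda>v. jbr v ^ 4) v w x \<le> 2 * (jbr v ^ 4 * jbr w ^ 2 + jbr v ^ 2 * jbr w ^ 4)"
proof -
  define \<alpha> \<beta> where "\<alpha> = jbr v" and "\<beta> = jbr w"
  have ab: "1 \<le> \<alpha>" "1 \<le> \<beta>" by (auto simp: \<alpha>_def \<beta>_def jbr_ge_1)
  have "dev tsQ (\<lambda>v. jbr v ^ 4) v w x \<le> 2 * \<alpha>\<^sup>2 * \<beta>\<^sup>2"
    using fourth_gain_le[OF energy_dissipation[OF zeta, of w v x]] by (simp add: dev_tsQ \<alpha>_def \<beta>_def)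
  then have "b (v - w) * dev tsQ (\<lambda>v. jbr v ^ 4) v w x \<le> b (v - w) * (2 * \<alpha>\<^sup>2 * \<beta>\<^sup>2)"
    using admissible_bounds(1)[OF assms] by (intro mult_left_mono) auto
  also have "\<dots> \<le> (\<alpha> + \<beta>) * (2 * \<alpha>\<^sup>2 * \<beta>\<^sup>2)"
    using admissible_le(1)[OF assms] ab by (intro mult_right_mono) (auto simp: \<alpha>_def \<beta>_def)
  also have "\<dots> = 2 * (\<alpha>\<^sup>2 * \<beta>\<^sup>2 * \<alpha> * 1 + \<alpha>\<^sup>2 * \<beta>\<^sup>2 * \<beta> * 1)"
    by (simp add: algebra_simps)
  also have "\<dots> \<le> 2 * (\<alpha>\<^sup>2 * \<beta>\<^sup>2 * \<alpha> * \<alpha> + \<alpha>\<^sup>2 * \<beta>\<^sup>2 * \<beta> * \<beta>)"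
    using ab by (intro add_mono mult_left_mono) auto
  finally show ?thesis unfolding \<alpha>_def[symmetric] \<beta>_def[symmetric]
    by (simp add: power2_eq_square power4_eq_xxxx algebra_simps)
qed

text \<open>The power \<open>s\<close> of \<open>jbr v\<close> cancels against the loss and at most
  \<open>s - 1\<close> remains; the kernel raises this to \<open>s\<close> again, so the moment
  closes linearly. 12 is 2 from the kernel, 2 from \<open>wt\<close> and 3 for the number of mixed
  terms.\<close>

lemma host_gain:
  assumes b: "admissible b" and s: "s \<in> {2, 3, 4::nat}"
  shows "b (v - w) * dev tsL (\<lambda>v. jbr v ^ s) v w x \<le> 12 * Kc\<^sup>2 * (jbr v ^ s * jbr w ^ 5)"
proof -
  define \<alpha> \<beta> L where "\<alpha> = jbr v" and "\<beta> = jbr w" and "L = Kc"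
  have ab: "1 \<le> \<alpha>" "1 \<le> \<beta>" "1 \<le> L" by (auto simp: \<alpha>_def \<beta>_def L_def jbr_ge_1 Kc_ge_1)
  define u where "u = jbr (w + disp_star c (v - w) x)"
  have u: "0 \<le> u" "u\<^sup>2 \<le> \<alpha>\<^sup>2 + L * \<beta>\<^sup>2" "u \<le> \<alpha> + L * \<beta>"
    using jbr_star_sq_le[of w v x] jbr_star_le[of w v x] by (auto simp: u_def \<alpha>_def \<beta>_def L_def)
  have LL: "L * 1 \<le> L * L" using ab by (intro mult_left_mono) auto
  have mono: "L ^ i * \<alpha> ^ j * \<beta> ^ k \<le> L\<^sup>2 * \<alpha> ^ (s - 1) * \<beta> ^ 4" if "i \<le> 2" "j \<le> s - 1" "k \<le> 4" for i j k
    using that ab by (intro mult_mono power_increasing) auto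
  have gain: "u ^ s - \<alpha> ^ s \<le> 3 * (L\<^sup>2 * \<alpha> ^ (s - 1) * \<beta> ^ 4)"
  proof -
    have nn: "0 \<le> L\<^sup>2 * \<alpha> ^ (s - 1) * \<beta> ^ 4" using ab by auto
    consider "s = 2" | "s = 3" | "s = 4" using s by auto
    then show ?thesis
    proof cases
      case 1
      then show ?thesis using u mono[of 1 0 2] nn by simp
    next
      case 2
      have "u * u\<^sup>2 \<le> (\<alpha> + L * \<beta>) * (\<alpha>\<^sup>2 + L * \<beta>\<^sup>2)"
        using u ab by (intro mult_mono) auto
      then have "u ^ 3 - \<alpha> ^ 3 \<le> L ^ 1 * \<alpha> ^ 2 * \<beta> ^ 1 + L ^ 1 * \<alpha> ^ 1 * \<beta> ^ 2 + L ^ 2 * \<alpha> ^ 0 * \<beta> ^ 3"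
        by (simp add: power2_eq_square power3_eq_cube algebra_simps)
      then show ?thesis using mono[of 1 2 1] mono[of 1 1 2] mono[of 2 0 3] 2 by simp
    next
      case 3
      have "u\<^sup>2 * u\<^sup>2 \<le> (\<alpha>\<^sup>2 + L * \<beta>\<^sup>2) * (\<alpha>\<^sup>2 + L * \<beta>\<^sup>2)"
        using u ab by (intro mult_mono) auto
      then have "u ^ 4 - \<alpha> ^ 4 \<le> 2 * (L ^ 1 * \<alpha> ^ 2 * \<beta> ^ 2) + L ^ 2 * \<alpha> ^ 0 * \<beta> ^ 4"
        by (simp add: power2_eq_square power4_eq_xxxx algebra_simps)
      then show ?thesis using mono[of 1 2 2] mono[of 2 0 4] 3 by simp
    qed
  qed
  have "b (v - w) * dev tsL (\<lambda>v. jbr v ^ s) v w x = (b (v - w) * wt (v - w) x) * (u ^ s - \<alpha> ^ s)"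
    by (simp add: dev_tsL u_def \<alpha>_def)
  also have "\<dots> \<le> (b (v - w) * wt (v - w) x) * (3 * (L\<^sup>2 * \<alpha> ^ (s - 1) * \<beta> ^ 4))"
    using gain admissible_bounds(1)[OF b] wt_bounds by (intro mult_left_mono) auto
  also have "\<dots> \<le> ((2 * (\<alpha> * \<beta>)) * 2) * (3 * (L\<^sup>2 * \<alpha> ^ (s - 1) * \<beta> ^ 4))"
    using admissible_le(2)[OF b] wt_bounds admissible_bounds(1)[OF b] ab
    by (intro mult_right_mono mult_mono) (auto simp: \<alpha>_def \<beta>_def)
  also have "\<dots> = 12 * L\<^sup>2 * ((\<alpha> * \<alpha> ^ (s - 1)) * (\<beta> * \<beta> ^ 4))" by (simp add: mult_ac)
  also have "\<alpha> * \<alpha> ^ (s - 1) = \<alpha> ^ s" using s by (cases s) auto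
  also have "\<beta> * \<beta> ^ 4 = \<beta> ^ 5" by (simp add: eval_nat_numeral)
  finally show ?thesis by (simp add: \<alpha>_def \<beta>_def L_def)
qed

definition CM :: real where
  "CM = 2 * tau + 12 * Kc\<^sup>2 * L1w_norm 5 F1 / lam"

lemma CM_nonneg: "0 \<le> CM"
  using tau lam L1w_norm_nonneg[of 5 F1] by (simp add: CM_def)

text \<open>The two kernel hypotheses have separate roles: \<open>admissible\<close> fixes constants
  that do not see a truncation, while the exponent \<open>r\<close> decides how many moments
  integrability costs. Truncated kernels have \<open>r = 0\<close>, so the moment of order
  \<open>s\<close> itself suffices.\<close>

lemma cint_tsL_moment:
  assumes b: "admissible b" "kernel_bound B r b" and s: "s \<in> {2, 3, 4::nat}"
    and f: "L1w (real s + r) f" "\<And>v. 0 \<le> f v" and r: "0 \<le> r" "real s + r \<le> 5"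
  shows "cint b tsL f F1 (\<lambda>v. jbr v ^ s) \<le> 12 * Kc\<^sup>2 * (L1w_norm (real s) f * L1w_norm 5 F1)"
proof -
  have fs: "L1w (real s) f" using L1w_mono(1)[OF f(1)] r by simp
  have "cint b tsL f F1 (\<lambda>v. jbr v ^ s) \<le>
    (\<Sum>i<(1::nat). (\<integral>v. 12 * Kc\<^sup>2 * (\<bar>f v\<bar> * jbr v powr real s) \<partial>lborel) * (\<integral>w. \<bar>F1 w\<bar> * jbr w powr 5 \<partial>lborel))"
  proof (rule cint_le)
    show "integrable colM (\<lambda>(v, w, x). f v * F1 w * b (v - w) * dev tsL (\<lambda>v. jbr v ^ s) v w x)"
      by (rule cint_integrable(1)[OF coll_wf_tsL _ _ _ b(2) f(1) F1_L1w', where C = 1]) (use r in \<open>auto simp: powr_realpow\<close>)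
    fix v w x
    have "(f v * F1 w) * (b (v - w) * dev tsL (\<lambda>v. jbr v ^ s) v w x) \<le> (f v * F1 w) * (12 * Kc\<^sup>2 * (jbr v ^ s * jbr w ^ 5))"
      using host_gain[OF b(1) s] f F1_nonneg by (intro mult_left_mono) auto
    then show "f v * F1 w * b (v - w) * dev tsL (\<lambda>v. jbr v ^ s) v w x \<le>
      (\<Sum>i<(1::nat). 12 * Kc\<^sup>2 * (\<bar>f v\<bar> * jbr v powr real s) * (\<bar>F1 w\<bar> * jbr w powr 5))"
      using f F1_nonneg by (simp add: powr_realpow mult_ac)
  qed (use L1wD(2)[OF fs] L1wD(2)[OF F1_L1w] in auto)
  then show ?thesis by (simp add: L1w_norm_def)
qed

lemma W_moment2:
  assumes b: "admissible b" "kernel_bound B r b"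
    and f: "L1w (2 + r) f" "\<And>v. 0 \<le> f v" and r: "0 \<le> r" "r \<le> 1"
  shows "W b f (\<lambda>v. jbr v ^ 2) \<le> CM * L1w_norm 2 f"
proof -
  \<comment> \<open>An empty sum is the bound 0: energy dissipation makes the integrand nonpositive
    for nonnegative \<open>f\<close>.\<close>
  have "cint b tsQ f f (\<lambda>v. jbr v ^ 2) \<le> (\<Sum>i<(0::nat). (\<integral>v. (0::real) \<partial>(lborel::vel measure)) * (\<integral>w. (0::real) \<partial>(lborel::vel measure)))"
  proof (rule cint_le)
    show "integrable colM (\<lambda>(v, w, x). f v * f w * b (v - w) * dev tsQ (\<lambda>v. jbr v ^ 2) v w x)"
      by (rule cint_integrable(1)[OF coll_wf_tsQ _ _ _ b(2) f(1) f(1), where C = 1]) auto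
    fix v w x
    have "(f v * f w) * (b (v - w) * dev tsQ (\<lambda>v. jbr v ^ 2) v w x) \<le> 0"
      using f by (intro mult_nonneg_nonpos povzner2[OF b(1)] mult_nonneg_nonneg)
    then show "f v * f w * b (v - w) * dev tsQ (\<lambda>v. jbr v ^ 2) v w x \<le> (\<Sum>i<(0::nat). 0 * 0)" by (simp add: mult.assoc)
  qed auto
  then have "cint b tsQ f f (\<lambda>v. jbr v ^ 2) \<le> 0" by simp
  then have "tau / 2 * cint b tsQ f f (\<lambda>v. jbr v ^ 2) \<le> 0"
    using tau by (intro mult_nonneg_nonpos[of "tau / 2"]) auto
  moreover have "0 \<le> 2 * tau * L1w_norm 2 f"
    using tau L1w_norm_nonneg[of 2 f] by (intro mult_nonneg_nonneg) auto
  ultimately have Q: "tau / 2 * cint b tsQ f f (\<lambda>v. jbr v ^ 2) \<le> 2 * tau * L1w_norm 2 f"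
    by linarith
  have "cint b tsL f F1 (\<lambda>v. jbr v ^ 2) \<le> 12 * Kc\<^sup>2 * (L1w_norm 2 f * L1w_norm 5 F1)"
    using cint_tsL_moment[OF b, of 2 f] f r by simp
  then have "1 / lam * cint b tsL f F1 (\<lambda>v. jbr v ^ 2) \<le> 1 / lam * (12 * Kc\<^sup>2 * (L1w_norm 2 f * L1w_norm 5 F1))"
    using lam by (intro mult_left_mono) auto
  with Q show ?thesis unfolding W_def CM_def by (simp add: algebra_simps)
qed

lemma W_moment34:
  assumes b: "admissible b" "kernel_bound B r b" and s: "s \<in> {3, 4::nat}"
    and f: "L1w (real s + r) f" "\<And>v. 0 \<le> f v" and r: "0 \<le> r" "real s + r \<le> 5"
  shows "W b f (\<lambda>v. jbr v ^ s) \<le> CM * (1 + L1w_norm 2 f) * L1w_norm (real s) f"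
proof -
  let ?s = "L1w_norm (real s) f" and ?m = "L1w_norm 2 f"
  have fs: "L1w (real s) f" "L1w 2 f" using L1w_mono(1)[OF f(1)] r s by auto
  have nn: "0 \<le> ?s" "0 \<le> ?m" "0 \<le> L1w_norm 5 F1" by (auto simp: L1w_norm_nonneg)
  have pov: "b (v - w) * dev tsQ (\<lambda>v. jbr v ^ s) v w x \<le> 2 * (jbr v ^ s * jbr w ^ 2 + jbr v ^ 2 * jbr w ^ s)" for v w x
    using s povzner3[OF b(1)] povzner4[OF b(1)] by auto
  define F where "F i = (if i = (0::nat) then (\<lambda>v. 2 * (\<bar>f v\<bar> * jbr v powr real s)) else (\<lambda>v. 2 * (\<bar>f v\<bar> * jbr v powr 2)))" for i
  define G where "G i = (if i = (0::nat) then (\<lambda>v. \<bar>f v\<bar> * jbr v powr 2) else (\<lambda>v. \<bar>f v\<bar> * jbr v powr real s))" for i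
  have "cint b tsQ f f (\<lambda>v. jbr v ^ s) \<le> (\<Sum>i<2. (\<integral>v. F i v \<partial>lborel) * (\<integral>w. G i w \<partial>lborel))"
  proof (rule cint_le)
    show "integrable colM (\<lambda>(v, w, x). f v * f w * b (v - w) * dev tsQ (\<lambda>v. jbr v ^ s) v w x)"
      by (rule cint_integrable(1)[OF coll_wf_tsQ _ _ _ b(2) f(1) f(1), where C = 1]) (auto simp: powr_realpow)
    fix v w x
    have "(f v * f w) * (b (v - w) * dev tsQ (\<lambda>v. jbr v ^ s) v w x) \<le> (f v * f w) * (2 * (jbr v ^ s * jbr w ^ 2 + jbr v ^ 2 * jbr w ^ s))"
      using pov f by (intro mult_left_mono) auto
    then show "f v * f w * b (v - w) * dev tsQ (\<lambda>v. jbr v ^ s) v w x \<le> (\<Sum>i<2. F i v * G i w)"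
      using f by (simp add: F_def G_def powr_realpow eval_nat_numeral algebra_simps)
  qed (use L1wD(2)[OF fs(1)] L1wD(2)[OF fs(2)] in \<open>auto simp: F_def G_def\<close>)
  also have "\<dots> = 4 * (?s * ?m)"
    by (simp add: F_def G_def L1w_norm_def eval_nat_numeral)
  finally have "tau / 2 * cint b tsQ f f (\<lambda>v. jbr v ^ s) \<le> tau / 2 * (4 * (?s * ?m))"
    using tau by (intro mult_left_mono) auto
  moreover have "cint b tsL f F1 (\<lambda>v. jbr v ^ s) \<le> 12 * Kc\<^sup>2 * (?s * L1w_norm 5 F1)"
    using cint_tsL_moment[OF b _ f r] s by simp
  then have "1 / lam * cint b tsL f F1 (\<lambda>v. jbr v ^ s) \<le> 1 / lam * (12 * Kc\<^sup>2 * (?s * L1w_norm 5 F1))"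
    using lam by (intro mult_left_mono) auto
  moreover have "0 \<le> 2 * tau * ?s" "0 \<le> 12 * Kc\<^sup>2 * L1w_norm 5 F1 / lam * ?m * ?s"
    using nn tau lam by auto
  ultimately have "W b f (\<lambda>v. jbr v ^ s) \<le> (tau / 2 * (4 * (?s * ?m)) + 1 / lam * (12 * Kc\<^sup>2 * (?s * L1w_norm 5 F1)))
      + (2 * tau * ?s + 12 * Kc\<^sup>2 * L1w_norm 5 F1 / lam * ?m * ?s)"
    unfolding W_def by (intro add_increasing2 add_mono add_nonneg_nonneg)
  also have "\<dots> = CM * (1 + ?m) * ?s"
    using lam by (simp add: CM_def field_simps)
  finally show ?thesis .
qed


subsection \<open>Stability at a fixed time\<close>

text \<open>Energy dissipation placed between concavity and subadditivity of the power
  \<open>p / 2\<close> of squared weights. Only concavity costs a constant, and at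
  \<open>p = 2\<close> it costs nothing.\<close>

lemma gain_powr_le:
  assumes p: "0 \<le> p" "p \<le> 2"
  shows "jbr (w + disp_v zeta (v - w) x) powr p + jbr (w + disp_w zeta (v - w) x) powr p
    \<le> 2 powr (1 - p / 2) * (jbr v powr p + jbr w powr p)"
proof -
  note sq = jbr_powr_eq_sq
  let ?v = "w + disp_v zeta (v - w) x" and ?w = "w + disp_w zeta (v - w) x"
  have "jbr ?v powr p + jbr ?w powr p \<le> 2 powr (1 - p / 2) * ((jbr ?v)\<^sup>2 + (jbr ?w)\<^sup>2) powr (p / 2)"
    unfolding sq[where p = p] by (rule add_powr_le_powr_add) (use p in auto)
  also have "\<dots> \<le> 2 powr (1 - p / 2) * ((jbr v)\<^sup>2 + (jbr w)\<^sup>2) powr (p / 2)"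
    using energy_dissipation[OF zeta, of w v x] p by (intro mult_left_mono powr_mono2) auto
  also have "\<dots> \<le> 2 powr (1 - p / 2) * (((jbr v)\<^sup>2) powr (p / 2) + ((jbr w)\<^sup>2) powr (p / 2))"
    using p by (intro mult_left_mono powr_add_le_add_powr) auto
  finally show ?thesis unfolding sq[where p = p] .
qed

lemma host_gain_powr:
  assumes p: "0 \<le> p" "p \<le> 2"
  shows "jbr (w + disp_star c (v - w) x) powr p \<le> jbr v powr p + Kc * jbr w powr 2"
proof -
  note sq = jbr_powr_eq_sq
  have "1 * 1 \<le> Kc * (jbr w)\<^sup>2"
    using Kc_ge_1 by (intro mult_mono) (auto simp: jbr_ge_1)
  then have 1: "(Kc * (jbr w)\<^sup>2) powr (p / 2) \<le> (Kc * (jbr w)\<^sup>2) powr 1"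
    using p by (intro powr_mono) auto
  have "((jbr (w + disp_star c (v - w) x))\<^sup>2) powr (p / 2) \<le> ((jbr v)\<^sup>2 + Kc * (jbr w)\<^sup>2) powr (p / 2)"
    using jbr_star_sq_le[of w v x] p by (intro powr_mono2) auto
  also have "\<dots> \<le> ((jbr v)\<^sup>2) powr (p / 2) + (Kc * (jbr w)\<^sup>2) powr (p / 2)"
    using p Kc_ge_1 by (intro powr_add_le_add_powr) auto
  also have "\<dots> \<le> ((jbr v)\<^sup>2) powr (p / 2) + Kc * (jbr w)\<^sup>2"
    using 1 Kc_ge_1 by simp
  finally show ?thesis unfolding sq[of "w + _" p] sq[of v p] by simp
qed

text \<open>Think of \<open>k = g + f\<close> and \<open>h = g - f\<close>.\<close>

lemma dev_tsQ_sign_le: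
  fixes h k :: "vel \<Rightarrow> real"
  assumes p: "0 \<le> p" "p \<le> 2" and b: "admissible b"
    and k: "\<And>v. - k v \<le> - \<bar>k v\<bar> + 2 * \<bar>h v\<bar>"
    and \<psi>: "\<psi> = (\<lambda>v. sgn (h v) * jbr v powr p)"
  defines "\<kappa> \<equiv> 2 powr (1 - p / 2)"
  shows "h v * k w * b (v - w) * dev tsQ \<psi> v w x \<le>
      2 * (\<kappa> - 1) * (\<bar>h v\<bar> * jbr v powr (p + 1)) * (\<bar>k w\<bar> * jbr w powr 1)
      + 2 * (\<kappa> + 1) * (\<bar>h v\<bar> * jbr v powr 1) * (\<bar>k w\<bar> * jbr w powr (p + 1))
      + 4 * (\<bar>h v\<bar> * jbr v powr (p + 1)) * (\<bar>h w\<bar> * jbr w powr 1)" (is ?A)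
    and "k v * h w * b (v - w) * dev tsQ \<psi> v w x \<le>
      2 * (\<kappa> - 1) * (\<bar>k v\<bar> * jbr v powr 1) * (\<bar>h w\<bar> * jbr w powr (p + 1))
      + 2 * (\<kappa> + 1) * (\<bar>k v\<bar> * jbr v powr (p + 1)) * (\<bar>h w\<bar> * jbr w powr 1)
      + 4 * (\<bar>h v\<bar> * jbr v powr 1) * (\<bar>h w\<bar> * jbr w powr (p + 1))" (is ?B)
proof -
  have \<kappa>: "1 \<le> \<kappa>" unfolding \<kappa>_def using p by (intro ge_one_powr_ge_zero) auto
  define \<phi> where "\<phi> = (\<lambda>v. jbr v powr p)"
  have \<phi>0: "0 \<le> \<phi> u" for u by (simp add: \<phi>_def)
  have \<psi>\<phi>: "\<bar>\<psi> u\<bar> \<le> \<phi> u" for u by (auto simp: \<psi> \<phi>_def abs_mult abs_sgn_eq)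
  have h\<psi>: "h u * \<psi> u = \<bar>h u\<bar> * \<phi> u" for u
    by (simp add: \<psi> \<phi>_def mult.assoc[symmetric]) (simp add: abs_sgn mult.commute)
  let ?v = "w + disp_v zeta (v - w) x" and ?w = "w + disp_w zeta (v - w) x"
  have gain: "\<bar>\<psi> ?v + \<psi> ?w\<bar> \<le> \<kappa> * (\<phi> v + \<phi> w)"
    using \<psi>\<phi>[of ?v] \<psi>\<phi>[of ?w] gain_powr_le[OF p, of w v x] unfolding \<phi>_def \<kappa>_def by linarith
  \<comment> \<open>\<open>u\<close> carries the factor \<open>h\<close> and \<open>z\<close> the
    factor \<open>k\<close>; the two assertions are the cases (u, z) = (v, w) and (u, z) = (w,
    v).\<close>
  have core: "h u * k z * (\<psi> ?v + \<psi> ?w - \<psi> u - \<psi> z) \<le>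
      (\<kappa> - 1) * (\<bar>h u\<bar> * \<phi> u) * \<bar>k z\<bar> + (\<kappa> + 1) * \<bar>h u\<bar> * (\<bar>k z\<bar> * \<phi> z) + 2 * (\<bar>h u\<bar> * \<phi> u) * \<bar>h z\<bar>"
    if uz: "\<phi> v + \<phi> w = \<phi> u + \<phi> z" for u z
  proof -
    have 1: "h u * k z * (\<psi> ?v + \<psi> ?w) \<le> \<bar>h u\<bar> * \<bar>k z\<bar> * (\<kappa> * (\<phi> u + \<phi> z))"
    proof -
      have "h u * k z * (\<psi> ?v + \<psi> ?w) \<le> \<bar>h u * k z * (\<psi> ?v + \<psi> ?w)\<bar>" by (rule abs_ge_self)
      also have "\<dots> = \<bar>h u\<bar> * \<bar>k z\<bar> * \<bar>\<psi> ?v + \<psi> ?w\<bar>" by (simp add: abs_mult)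
      also have "\<dots> \<le> \<bar>h u\<bar> * \<bar>k z\<bar> * (\<kappa> * (\<phi> u + \<phi> z))"
        using gain uz by (intro mult_left_mono) auto
      finally show ?thesis .
    qed
    have 2: "h u * k z * (- \<psi> z) \<le> \<bar>h u\<bar> * \<bar>k z\<bar> * \<phi> z"
    proof -
      have "h u * k z * (- \<psi> z) \<le> \<bar>h u * k z * (- \<psi> z)\<bar>" by (rule abs_ge_self)
      also have "\<dots> = \<bar>h u\<bar> * \<bar>k z\<bar> * \<bar>\<psi> z\<bar>" by (simp add: abs_mult)
      also have "\<dots> \<le> \<bar>h u\<bar> * \<bar>k z\<bar> * \<phi> z"
        using \<psi>\<phi> by (intro mult_left_mono) auto
      finally show ?thesis .
    qed
    \<comment> \<open>The term with the good sign. It becomes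
      \<open>- \<bar>h u\<bar> * \<phi> u * \<bar>k z\<bar>\<close> up to an error quadratic in
      \<open>h\<close>, and cancels all but the fraction \<open>\<kappa> - 1\<close> of the gain
      carrying the weight of \<open>u\<close>.\<close>
    have "h u * k z * (- \<psi> u) = (h u * \<psi> u) * (- k z)" by simp
    also have "\<dots> = (\<bar>h u\<bar> * \<phi> u) * (- k z)" by (simp only: h\<psi>)
    also have "\<dots> \<le> (\<bar>h u\<bar> * \<phi> u) * (- \<bar>k z\<bar> + 2 * \<bar>h z\<bar>)"
      using k \<phi>0 by (intro mult_left_mono) auto
    finally have 3: "h u * k z * (- \<psi> u) \<le> (\<bar>h u\<bar> * \<phi> u) * (- \<bar>k z\<bar> + 2 * \<bar>h z\<bar>)" .
    have "h u * k z * (\<psi> ?v + \<psi> ?w - \<psi> u - \<psi> z) = h u * k z * (\<psi> ?v + \<psi> ?w) + h u * k z * (- \<psi> u) + h u * k z * (- \<psi> z)"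
      by (simp add: algebra_simps)
    also have "\<dots> \<le> \<bar>h u\<bar> * \<bar>k z\<bar> * (\<kappa> * (\<phi> u + \<phi> z)) + (\<bar>h u\<bar> * \<phi> u) * (- \<bar>k z\<bar> + 2 * \<bar>h z\<bar>) + \<bar>h u\<bar> * \<bar>k z\<bar> * \<phi> z"
      using 1 2 3 by (intro add_mono) auto
    also have "\<dots> = (\<kappa> - 1) * (\<bar>h u\<bar> * \<phi> u) * \<bar>k z\<bar> + (\<kappa> + 1) * \<bar>h u\<bar> * (\<bar>k z\<bar> * \<phi> z) + 2 * (\<bar>h u\<bar> * \<phi> u) * \<bar>h z\<bar>"
      by (simp add: algebra_simps)
    finally show ?thesis .
  qed
  have bb: "b (v - w) * E \<le> (2 * (jbr v * jbr w)) * E" if "0 \<le> E" for E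
    using admissible_le(2)[OF b] that by (intro mult_right_mono) auto
  have b0: "0 \<le> b (v - w)" by (rule admissible_bounds[OF b])
  have step: "b (v - w) * X \<le> (2 * (jbr v * jbr w)) * E" if "X \<le> E" "0 \<le> E" for X E
    using mult_left_mono[OF that(1) b0] bb[OF that(2)] by linarith
  have E0: "0 \<le> (\<kappa> - 1) * (\<bar>h u\<bar> * \<phi> u) * \<bar>k z\<bar> + (\<kappa> + 1) * \<bar>h u\<bar> * (\<bar>k z\<bar> * \<phi> z) + 2 * (\<bar>h u\<bar> * \<phi> u) * \<bar>h z\<bar>" for u z
    using \<kappa> \<phi>0 by (intro add_nonneg_nonneg mult_nonneg_nonneg) auto
  have \<phi>1: "jbr u powr (p + 1) = \<phi> u * jbr u" "jbr u powr 1 = jbr u" for u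
    by (simp_all add: \<phi>_def powr_add)
  have A: "b (v - w) * (h v * k w * (\<psi> ?v + \<psi> ?w - \<psi> v - \<psi> w)) \<le> (2 * (jbr v * jbr w)) *
     ((\<kappa> - 1) * (\<bar>h v\<bar> * \<phi> v) * \<bar>k w\<bar> + (\<kappa> + 1) * \<bar>h v\<bar> * (\<bar>k w\<bar> * \<phi> w) + 2 * (\<bar>h v\<bar> * \<phi> v) * \<bar>h w\<bar>)"
    by (rule step[OF core[of v w] E0]) simp
  have B: "b (v - w) * (h w * k v * (\<psi> ?v + \<psi> ?w - \<psi> w - \<psi> v)) \<le> (2 * (jbr v * jbr w)) *
     ((\<kappa> - 1) * (\<bar>h w\<bar> * \<phi> w) * \<bar>k v\<bar> + (\<kappa> + 1) * \<bar>h w\<bar> * (\<bar>k v\<bar> * \<phi> v) + 2 * (\<bar>h w\<bar> * \<phi> w) * \<bar>h v\<bar>)"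
    by (rule step[OF core[of w v] E0]) simp
  show ?A using A unfolding dev_tsQ \<phi>1 by (simp add: algebra_simps)
  show ?B using B unfolding dev_tsQ \<phi>1 by (simp add: algebra_simps)
qed

end

context granular
begin

definition CA :: "real \<Rightarrow> real" where
  "CA M = 10 * tau * M + 4 * Kc * L1w_norm 5 F1 / lam"

lemma CA_nonneg: "0 \<le> M \<Longrightarrow> 0 \<le> CA M"
  using tau lam Kc_ge_1 L1w_norm_nonneg[of 5 F1] by (simp add: CA_def)

text \<open>Subadditivity bounds the gain by the loss plus a weight in \<open>w\<close>, so the top
  weight in \<open>v\<close> cancels exactly for every \<open>p \<le> 2\<close>. What remains is the
  single power of \<open>jbr v\<close> from the kernel, absorbed because
  \<open>1 \<le> p\<close>.\<close>

lemma cint_tsL_sign_le: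
  assumes p: "1 \<le> p" "p \<le> 2" and b: "admissible b" and h: "L1w 3 h"
  shows "cint b tsL h F1 (\<lambda>v. sgn (h v) * jbr v powr p) \<le> 4 * Kc * (L1w_norm p h * L1w_norm 5 F1)"
proof -
  define \<psi> where "\<psi> = (\<lambda>v. sgn (h v) * jbr v powr p)"
  have [measurable]: "h \<in> borel_measurable borel" by (rule L1wD[OF h])
  have [measurable]: "\<psi> \<in> borel_measurable borel" unfolding \<psi>_def by measurable
  have \<psi>\<phi>: "\<bar>\<psi> u\<bar> \<le> 1 * jbr u powr p" for u by (auto simp: \<psi>_def abs_mult abs_sgn_eq)
  have h1: "L1w (p + 1) h" "L1w p h" "L1w 1 h"
    using L1w_mono[OF h, of "p + 1"] L1w_mono[OF h, of p] L1w_mono(1)[OF h, of 1] p by auto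
  have h1n: "L1w_norm 1 h \<le> L1w_norm p h" using L1w_mono(2)[OF h1(2), of 1] p by simp
  have F3: "L1w (p + 1) F1" "L1w 3 F1" "L1w_norm 3 F1 \<le> L1w_norm 5 F1" using p by (auto intro: F1_L1w' F1_norm_le)
  have "cint b tsL h F1 \<psi> \<le> (\<Sum>i<(1::nat). (\<integral>v. 4 * Kc * (\<bar>h v\<bar> * jbr v powr 1) \<partial>lborel) * (\<integral>w. \<bar>F1 w\<bar> * jbr w powr 3 \<partial>lborel))"
  proof (rule cint_le)
    show "integrable colM (\<lambda>(v, w, x). h v * F1 w * b (v - w) * dev tsL \<psi> v w x)"
      by (rule cint_integrable(1)[OF coll_wf_tsL _ _ \<psi>\<phi> admissible_kernel_bound[OF b] h1(1) F3(1)]) (use p in auto)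
    fix v w x
    let ?s = "w + disp_star c (v - w) x"
    have "h v * (\<psi> ?s - \<psi> v) \<le> \<bar>h v\<bar> * (Kc * jbr w powr 2)"
    proof -
      have "h v * \<psi> ?s \<le> \<bar>h v * \<psi> ?s\<bar>" by (rule abs_ge_self)
      also have "\<dots> \<le> \<bar>h v\<bar> * (jbr v powr p + Kc * jbr w powr 2)"
        unfolding abs_mult using \<psi>\<phi>[of ?s] host_gain_powr[of p w v x] p
        by (intro mult_left_mono) auto
      finally have "h v * \<psi> ?s \<le> \<bar>h v\<bar> * (jbr v powr p + Kc * jbr w powr 2)" .
      moreover have "h v * \<psi> v = \<bar>h v\<bar> * jbr v powr p"
        by (simp add: \<psi>_def mult.assoc[symmetric]) (simp add: abs_sgn mult.commute)
      ultimately show ?thesis by (simp add: algebra_simps)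
    qed
    then have "(F1 w * b (v - w) * wt (v - w) x) * (h v * (\<psi> ?s - \<psi> v)) \<le> (F1 w * b (v - w) * wt (v - w) x) * (\<bar>h v\<bar> * (Kc * jbr w powr 2))"
      using F1_nonneg[of w] admissible_bounds(1)[OF b, of "v - w"] wt_bounds(1)[of "v - w" x]
      by (intro mult_left_mono) auto
    also have "\<dots> \<le> (F1 w * (2 * (jbr v * jbr w)) * 2) * (\<bar>h v\<bar> * (Kc * jbr w powr 2))"
      using F1_nonneg[of w] admissible_bounds(1)[OF b, of "v - w"] wt_bounds[of "v - w" x] Kc_ge_1 admissible_le(2)[OF b, of v w]
      by (intro mult_right_mono mult_mono) auto
    also have "\<dots> = 4 * Kc * (\<bar>h v\<bar> * jbr v powr 1) * (\<bar>F1 w\<bar> * jbr w powr 3)"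
      using F1_nonneg[of w] by (simp add: power2_eq_square power3_eq_cube)
    finally show "h v * F1 w * b (v - w) * dev tsL \<psi> v w x \<le> (\<Sum>i<(1::nat). 4 * Kc * (\<bar>h v\<bar> * jbr v powr 1) * (\<bar>F1 w\<bar> * jbr w powr 3))"
      by (simp add: dev_tsL mult_ac)
  qed (use L1wD(2)[OF h1(3)] L1wD(2)[OF F3(2)] in auto)
  also have "\<dots> = 4 * Kc * L1w_norm 1 h * L1w_norm 3 F1" by (simp add: L1w_norm_def)
  also have "\<dots> \<le> 4 * Kc * L1w_norm p h * L1w_norm 5 F1"
    using Kc_ge_1 h1n F3 by (intro mult_mono) (auto simp: L1w_norm_nonneg)
  finally show ?thesis unfolding \<psi>_def by (simp add: mult.assoc)
qed

text \<open>The form is evaluated at (h, k) and (k, h) with h = g - f and k = g + f. Bounds in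
  weight 3 control every norm that carries the excess weight; only the part with the factor \<kappa>
  - 1 fails to be proportional to the norm of h, and it is left as an additive error.\<close>

lemma W_stability:
  assumes p: "1 \<le> p" "p \<le> 2" and b: "admissible b" and f0: "\<And>v. 0 \<le> f v"
    and f: "L1w 3 f" "L1w_norm 3 f \<le> M" and g: "L1w 3 g" "L1w_norm 3 g \<le> M"
  shows "W b g (\<lambda>v. sgn (g v - f v) * jbr v powr p) - W b f (\<lambda>v. sgn (g v - f v) * jbr v powr p)
    \<le> CA M * L1w_norm p (\<lambda>v. g v - f v) + 4 * tau * M\<^sup>2 * (2 powr (1 - p / 2) - 1)"
proof -
  define h k \<psi> \<kappa> where "h = (\<lambda>v. g v - f v)" and "k = (\<lambda>v. g v + f v)"
    and "\<psi> = (\<lambda>v. sgn (h v) * jbr v powr p)" and "\<kappa> = 2 powr (1 - p / 2)"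
  have \<kappa>: "1 \<le> \<kappa>" "\<kappa> \<le> 2"
  proof -
    show "1 \<le> \<kappa>" unfolding \<kappa>_def using p by (intro ge_one_powr_ge_zero) auto
    have "2 powr (1 - p / 2) \<le> 2 powr (1::real)" using p by (intro powr_mono) auto
    then show "\<kappa> \<le> 2" by (simp add: \<kappa>_def)
  qed
  have h: "L1w 3 h" "L1w_norm 3 h \<le> 2 * M" unfolding h_def using L1w_diff[OF g(1) f(1)] f g by auto
  have k: "L1w 3 k" "L1w_norm 3 k \<le> 2 * M" unfolding k_def using L1w_add[OF g(1) f(1)] f g by auto
  have le3: "L1w r u" "L1w_norm r u \<le> L1w_norm 3 u" if "L1w 3 u" "r \<le> 3" for u r
    using L1w_mono[OF that] .
  have hp: "L1w p h" "L1w_norm 1 h \<le> L1w_norm p h"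
    using le3[OF h(1), of p] L1w_mono(2)[OF le3(1)[OF h(1), of p], of 1] p by auto
  have M: "0 \<le> M" using f(2) L1w_norm_nonneg[of 3 f] by linarith
  have [measurable]: "h \<in> borel_measurable borel" by (rule L1wD[OF h(1)])
  have \<psi>m[measurable]: "\<psi> \<in> borel_measurable borel" unfolding \<psi>_def by measurable
  have \<psi>\<phi>: "\<bar>\<psi> u\<bar> \<le> 1 * jbr u powr p" for u by (auto simp: \<psi>_def abs_mult abs_sgn_eq)
  have kh: "- k v \<le> - \<bar>k v\<bar> + 2 * \<bar>h v\<bar>" for v unfolding k_def h_def by (rule loss_term_le) (rule f0)
  note kb = admissible_kernel_bound[OF b]
  note sign = dev_tsQ_sign_le[where h = h and k = k and \<psi> = \<psi> and p = p and b = b, folded \<kappa>_def]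
  have p02: "0 \<le> p" "p \<le> 2" using p by auto
  let ?n = "L1w_norm"
  \<comment> \<open>8 comes from two norms bounded by \<open>2 * M\<close> and the coefficient 2; 20
    is 12 + 8, with \<open>\<kappa> + 1 \<le> 3\<close> in the middle term.\<close>
  define B where "B = 8 * M\<^sup>2 * (\<kappa> - 1) + 20 * M * ?n p h"
  have sumB: "2 * (\<kappa> - 1) * (?n (p + 1) h * ?n 1 k) + 2 * (\<kappa> + 1) * (?n 1 h * ?n (p + 1) k) + 4 * (?n (p + 1) h * ?n 1 h) \<le> B"
  proof -
    have b1: "?n (p + 1) h \<le> 2 * M" "?n 1 k \<le> 2 * M" "?n (p + 1) k \<le> 2 * M"
      using le3(2)[OF h(1), of "p + 1"] le3(2)[OF k(1), of "p + 1"] le3(2)[OF k(1), of 1] h k p by auto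
    have "?n (p + 1) h * ?n 1 k \<le> (2 * M) * (2 * M)" "?n 1 h * ?n (p + 1) k \<le> ?n p h * (2 * M)"
      "?n (p + 1) h * ?n 1 h \<le> (2 * M) * ?n p h"
      using mult_mono[OF b1(1,2)] mult_mono[OF hp(2) b1(3)] mult_mono[OF b1(1) hp(2)] M
      by (simp_all add: L1w_norm_nonneg)
    then have "2 * (\<kappa> - 1) * (?n (p + 1) h * ?n 1 k) + 2 * (\<kappa> + 1) * (?n 1 h * ?n (p + 1) k) + 4 * (?n (p + 1) h * ?n 1 h)
      \<le> 2 * (\<kappa> - 1) * ((2 * M) * (2 * M)) + 2 * (2 + 1) * (?n p h * (2 * M)) + 4 * ((2 * M) * ?n p h)"
      using \<kappa> M b1 hp(2) by (intro add_mono mult_mono) (auto simp: L1w_norm_nonneg)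
    also have "\<dots> = B" by (simp add: B_def power2_eq_square algebra_simps)
    finally show ?thesis .
  qed
  note L = L1wD(2)[OF le3(1)[OF h(1)]] L1wD(2)[OF le3(1)[OF k(1)]]
  have L1: "integrable lborel (\<lambda>v. \<bar>h v\<bar> * jbr v)" "integrable lborel (\<lambda>v. \<bar>k v\<bar> * jbr v)"
    using L(1)[of 1] L(2)[of 1] by simp_all
  have Q1: "cint b tsQ h k \<psi> \<le> B"
  proof -
    define F where "F = (\<lambda>i::nat. if i = 0 then (\<lambda>v. 2 * (\<kappa> - 1) * (\<bar>h v\<bar> * jbr v powr (p + 1)))
      else if i = 1 then (\<lambda>v. 2 * (\<kappa> + 1) * (\<bar>h v\<bar> * jbr v powr 1)) else (\<lambda>v. 4 * (\<bar>h v\<bar> * jbr v powr (p + 1))))"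
    define G where "G = (\<lambda>i::nat. if i = 0 then (\<lambda>v. \<bar>k v\<bar> * jbr v powr 1)
      else if i = 1 then (\<lambda>v. \<bar>k v\<bar> * jbr v powr (p + 1)) else (\<lambda>v. \<bar>h v\<bar> * jbr v powr 1))"
    have "cint b tsQ h k \<psi> \<le> (\<Sum>i<(3::nat). (\<integral>v. F i v \<partial>lborel) * (\<integral>w. G i w \<partial>lborel))"
    proof (rule cint_le)
      show "integrable colM (\<lambda>(v, w, x). h v * k w * b (v - w) * dev tsQ \<psi> v w x)"
        by (rule cint_integrable(1)[OF coll_wf_tsQ _ \<psi>m \<psi>\<phi> kb le3(1)[OF h(1)] le3(1)[OF k(1)]]) (use p in auto)
      show "h v * k w * b (v - w) * dev tsQ \<psi> v w x \<le> (\<Sum>i<3. F i v * G i w)" for v w x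
        using sign(1)[OF p02 b kh \<psi>_def, of v w x] unfolding F_def G_def
        by (simp add: eval_nat_numeral add.assoc)
    qed (use L L1 p in \<open>auto simp: F_def G_def\<close>)
    also have "\<dots> = 2 * (\<kappa> - 1) * (?n (p + 1) h * ?n 1 k) + 2 * (\<kappa> + 1) * (?n 1 h * ?n (p + 1) k) + 4 * (?n (p + 1) h * ?n 1 h)"
      unfolding F_def G_def L1w_norm_def by (simp add: eval_nat_numeral add.assoc)
    finally show ?thesis using sumB by linarith
  qed
  have Q2: "cint b tsQ k h \<psi> \<le> B"
  proof -
    define G where "G = (\<lambda>i::nat. if i = 0 then (\<lambda>v. 2 * (\<kappa> - 1) * (\<bar>h v\<bar> * jbr v powr (p + 1)))
      else if i = 1 then (\<lambda>v. 2 * (\<kappa> + 1) * (\<bar>h v\<bar> * jbr v powr 1)) else (\<lambda>v. 4 * (\<bar>h v\<bar> * jbr v powr (p + 1))))"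
    define F where "F = (\<lambda>i::nat. if i = 0 then (\<lambda>v. \<bar>k v\<bar> * jbr v powr 1)
      else if i = 1 then (\<lambda>v. \<bar>k v\<bar> * jbr v powr (p + 1)) else (\<lambda>v. \<bar>h v\<bar> * jbr v powr 1))"
    have "cint b tsQ k h \<psi> \<le> (\<Sum>i<(3::nat). (\<integral>v. F i v \<partial>lborel) * (\<integral>w. G i w \<partial>lborel))"
    proof (rule cint_le)
      show "integrable colM (\<lambda>(v, w, x). k v * h w * b (v - w) * dev tsQ \<psi> v w x)"
        by (rule cint_integrable(1)[OF coll_wf_tsQ _ \<psi>m \<psi>\<phi> kb le3(1)[OF k(1)] le3(1)[OF h(1)]]) (use p in auto)
      show "k v * h w * b (v - w) * dev tsQ \<psi> v w x \<le> (\<Sum>i<3. F i v * G i w)" for v w x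
        using sign(2)[OF p02 b kh \<psi>_def, of v w x] unfolding F_def G_def
        by (simp add: eval_nat_numeral add.assoc mult_ac)
    qed (use L L1 p in \<open>auto simp: F_def G_def\<close>)
    also have "\<dots> = 2 * (\<kappa> - 1) * (?n (p + 1) h * ?n 1 k) + 2 * (\<kappa> + 1) * (?n 1 h * ?n (p + 1) k) + 4 * (?n (p + 1) h * ?n 1 h)"
      unfolding F_def G_def L1w_norm_def
      by (simp add: eval_nat_numeral add.assoc)
    finally show ?thesis using sumB by linarith
  qed
  have p1: "L1w (p + 1) u" if "L1w 3 u" for u using le3(1)[OF that] p by simp
  \<comment> \<open>Polarisation: the two mixed forms in the difference and the sum add up to twice
    the difference of the quadratic ones.\<close>
  have split: "cint b tsQ h k \<psi> + cint b tsQ k h \<psi> = 2 * (cint b tsQ g g \<psi> - cint b tsQ f f \<psi>)"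
    unfolding h_def k_def
      cint_diff_left[OF coll_wf_tsQ p02(1) \<psi>m \<psi>\<phi> kb p1[OF g(1)] p1[OF f(1)] p1[OF k(1)[unfolded k_def]]]
      cint_diff_right[OF coll_wf_tsQ p02(1) \<psi>m \<psi>\<phi> kb p1[OF k(1)[unfolded k_def]] p1[OF g(1)] p1[OF f(1)]]
      cint_add_left[OF coll_wf_tsQ p02(1) \<psi>m \<psi>\<phi> kb p1[OF g(1)] p1[OF f(1)] p1[OF g(1)]]
      cint_add_left[OF coll_wf_tsQ p02(1) \<psi>m \<psi>\<phi> kb p1[OF g(1)] p1[OF f(1)] p1[OF f(1)]]
      cint_add_right[OF coll_wf_tsQ p02(1) \<psi>m \<psi>\<phi> kb p1[OF g(1)] p1[OF g(1)] p1[OF f(1)]]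
      cint_add_right[OF coll_wf_tsQ p02(1) \<psi>m \<psi>\<phi> kb p1[OF f(1)] p1[OF g(1)] p1[OF f(1)]]
    by simp
  have "cint b tsQ g g \<psi> - cint b tsQ f f \<psi> \<le> B" using split Q1 Q2 by (smt (verit))
  then have Q: "tau / 2 * (cint b tsQ g g \<psi> - cint b tsQ f f \<psi>) \<le> tau / 2 * B"
    using tau by (intro mult_left_mono) auto
  have "cint b tsL h F1 \<psi> \<le> 4 * Kc * (?n p h * ?n 5 F1)"
    unfolding \<psi>_def by (rule cint_tsL_sign_le[OF p b h(1)])
  then have Lh: "1 / lam * cint b tsL h F1 \<psi> \<le> 1 / lam * (4 * Kc * (?n p h * ?n 5 F1))"
    using lam by (intro mult_left_mono) auto
  have eq: "cint b tsL h F1 \<psi> = cint b tsL g F1 \<psi> - cint b tsL f F1 \<psi>"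
    unfolding h_def using p F1_L1w'[of "p + 1"]
    by (intro cint_diff_left[OF coll_wf_tsL p02(1) \<psi>m \<psi>\<phi> kb p1[OF g(1)] p1[OF f(1)]]) auto
  have "W b g \<psi> - W b f \<psi> = tau / 2 * (cint b tsQ g g \<psi> - cint b tsQ f f \<psi>) + 1 / lam * cint b tsL h F1 \<psi>"
    unfolding W_def eq by (simp add: algebra_simps diff_divide_distrib)
  also have "\<dots> \<le> tau / 2 * B + 1 / lam * (4 * Kc * (?n p h * ?n 5 F1))"
    using Q Lh by (rule add_mono)
  also have "\<dots> = CA M * ?n p h + 4 * tau * M\<^sup>2 * (\<kappa> - 1)"
    using lam by (simp add: CA_def B_def field_simps)
  finally show ?thesis unfolding \<psi>_def \<kappa>_def h_def .
qed

subsection \<open>The weak formulation as a collision integral\<close>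

text \<open>Both averages are integrals over \<open>sphU\<close> of the lists \<open>tsQ\<close> and
  \<open>tsL\<close>. A bounded observable is of order 0, so the first moment makes the triple
  integral absolutely convergent and Fubini applies.\<close>

lemma weak_form_eq_W:
  assumes f: "L1w 1 f" and \<psi>[measurable]: "\<psi> \<in> borel_measurable borel" and C: "\<And>v. \<bar>\<psi> v\<bar> \<le> C" and ab: "c = 2 * a * (1 - be)"
  shows "tau / 2 * (\<integral>v. (\<integral>w. f v * f w * norm (v - w) * A_op zeta \<psi> v w \<partial>lborel) \<partial>lborel)
      + 1 / lam * (\<integral>v. (\<integral>w. norm (v - w) * f v * F1 w *
          (2 * sphere_avg (\<lambda>n. \<bar>((v - w) /\<^sub>R norm (v - w)) \<bullet> n\<bar> * (\<psi> (vstar a be v w n) - \<psi> v))) \<partial>lborel) \<partial>lborel)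
    = W norm f \<psi>"
proof -
  have C': "\<bar>\<psi> v\<bar> \<le> C * jbr v powr 0" for v using C by simp
  have f': "L1w (0 + 1) f" "L1w (0 + 1) F1" using f F1_L1w'[of 1] by simp_all
  note kb = admissible_kernel_bound[OF admissible_norm]
  have A: "A_op zeta \<psi> v w = (\<integral>x. dev tsQ \<psi> v w x \<partial>sphU)" for v w
    unfolding A_op_def
  proof (subst sphere_avg_eq)
    show "(\<lambda>x. \<psi> (vpost zeta v w (dir x)) + \<psi> (wpost zeta v w (dir x)) - \<psi> v - \<psi> w) \<in> borel_measurable borel"
      unfolding vpost_def wpost_def by measurable
  qed (auto intro!: Bochner_Integration.integral_cong simp: dev_tsQ vpost_eq wpost_eq)
  have vs: "vstar a be v w (dir x) = w + disp_star c (v - w) x" for v w x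
    unfolding ab by (rule vstar_eq)
  have J: "2 * sphere_avg (\<lambda>n. \<bar>((v - w) /\<^sub>R norm (v - w)) \<bullet> n\<bar> * (\<psi> (vstar a be v w n) - \<psi> v)) = (\<integral>x. dev tsL \<psi> v w x \<partial>sphU)" for v w
  proof (subst sphere_avg_eq)
    show "(\<lambda>x. \<bar>((v - w) /\<^sub>R norm (v - w)) \<bullet> dir x\<bar> * (\<psi> (vstar a be v w (dir x)) - \<psi> v)) \<in> borel_measurable borel"
      unfolding vstar_def by measurable
  qed (auto intro!: Bochner_Integration.integral_cong simp: dev_tsL vs wt_def mult.assoc simp flip: integral_mult_right_zero)
  have "cint norm tsQ f f \<psi> = (\<integral>v. (\<integral>w. f v * f w * norm (v - w) * A_op zeta \<psi> v w \<partial>lborel) \<partial>lborel)"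
    unfolding A by (rule cint_iterated[OF cint_integrable(1)[OF coll_wf_tsQ _ \<psi> C' kb f'(1) f'(1)]]) simp
  moreover have "cint norm tsL f F1 \<psi> = (\<integral>v. (\<integral>w. norm (v - w) * f v * F1 w * (\<integral>x. dev tsL \<psi> v w x \<partial>sphU) \<partial>lborel) \<partial>lborel)"
    by (subst cint_iterated[OF cint_integrable(1)[OF coll_wf_tsL _ \<psi> C' kb f']]) (simp_all add: mult_ac)
  ultimately show ?thesis unfolding W_def J by (simp only:)
qed

end

section \<open>Double series and a growth recursion\<close>

text \<open>Tonelli, with one of the sums read as an integral for the counting measure.\<close>

lemma suminf_ennreal_swap:
  fixes g :: "nat \<Rightarrow> nat \<Rightarrow> ennreal"
  shows "(\<Sum>i. \<Sum>j. g i j) = (\<Sum>j. \<Sum>i. g i j)"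
proof -
  have "(\<Sum>i. \<Sum>j. g i j) = (\<integral>\<^sup>+i. (\<Sum>j. g i j) \<partial>count_space UNIV)"
    by (simp add: nn_integral_count_space_nat)
  also have "\<dots> = (\<Sum>j. \<integral>\<^sup>+i. g i j \<partial>count_space UNIV)"
    by (rule nn_integral_suminf) auto
  finally show ?thesis by (simp add: nn_integral_count_space_nat)
qed

text \<open>Each inner series is shifted by \<open>j\<close> and padded with zeros for
  \<open>k < j\<close>; after the exchange of sums the padding cuts the inner sum off at
  \<open>k\<close>.\<close>

lemma suminf_ennreal_diagonal:
  fixes e :: "nat \<Rightarrow> nat \<Rightarrow> ennreal"
  shows "(\<Sum>j. \<Sum>l. e j l) = (\<Sum>k. \<Sum>j\<le>k. e j (k - j))"
proof -
  have "(\<Sum>l. e j l) = (\<Sum>k. if j \<le> k then e j (k - j) else 0)" for j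
  proof -
    have "(\<Sum>k. if j \<le> k then e j (k - j) else 0)
      = (\<Sum>k. if j \<le> k + j then e j (k + j - j) else 0) + (\<Sum>k<j. if j \<le> k then e j (k - j) else 0)"
      by (rule suminf_offset) auto
    then show ?thesis by simp
  qed
  then have "(\<Sum>j. \<Sum>l. e j l) = (\<Sum>j. \<Sum>k. if j \<le> k then e j (k - j) else 0)" by simp
  also have "\<dots> = (\<Sum>k. \<Sum>j. if j \<le> k then e j (k - j) else 0)" by (rule suminf_ennreal_swap)
  also have "\<dots> = (\<Sum>k. \<Sum>j\<le>k. e j (k - j))"
  proof (intro suminf_cong)
    fix k
    have "(\<Sum>j. if j \<le> k then e j (k - j) else 0) = (\<Sum>j\<le>k. if j \<le> k then e j (k - j) else 0)"
      by (rule suminf_finite) auto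
    then show "(\<Sum>j. if j \<le> k then e j (k - j) else 0) = (\<Sum>j\<le>k. e j (k - j))" by simp
  qed
  finally show ?thesis .
qed

text \<open>The recursion \<open>(k + 1) M (k + 1) \<le> D (M 0 + \<dots> + M k)\<close> forces polynomial growth; a
  geometric bound with arbitrary ratio \<open>\<rho> > 1\<close> is all that is needed.\<close>

lemma recursive_average_growth:
  fixes M :: "nat \<Rightarrow> real"
  assumes M0: "\<And>k. 0 \<le> M k" and D: "0 \<le> D"
    and rec: "\<And>k. M (Suc k) \<le> D / real (Suc k) * (\<Sum>j\<le>k. M j)" and \<rho>: "1 < \<rho>"
  shows "\<exists>C\<ge>0. \<forall>k. M k \<le> C * \<rho> ^ k"
proof -
  \<comment> \<open>From \<open>n\<close> on the factor \<open>D / ((\<rho> - 1) * k)\<close> is at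
    most 1, so summing the geometric bound reproduces it; the earlier values are absorbed into
    \<open>C\<close>.\<close>
  obtain n where n: "D / (\<rho> - 1) \<le> real n" using real_arch_simple by blast
  define C where "C = (\<Sum>j\<le>n. M j)"
  have C0: "0 \<le> C" by (simp add: C_def M0 sum_nonneg)
  have "M k \<le> C * \<rho> ^ k" for k
  proof (induction k rule: less_induct)
    case (less k)
    show ?case
    proof (cases "k \<le> n")
      case True
      then have "M k \<le> C" unfolding C_def by (intro member_le_sum) (auto simp: M0)
      also have "\<dots> \<le> C * \<rho> ^ k" using C0 \<rho> by (simp add: mult_le_cancel_left1 one_le_power)
      finally show ?thesis .
    next
      case False
      then obtain k' where k': "k = Suc k'" by (cases k) auto
      have "M k \<le> D / real k * (\<Sum>j\<le>k'. M j)" using rec[of k'] by (simp add: k')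
      also have "\<dots> \<le> D / real k * (\<Sum>j\<le>k'. C * \<rho> ^ j)"
        using less k' D by (intro mult_left_mono sum_mono) auto
      also have "(\<Sum>j\<le>k'. C * \<rho> ^ j) = C * ((\<rho> ^ k - 1) / (\<rho> - 1))"
        using \<rho> geometric_sum[of \<rho> k] by (simp add: sum_distrib_left[symmetric] k' lessThan_Suc_atMost)
      also have "D / real k * (C * ((\<rho> ^ k - 1) / (\<rho> - 1))) = (D / (\<rho> - 1)) / real k * (C * (\<rho> ^ k - 1))"
        by simp
      also have "\<dots> \<le> 1 * (C * (\<rho> ^ k - 1))"
        using n False C0 \<rho> by (intro mult_right_mono) (auto simp: divide_le_eq one_le_power intro: order_trans)
      also have "\<dots> \<le> C * \<rho> ^ k" using C0 by (simp add: algebra_simps)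
      finally show ?thesis .
    qed
  qed
  with C0 show ?thesis by blast
qed

subsection \<open>Wild sums\<close>

text \<open>The equation \<open>f' = a (\<Gamma> f f - f)\<close> with \<open>\<integral> \<Gamma> f g = (\<integral> f) (\<integral> g) / m\<close> and \<open>\<integral> f = m\<close> is
  solved by \<open>f t = (1 - x) (\<Sum>k. x ^ k wild k)\<close> with \<open>x = 1 - exp (- a t)\<close>. Everything is
  nonnegative, so all rearrangements take place in \<open>ennreal\<close>.\<close>

locale wild_sum =
  fixes \<Gamma> :: "(vel \<Rightarrow> ennreal) \<Rightarrow> (vel \<Rightarrow> ennreal) \<Rightarrow> vel \<Rightarrow> ennreal"
    and K :: "(vel \<Rightarrow> ennreal) \<Rightarrow> vel \<Rightarrow> vel \<Rightarrow> ennreal"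
    and f0 :: "vel \<Rightarrow> real" and m A a :: real
  assumes \<Gamma>_measurable: "\<And>f g. f \<in> borel_measurable borel \<Longrightarrow> g \<in> borel_measurable borel \<Longrightarrow> \<Gamma> f g \<in> borel_measurable borel"
    and K_measurable: "\<And>\<psi>. \<psi> \<in> borel_measurable borel \<Longrightarrow> (\<lambda>(v, w). K \<psi> v w) \<in> borel_measurable (borel \<Otimes>\<^sub>M borel)"
    and pairing: "\<And>f g \<psi>. f \<in> borel_measurable borel \<Longrightarrow> g \<in> borel_measurable borel \<Longrightarrow> \<psi> \<in> borel_measurable borel \<Longrightarrow>
      (\<integral>\<^sup>+y. \<Gamma> f g y * \<psi> y \<partial>lborel) = (\<integral>\<^sup>+v. \<integral>\<^sup>+w. f v * g w * K \<psi> v w \<partial>lborel \<partial>lborel)"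
    and K_one: "\<And>v w. K (\<lambda>_. 1) v w = ennreal (1 / m)"
    and K_moment: "\<And>v w. K (\<lambda>v. ennreal (jbr v ^ 4)) v w \<le> ennreal A * (ennreal (jbr v ^ 4) + ennreal (jbr w ^ 4))"
    and f0: "L1w 4 f0" "\<And>v. 0 \<le> f0 v" "(\<integral>v. f0 v \<partial>lborel) = m"
    and m: "0 < m" and A: "0 \<le> A" and a: "0 \<le> a"
begin

text \<open>Writing the solution as (1 - x) times a series \<Phi> in x = 1 - exp(-a t) turns the
  equation into \<Phi>' = \<Gamma> \<Phi> \<Phi>. These are the Taylor coefficients: k + 1 times the
  next one is the Cauchy product of the previous ones.\<close>

fun wild :: "nat \<Rightarrow> vel \<Rightarrow> ennreal" where
  "wild 0 = (\<lambda>v. ennreal (f0 v))"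
| "wild (Suc k) = (\<lambda>v. ennreal (1 / real (Suc k)) * (\<Sum>j\<le>k. \<Gamma> (wild j) (wild (k - j)) v))"

definition coef :: "(vel \<Rightarrow> ennreal) \<Rightarrow> nat \<Rightarrow> ennreal" where
  "coef \<psi> k = (\<integral>\<^sup>+v. wild k v * \<psi> v \<partial>lborel)"

definition Epair :: "(vel \<Rightarrow> ennreal) \<Rightarrow> (vel \<Rightarrow> ennreal) \<Rightarrow> (vel \<Rightarrow> ennreal) \<Rightarrow> ennreal" where
  "Epair \<psi> f g = (\<integral>\<^sup>+v. \<integral>\<^sup>+w. f v * g w * K \<psi> v w \<partial>lborel \<partial>lborel)"

lemma f0_measurable [measurable]: "f0 \<in> borel_measurable borel"
  by (rule L1wD[OF f0(1)])

lemma wild_measurable [measurable]: "wild k \<in> borel_measurable borel"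
proof (induction k rule: less_induct)
  case (less k)
  show ?case
  proof (cases k)
    case (Suc k')
    have [measurable]: "\<Gamma> (wild j) (wild (k' - j)) \<in> borel_measurable borel" if "j \<le> k'" for j
      using that Suc by (intro \<Gamma>_measurable less) auto
    show ?thesis unfolding Suc wild.simps
      by (intro borel_measurable_times_ennreal borel_measurable_const borel_measurable_sum) auto
  qed simp
qed

lemma coef_Suc:
  assumes [measurable]: "\<psi> \<in> borel_measurable borel"
  shows "coef \<psi> (Suc k) = ennreal (1 / real (Suc k)) * (\<Sum>j\<le>k. Epair \<psi> (wild j) (wild (k - j)))"
proof -
  have [measurable]: "\<Gamma> (wild j) (wild (k - j)) \<in> borel_measurable borel" for j
    by (intro \<Gamma>_measurable) auto
  have "coef \<psi> (Suc k) = (\<integral>\<^sup>+v. ennreal (1 / real (Suc k)) * (\<Sum>j\<le>k. \<Gamma> (wild j) (wild (k - j)) v * \<psi> v) \<partial>lborel)"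
    unfolding coef_def wild.simps by (simp add: mult.assoc sum_distrib_right)
  also have "\<dots> = ennreal (1 / real (Suc k)) * (\<Sum>j\<le>k. \<integral>\<^sup>+v. \<Gamma> (wild j) (wild (k - j)) v * \<psi> v \<partial>lborel)"
    by (subst nn_integral_cmult) (auto simp: nn_integral_sum)
  finally show ?thesis unfolding Epair_def by (simp add: pairing)
qed

lemma Epair_bound:
  assumes [measurable]: "f \<in> borel_measurable borel" "g \<in> borel_measurable borel"
  shows "Epair (\<lambda>v. ennreal (jbr v ^ 4)) f g \<le> ennreal A *
    ((\<integral>\<^sup>+v. f v * ennreal (jbr v ^ 4) \<partial>lborel) * (\<integral>\<^sup>+w. g w \<partial>lborel) + (\<integral>\<^sup>+v. f v \<partial>lborel) * (\<integral>\<^sup>+w. g w * ennreal (jbr w ^ 4) \<partial>lborel))"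
proof -
  let ?J = "\<lambda>v. ennreal (jbr v ^ 4)"
  have "Epair ?J f g \<le> (\<integral>\<^sup>+v. \<integral>\<^sup>+w. ennreal A * (f v * ?J v * g w + f v * (g w * ?J w)) \<partial>lborel \<partial>lborel)"
    unfolding Epair_def
  proof (intro nn_integral_mono)
    fix v w
    have "f v * g w * K ?J v w \<le> f v * g w * (ennreal A * (?J v + ?J w))"
      by (intro mult_left_mono K_moment) auto
    then show "f v * g w * K ?J v w \<le> ennreal A * (f v * ?J v * g w + f v * (g w * ?J w))"
      by (simp add: algebra_simps)
  qed
  also have "\<dots> = ennreal A * ((\<integral>\<^sup>+v. f v * ?J v * (\<integral>\<^sup>+w. g w \<partial>lborel) \<partial>lborel) + (\<integral>\<^sup>+v. f v * (\<integral>\<^sup>+w. g w * ?J w \<partial>lborel) \<partial>lborel))"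
    by (simp add: nn_integral_cmult nn_integral_add)
  finally show ?thesis by (simp add: nn_integral_multc)
qed

lemma Epair_one:
  assumes [measurable]: "f \<in> borel_measurable borel" "g \<in> borel_measurable borel"
  shows "Epair (\<lambda>_. 1) f g = (\<integral>\<^sup>+v. f v \<partial>lborel) * (\<integral>\<^sup>+w. g w \<partial>lborel) * ennreal (1 / m)"
  unfolding Epair_def K_one by (simp add: nn_integral_multc nn_integral_cmult)

lemma mass_f0: "(\<integral>\<^sup>+v. ennreal (f0 v) \<partial>lborel) = ennreal m"
proof -
  have "integrable lborel f0"
    using L1wD(2)[OF L1w_mono(1)[OF f0(1), of 0]] f0(2) by simp
  then show ?thesis using f0 by (simp add: nn_integral_eq_integral)
qed

text \<open>\<open>\<Gamma>\<close> applied to two functions of mass m has mass m * m / m, and each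
  coefficient averages k + 1 such terms.\<close>

lemma wild_mass: "(\<integral>\<^sup>+v. wild k v \<partial>lborel) = ennreal m"
proof (induction k rule: less_induct)
  case (less k)
  show ?case
  proof (cases k)
    case 0
    then show ?thesis by (simp add: mass_f0)
  next
    case (Suc k')
    have "(\<integral>\<^sup>+v. wild k v \<partial>lborel) = ennreal (1 / real (Suc k')) * (\<Sum>j\<le>k'. Epair (\<lambda>_. 1) (wild j) (wild (k' - j)))"
      using coef_Suc[of "\<lambda>_. 1" k'] by (simp add: coef_def Suc)
    also have "(\<Sum>j\<le>k'. Epair (\<lambda>_. 1) (wild j) (wild (k' - j))) = (\<Sum>j\<le>k'. ennreal m)"
    proof (rule sum.cong[OF refl])
      fix j assume "j \<in> {..k'}"
      then have "(\<integral>\<^sup>+v. wild j v \<partial>lborel) = ennreal m" "(\<integral>\<^sup>+v. wild (k' - j) v \<partial>lborel) = ennreal m"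
        using less Suc by auto
      then show "Epair (\<lambda>_. 1) (wild j) (wild (k' - j)) = ennreal m"
        using m by (simp add: Epair_one flip: ennreal_mult')
    qed
    also have "\<dots> = ennreal (real (Suc k') * m)"
      using m by (simp add: ennreal_mult ennreal_of_nat_eq_real_of_nat)
    also have "ennreal (1 / real (Suc k')) * ennreal (real (Suc k') * m) = ennreal m"
      using m by (subst ennreal_mult'[symmetric]) (auto simp del: of_nat_Suc)
    finally show ?thesis .
  qed
qed

text \<open>Each term distributes the fourth moment to one of the two factors while the other
  contributes its mass \<open>m\<close>; reversing the summation index makes both halves equal,
  hence the 2.\<close>

lemma moment_Suc:
  "coef (\<lambda>v. ennreal (jbr v ^ 4)) (Suc k) \<le> ennreal (2 * A * m / real (Suc k)) * (\<Sum>j\<le>k. coef (\<lambda>v. ennreal (jbr v ^ 4)) j)"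
proof -
  let ?J = "\<lambda>v. ennreal (jbr v ^ 4)" and ?M = "coef (\<lambda>v. ennreal (jbr v ^ 4))"
  have "coef ?J (Suc k) \<le> ennreal (1 / real (Suc k)) * (\<Sum>j\<le>k. ennreal (A * m) * (?M j + ?M (k - j)))"
  proof (subst coef_Suc, measurable, intro mult_left_mono sum_mono)
    fix j
    have "Epair ?J (wild j) (wild (k - j)) \<le> ennreal A * (?M j * ennreal m + ennreal m * ?M (k - j))"
      using Epair_bound[of "wild j" "wild (k - j)"] by (simp add: wild_mass coef_def)
    also have "\<dots> = ennreal (A * m) * (?M j + ?M (k - j))"
      using A m by (simp add: ennreal_mult algebra_simps)
    finally show "Epair ?J (wild j) (wild (k - j)) \<le> ennreal (A * m) * (?M j + ?M (k - j))" .
  qed auto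
  also have "(\<Sum>j\<le>k. ennreal (A * m) * (?M j + ?M (k - j))) = ennreal (A * m) * (2 * (\<Sum>j\<le>k. ?M j))"
    using sum.nat_diff_reindex[of ?M "Suc k"]
    by (simp add: sum_distrib_left[symmetric] sum.distrib mult_2 lessThan_Suc_atMost)
  also have "ennreal (1 / real (Suc k)) * \<dots> = ennreal (2 * A * m / real (Suc k)) * (\<Sum>j\<le>k. ?M j)"
  proof -
    have "ennreal (2 * A * m / real (Suc k)) = ennreal (1 / real (Suc k)) * (ennreal (A * m) * ennreal 2)"
      using A m by (subst ennreal_mult[symmetric], simp, simp, subst ennreal_mult[symmetric]) (auto simp: mult_ac)
    then show ?thesis by (simp add: mult_ac)
  qed
  finally show ?thesis .
qed


lemma coef_moment_finite: "coef (\<lambda>v. ennreal (jbr v ^ 4)) k < \<infinity>"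
proof (induction k rule: less_induct)
  case (less k)
  let ?M = "coef (\<lambda>v. ennreal (jbr v ^ 4))"
  show ?case
  proof (cases k)
    case 0
    have "integrable lborel (\<lambda>v. f0 v * jbr v ^ 4)" using L1wD(2)[OF f0(1)] f0(2) by simp
    then have "(\<integral>\<^sup>+v. ennreal (f0 v * jbr v ^ 4) \<partial>lborel) < \<infinity>"
      using f0(2) by (simp add: nn_integral_eq_integral)
    then show ?thesis using f0(2) by (simp add: 0 coef_def ennreal_mult)
  next
    case (Suc k')
    have "(\<Sum>j\<le>k'. ?M j) < \<infinity>" using less Suc by (auto simp: ennreal_sum_less_top)
    then have "ennreal (2 * A * m / real (Suc k')) * (\<Sum>j\<le>k'. ?M j) < \<infinity>"
      by (simp add: ennreal_mult_less_top)
    then show ?thesis using moment_Suc[of k'] unfolding Suc by (rule le_less_trans[rotated])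
  qed
qed

lemma coef_mono: "(\<And>v. \<psi> v \<le> \<phi> v) \<Longrightarrow> coef \<psi> k \<le> coef \<phi> k"
  unfolding coef_def by (intro nn_integral_mono mult_left_mono) auto

text \<open>Real coefficients give access to the calculus of power series; nothing is lost for
  observables below the fourth weight, by \<open>coef_moment_finite\<close>.\<close>

definition cr :: "(vel \<Rightarrow> real) \<Rightarrow> nat \<Rightarrow> real" where
  "cr \<psi> k = enn2real (coef (\<lambda>v. ennreal (\<psi> v)) k)"

lemma coef_eq_cr:
  assumes "\<And>v. \<psi> v \<le> jbr v ^ 4"
  shows "coef (\<lambda>v. ennreal (\<psi> v)) k = ennreal (cr \<psi> k)"
proof -
  have "coef (\<lambda>v. ennreal (\<psi> v)) k \<le> coef (\<lambda>v. ennreal (jbr v ^ 4)) k"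
    using assms by (intro coef_mono ennreal_leI)
  then have "coef (\<lambda>v. ennreal (\<psi> v)) k < \<infinity>" using coef_moment_finite by (rule le_less_trans)
  then show ?thesis by (simp add: cr_def)
qed

lemma cr_nonneg: "0 \<le> cr \<psi> k"
  by (simp add: cr_def)

lemma cr_summable:
  assumes \<psi>: "\<And>v. \<psi> v \<le> jbr v ^ 4" and x: "0 \<le> x" "x < 1"
  shows "summable (\<lambda>k. cr \<psi> k * x ^ k)"
proof -
  let ?J = "\<lambda>v. jbr v ^ 4"
  have J: "\<And>v. ?J v \<le> jbr v ^ 4" by simp
  \<comment> \<open>Between 1 and 1 / x: since \<open>x < 1\<close>, both \<open>1 + x < 2\<close>
    and \<open>2 * x < 1 + x\<close>.\<close>
  define \<rho> where "\<rho> = 2 / (1 + x)"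
  have \<rho>: "1 < \<rho>" "x * \<rho> < 1" using x by (auto simp: \<rho>_def field_simps)
  have rec: "cr ?J (Suc k) \<le> 2 * A * m / real (Suc k) * (\<Sum>j\<le>k. cr ?J j)" for k
  proof -
    have "ennreal (cr ?J (Suc k)) \<le> ennreal (2 * A * m / real (Suc k)) * ennreal (\<Sum>j\<le>k. cr ?J j)"
      using moment_Suc[of k] unfolding coef_eq_cr[OF J] by (simp add: sum_ennreal cr_nonneg del: of_nat_Suc)
    also have "\<dots> = ennreal (2 * A * m / real (Suc k) * (\<Sum>j\<le>k. cr ?J j))"
      using A m by (intro ennreal_mult[symmetric] sum_nonneg cr_nonneg) auto
    finally have "ennreal (cr ?J (Suc k)) \<le> ennreal (2 * A * m / real (Suc k) * (\<Sum>j\<le>k. cr ?J j))" .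
    moreover have "0 \<le> 2 * A * m / real (Suc k) * (\<Sum>j\<le>k. cr ?J j)"
      by (intro mult_nonneg_nonneg divide_nonneg_nonneg sum_nonneg cr_nonneg) (use A m in auto)
    ultimately show ?thesis by (simp only: ennreal_le_iff)
  qed
  have "0 \<le> 2 * A * m" using A m by simp
  from recursive_average_growth[of "cr ?J" "2 * A * m" \<rho>, OF cr_nonneg this rec \<rho>(1)]
  obtain C where C: "0 \<le> C" "\<And>k. cr ?J k \<le> C * \<rho> ^ k" by blast
  have le: "cr \<psi> k \<le> C * \<rho> ^ k" for k
  proof -
    have "coef (\<lambda>v. ennreal (\<psi> v)) k \<le> coef (\<lambda>v. ennreal (?J v)) k"
      using \<psi> by (intro coef_mono ennreal_leI)
    then have "cr \<psi> k \<le> cr ?J k" unfolding coef_eq_cr[OF J] coef_eq_cr[OF \<psi>]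
      by (simp add: cr_nonneg)
    then show ?thesis using C(2)[of k] by linarith
  qed
  have "norm (cr \<psi> k * x ^ k) \<le> C * (x * \<rho>) ^ k" for k
  proof -
    have "norm (cr \<psi> k * x ^ k) = cr \<psi> k * x ^ k"
      using x cr_nonneg[of \<psi> k] by (simp add: abs_mult)
    also have "\<dots> \<le> (C * \<rho> ^ k) * x ^ k"
      using x by (intro mult_right_mono le) auto
    also have "\<dots> = C * (x * \<rho>) ^ k" by (simp only: power_mult_distrib mult_ac)
    finally show ?thesis .
  qed
  moreover have "summable (\<lambda>k. C * (x * \<rho>) ^ k)"
  proof (rule summable_mult, rule summable_geometric)
    have "0 \<le> x * \<rho>" using x \<rho>(1) by (intro mult_nonneg_nonneg) auto
    then show "norm (x * \<rho>) < 1" using \<rho>(2) by (simp only: real_norm_def abs_of_nonneg)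
  qed
  ultimately show ?thesis by (rule summable_comparison_test'[where N = 0, rotated])
qed

definition Fx :: "real \<Rightarrow> vel \<Rightarrow> ennreal" where
  "Fx x v = (\<Sum>k. ennreal (x ^ k) * wild k v)"

lemma Fx_measurable [measurable]: "Fx x \<in> borel_measurable borel"
  unfolding Fx_def by measurable

lemma Fx_pairing:
  assumes [measurable]: "\<psi> \<in> borel_measurable borel" and \<psi>: "\<And>v. \<psi> v \<le> jbr v ^ 4" and x: "0 \<le> x" "x < 1"
  shows "(\<integral>\<^sup>+v. Fx x v * ennreal (\<psi> v) \<partial>lborel) = ennreal (\<Sum>k. cr \<psi> k * x ^ k)"
proof -
  have "(\<integral>\<^sup>+v. Fx x v * ennreal (\<psi> v) \<partial>lborel) = (\<integral>\<^sup>+v. (\<Sum>k. ennreal (x ^ k) * (wild k v * ennreal (\<psi> v))) \<partial>lborel)"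
    unfolding Fx_def by (simp add: mult.assoc flip: ennreal_suminf_multc)
  also have "\<dots> = (\<Sum>k. ennreal (x ^ k) * coef (\<lambda>v. ennreal (\<psi> v)) k)"
    by (subst nn_integral_suminf) (auto simp: nn_integral_cmult coef_def)
  also have "\<dots> = (\<Sum>k. ennreal (cr \<psi> k * x ^ k))"
    using x by (simp add: coef_eq_cr[OF \<psi>] ennreal_mult cr_nonneg mult.commute)
  also have "\<dots> = ennreal (\<Sum>k. cr \<psi> k * x ^ k)"
    using cr_summable[OF \<psi> x] x by (intro suminf_ennreal_eq) (auto simp: cr_nonneg summable_sums)
  finally show ?thesis .
qed

lemma Epair_suminf:
  assumes [measurable]: "\<psi> \<in> borel_measurable borel" "\<And>i. f i \<in> borel_measurable borel" "\<And>i. g i \<in> borel_measurable borel"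
  shows "Epair \<psi> (\<lambda>v. \<Sum>i. f i v) (\<lambda>v. \<Sum>i. g i v) = (\<Sum>j. \<Sum>l. Epair \<psi> (f j) (g l))"
proof -
  note [measurable] = K_measurable[OF assms(1)]
  have "Epair \<psi> (\<lambda>v. \<Sum>i. f i v) (\<lambda>v. \<Sum>i. g i v) = (\<integral>\<^sup>+v. \<integral>\<^sup>+w. (\<Sum>l. \<Sum>j. f j v * g l w * K \<psi> v w) \<partial>lborel \<partial>lborel)"
    unfolding Epair_def by (simp flip: ennreal_suminf_multc ennreal_suminf_cmult)
  also have "\<dots> = (\<Sum>l. \<Sum>j. Epair \<psi> (f j) (g l))"
    unfolding Epair_def by (simp add: nn_integral_suminf del: ennreal_suminf_multc ennreal_suminf_cmult)
  finally show ?thesis by (simp add: suminf_ennreal_swap[of "\<lambda>j l. Epair \<psi> (f j) (g l)"])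
qed

lemma Epair_cmult:
  assumes [measurable]: "\<psi> \<in> borel_measurable borel" "f \<in> borel_measurable borel" "g \<in> borel_measurable borel"
  shows "Epair \<psi> (\<lambda>v. r * f v) (\<lambda>v. s * g v) = r * s * Epair \<psi> f g"
proof -
  note [measurable] = K_measurable[OF assms(1)]
  have "Epair \<psi> (\<lambda>v. r * f v) (\<lambda>v. s * g v) = (\<integral>\<^sup>+v. \<integral>\<^sup>+w. (r * s) * (f v * g w * K \<psi> v w) \<partial>lborel \<partial>lborel)"
    unfolding Epair_def by (simp add: mult_ac)
  also have "\<dots> = r * s * Epair \<psi> f g"
    unfolding Epair_def by (simp add: nn_integral_cmult)
  finally show ?thesis .
qed

text \<open>The Cauchy product has k-th coefficient
  \<open>\<Sum>j\<le>k. Epair \<psi> (wild j) (wild (k - j))\<close>, which the recursion identifies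
  with k + 1 times the next coefficient, that is, with the termwise derivative
  \<open>diffs\<close>.\<close>

lemma Epair_Fx:
  assumes [measurable]: "\<psi> \<in> borel_measurable borel" and \<psi>: "\<And>v. \<psi> v \<le> jbr v ^ 4" and x: "0 \<le> x" "x < 1"
  shows "Epair (\<lambda>v. ennreal (\<psi> v)) (Fx x) (Fx x) = ennreal (\<Sum>k. diffs (cr \<psi>) k * x ^ k)"
proof -
  let ?\<psi> = "\<lambda>v. ennreal (\<psi> v)"
  have \<psi>m: "?\<psi> \<in> borel_measurable borel" by measurable
  have "Epair ?\<psi> (Fx x) (Fx x) = (\<Sum>j. \<Sum>l. ennreal (x ^ j) * ennreal (x ^ l) * Epair ?\<psi> (wild j) (wild l))"
    unfolding Fx_def by (simp add: Epair_suminf Epair_cmult)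
  also have "\<dots> = (\<Sum>k. \<Sum>j\<le>k. ennreal (x ^ j) * ennreal (x ^ (k - j)) * Epair ?\<psi> (wild j) (wild (k - j)))"
    by (rule suminf_ennreal_diagonal)
  also have "\<dots> = (\<Sum>k. ennreal (diffs (cr \<psi>) k * x ^ k))"
  proof (intro suminf_cong)
    fix k
    have "(\<Sum>j\<le>k. ennreal (x ^ j) * ennreal (x ^ (k - j)) * Epair ?\<psi> (wild j) (wild (k - j)))
      = ennreal (x ^ k) * (\<Sum>j\<le>k. Epair ?\<psi> (wild j) (wild (k - j)))"
      unfolding sum_distrib_left using x
      by (intro sum.cong refl) (auto simp: ennreal_mult[symmetric] power_add[symmetric])
    also have "(\<Sum>j\<le>k. Epair ?\<psi> (wild j) (wild (k - j))) = ennreal (real (Suc k)) * coef ?\<psi> (Suc k)"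
      unfolding coef_Suc[OF \<psi>m] mult.assoc[symmetric]
      by (subst ennreal_mult'[symmetric]) (auto simp del: of_nat_Suc)
    also have "ennreal (x ^ k) * \<dots> = ennreal (diffs (cr \<psi>) k * x ^ k)"
      using x unfolding coef_eq_cr[OF \<psi>] diffs_def
      by (simp add: ennreal_mult[symmetric] cr_nonneg mult_ac del: of_nat_Suc)
    finally show "(\<Sum>j\<le>k. ennreal (x ^ j) * ennreal (x ^ (k - j)) * Epair ?\<psi> (wild j) (wild (k - j))) = ennreal (diffs (cr \<psi>) k * x ^ k)" .
  qed
  also have "\<dots> = ennreal (\<Sum>k. diffs (cr \<psi>) k * x ^ k)"
  proof (rule suminf_ennreal_eq)
    show "(\<lambda>k. diffs (cr \<psi>) k * x ^ k) sums (\<Sum>k. diffs (cr \<psi>) k * x ^ k)"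
    proof (rule summable_sums, rule termdiff_converges[where K = 1])
      fix y :: real assume "norm y < 1"
      then have "summable (\<lambda>k. norm (cr \<psi> k * y ^ k))"
        using cr_summable[OF \<psi>, of "\<bar>y\<bar>"] cr_nonneg by (simp add: abs_mult power_abs)
      then show "summable (\<lambda>k. cr \<psi> k * y ^ k)" by (rule summable_norm_cancel)
    qed (use x in auto)
  qed (use x in \<open>auto simp: diffs_def cr_nonneg\<close>)
  finally show ?thesis .
qed

text \<open>\<open>exp (- a * t)\<close> is 1 - x. \<open>enn2real\<close> sends the value infinity
  to 0, which happens on a null set only, by \<open>sol_AE\<close>.\<close>

definition sol :: "real \<Rightarrow> vel \<Rightarrow> real" where
  "sol t v = enn2real (ennreal (exp (- a * t)) * Fx (1 - exp (- a * t)) v)"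

lemma sol_measurable [measurable]: "sol t \<in> borel_measurable borel"
  unfolding sol_def by measurable

lemma sol_nonneg: "0 \<le> sol t v"
  by (simp add: sol_def)

lemma sol_0: "sol 0 v = f0 v"
proof -
  have "Fx 0 v = (\<Sum>k\<in>{0}. ennreal (0 ^ k) * wild k v)"
    unfolding Fx_def by (rule suminf_finite) (auto simp: power_0_left)
  then show ?thesis using f0(2) by (simp add: sol_def)
qed

lemma time_change:
  assumes "0 \<le> t"
  shows "0 \<le> 1 - exp (- a * t)" "1 - exp (- a * t) < 1"
  using assms a by auto

lemma jbr_pow4_ge_1: "1 \<le> jbr v ^ 4"
  using jbr_ge_1 by (rule one_le_power)

lemma sol_AE:
  assumes "0 \<le> t"
  shows "AE v in lborel. ennreal (sol t v) = ennreal (exp (- a * t)) * Fx (1 - exp (- a * t)) v"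
proof -
  have "(\<integral>\<^sup>+v. Fx (1 - exp (- a * t)) v * ennreal 1 \<partial>lborel) \<noteq> \<infinity>"
    by (subst Fx_pairing) (auto simp: jbr_pow4_ge_1 time_change[OF assms, simplified] assms a)
  then have "AE v in lborel. Fx (1 - exp (- a * t)) v \<noteq> \<infinity>"
    by (intro nn_integral_PInf_AE) auto
  then show ?thesis
    by eventually_elim (auto simp: sol_def ennreal_mult_eq_top_iff ennreal_enn2real_if)
qed

lemma sol_pairing:
  assumes [measurable]: "\<psi> \<in> borel_measurable borel" and \<psi>: "\<And>v. 0 \<le> \<psi> v" "\<And>v. \<psi> v \<le> jbr v ^ 4" and t: "0 \<le> t"
  shows "integrable lborel (\<lambda>v. sol t v * \<psi> v)"
    and "(\<integral>v. sol t v * \<psi> v \<partial>lborel) = exp (- a * t) * (\<Sum>k. cr \<psi> k * (1 - exp (- a * t)) ^ k)"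
proof -
  let ?x = "1 - exp (- a * t)"
  have S: "0 \<le> (\<Sum>k. cr \<psi> k * ?x ^ k)"
    using cr_summable[OF \<psi>(2) time_change[OF t]] time_change(1)[OF t]
    by (intro suminf_nonneg mult_nonneg_nonneg cr_nonneg zero_le_power) auto
  have "(\<integral>\<^sup>+v. ennreal (sol t v * \<psi> v) \<partial>lborel) = (\<integral>\<^sup>+v. ennreal (exp (- a * t)) * (Fx ?x v * ennreal (\<psi> v)) \<partial>lborel)"
    using sol_AE[OF t] by (intro nn_integral_cong_AE, eventually_elim) (use \<psi> in \<open>auto simp: ennreal_mult'' mult.assoc\<close>)
  also have "\<dots> = ennreal (exp (- a * t) * (\<Sum>k. cr \<psi> k * ?x ^ k))"
    using Fx_pairing[OF assms(1) \<psi>(2) time_change[OF t]] S by (simp add: nn_integral_cmult ennreal_mult)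
  finally have *: "(\<integral>\<^sup>+v. ennreal (sol t v * \<psi> v) \<partial>lborel) = ennreal (exp (- a * t) * (\<Sum>k. cr \<psi> k * ?x ^ k))" .
  have "integrable lborel (\<lambda>v. sol t v * \<psi> v) \<and> (\<integral>v. sol t v * \<psi> v \<partial>lborel) = exp (- a * t) * (\<Sum>k. cr \<psi> k * ?x ^ k)"
    using * S \<psi> by (subst nn_integral_eq_integrable[symmetric]) (auto simp: sol_nonneg)
  then show "integrable lborel (\<lambda>v. sol t v * \<psi> v)" "(\<integral>v. sol t v * \<psi> v \<partial>lborel) = exp (- a * t) * (\<Sum>k. cr \<psi> k * ?x ^ k)"
    by auto
qed

lemma sol_L1w: "0 \<le> t \<Longrightarrow> L1w 4 (sol t)"
  using sol_pairing(1)[of "\<lambda>v. jbr v ^ 4" t] by (simp add: L1w_def sol_nonneg)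

lemma sol_mass:
  assumes "0 \<le> t"
  shows "(\<integral>v. sol t v \<partial>lborel) = m"
proof -
  have cr1: "cr (\<lambda>_. 1) k = m" for k using wild_mass[of k] m by (simp add: cr_def coef_def)
  have "(\<integral>v. sol t v * 1 \<partial>lborel) = exp (- a * t) * (\<Sum>k. m * (1 - exp (- a * t)) ^ k)"
    using sol_pairing(2)[of "\<lambda>_. 1" t] assms by (simp add: cr1 jbr_pow4_ge_1)
  also have "(\<Sum>k. m * (1 - exp (- a * t)) ^ k) = m * (1 / (1 - (1 - exp (- a * t))))"
    using time_change[OF assms] by (subst suminf_mult) (auto simp: suminf_geometric intro!: summable_geometric)
  finally show ?thesis by simp
qed

lemma Epair_sol:
  assumes [measurable]: "\<psi> \<in> borel_measurable borel" and \<psi>: "\<And>v. 0 \<le> \<psi> v" "\<And>v. \<psi> v \<le> jbr v ^ 4" and t: "0 \<le> t"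
  shows "Epair (\<lambda>v. ennreal (\<psi> v)) (\<lambda>v. ennreal (sol t v)) (\<lambda>v. ennreal (sol t v))
    = ennreal ((exp (- a * t))\<^sup>2 * (\<Sum>k. diffs (cr \<psi>) k * (1 - exp (- a * t)) ^ k))"
proof -
  let ?F = "\<lambda>v. ennreal (exp (- a * t)) * Fx (1 - exp (- a * t)) v"
  have "Epair (\<lambda>v. ennreal (\<psi> v)) (\<lambda>v. ennreal (sol t v)) (\<lambda>v. ennreal (sol t v)) = Epair (\<lambda>v. ennreal (\<psi> v)) ?F ?F"
    unfolding Epair_def
  proof (rule nn_integral_cong_AE)
    show "AE v in lborel. (\<integral>\<^sup>+w. ennreal (sol t v) * ennreal (sol t w) * K (\<lambda>v. ennreal (\<psi> v)) v w \<partial>lborel)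
      = (\<integral>\<^sup>+w. ?F v * ?F w * K (\<lambda>v. ennreal (\<psi> v)) v w \<partial>lborel)"
      using sol_AE[OF t]
    proof eventually_elim
      case (elim v)
      show ?case unfolding elim
        by (rule nn_integral_cong_AE, use sol_AE[OF t] in eventually_elim) (simp only:)
    qed
  qed
  also have "\<dots> = ennreal (exp (- a * t)) * ennreal (exp (- a * t)) * Epair (\<lambda>v. ennreal (\<psi> v)) (Fx (1 - exp (- a * t))) (Fx (1 - exp (- a * t)))"
    by (rule Epair_cmult) measurable
  also have "\<dots> = ennreal ((exp (- a * t))\<^sup>2 * (\<Sum>k. diffs (cr \<psi>) k * (1 - exp (- a * t)) ^ k))"
    unfolding Epair_Fx[OF assms(1) \<psi>(2) time_change[OF t]] by (simp add: ennreal_mult' power2_eq_square mult.assoc)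
  finally show ?thesis .
qed

text \<open>Time enters only through an exponential and the argument of a power series, so the
  derivative is termwise differentiation and the chain rule. The time derivative is taken after
  pairing with a fixed observable, never pointwise in \<open>v\<close>.\<close>

lemma sol_derivative:
  assumes \<psi>m[measurable]: "\<psi> \<in> borel_measurable borel" and \<psi>: "\<And>v. 0 \<le> \<psi> v" "\<And>v. \<psi> v \<le> jbr v ^ 4"
    and t: "t \<in> {0..T}"
  shows "((\<lambda>s. \<integral>v. sol s v * \<psi> v \<partial>lborel) has_real_derivative
    a * (enn2real (Epair (\<lambda>v. ennreal (\<psi> v)) (\<lambda>v. ennreal (sol t v)) (\<lambda>v. ennreal (sol t v))) - (\<integral>v. sol t v * \<psi> v \<partial>lborel)))
    (at t within {0..T})"
proof -
  let ?x = "\<lambda>t. 1 - exp (- a * t)"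
  define C where "C = (\<lambda>x. \<Sum>k. cr \<psi> k * x ^ k)"
  define D where "D = (\<Sum>k. diffs (cr \<psi>) k * ?x t ^ k)"
  have t0: "0 \<le> t" using t by auto
  have D0: "0 \<le> (exp (- a * t))\<^sup>2 * D"
  proof -
    have summ: "summable (\<lambda>k. diffs (cr \<psi>) k * ?x t ^ k)"
    proof (rule termdiff_converges[where K = 1])
      fix y :: real assume "norm y < 1"
      then have "summable (\<lambda>k. norm (cr \<psi> k * y ^ k))"
        using cr_summable[OF \<psi>(2), of "\<bar>y\<bar>"] cr_nonneg by (simp add: abs_mult power_abs)
      then show "summable (\<lambda>k. cr \<psi> k * y ^ k)" by (rule summable_norm_cancel)
    qed (use time_change[OF t0] in auto)
    have "0 \<le> D" unfolding D_def
    proof (rule suminf_nonneg[OF summ])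
      show "0 \<le> diffs (cr \<psi>) k * ?x t ^ k" for k
        unfolding diffs_def by (intro mult_nonneg_nonneg zero_le_power cr_nonneg time_change[OF t0]) simp
    qed
    then show ?thesis by simp
  qed
  have "(C has_real_derivative D) (at (?x t))"
    unfolding C_def D_def
  proof (rule termdiffs_strong')
    fix y :: real assume "norm y < 1"
    then have "summable (\<lambda>k. norm (cr \<psi> k * y ^ k))"
      using cr_summable[OF \<psi>(2), of "\<bar>y\<bar>"] cr_nonneg by (simp add: abs_mult power_abs)
    then show "summable (\<lambda>k. cr \<psi> k * y ^ k)" by (rule summable_norm_cancel)
  qed (use time_change[OF t0] in auto)
  moreover have "(?x has_real_derivative a * exp (- a * t)) (at t within {0..T})"
    by (auto intro!: derivative_eq_intros)
  ultimately have "((\<lambda>s. C (?x s)) has_real_derivative D * (a * exp (- a * t))) (at t within {0..T})"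
    by (rule DERIV_chain2)
  moreover have "((\<lambda>s. exp (- a * s)) has_real_derivative - a * exp (- a * t)) (at t within {0..T})"
    by (auto intro!: derivative_eq_intros)
  ultimately have "((\<lambda>s. exp (- a * s) * C (?x s)) has_real_derivative
      (- a * exp (- a * t)) * C (?x t) + D * (a * exp (- a * t)) * exp (- a * t)) (at t within {0..T})"
    by (intro DERIV_mult) auto
  moreover have "(- a * exp (- a * t)) * C (?x t) + D * (a * exp (- a * t)) * exp (- a * t)
    = a * (enn2real (Epair (\<lambda>v. ennreal (\<psi> v)) (\<lambda>v. ennreal (sol t v)) (\<lambda>v. ennreal (sol t v))) - (\<integral>v. sol t v * \<psi> v \<partial>lborel))"
    unfolding Epair_sol[OF \<psi>m \<psi> t0] sol_pairing(2)[OF \<psi>m \<psi> t0] D_def[symmetric]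
    using D0 by (simp add: C_def power2_eq_square algebra_simps)
  ultimately have "((\<lambda>s. exp (- a * s) * C (?x s)) has_real_derivative
    a * (enn2real (Epair (\<lambda>v. ennreal (\<psi> v)) (\<lambda>v. ennreal (sol t v)) (\<lambda>v. ennreal (sol t v))) - (\<integral>v. sol t v * \<psi> v \<partial>lborel)))
    (at t within {0..T})" by simp
  then show ?thesis
    by (rule has_field_derivative_transform_within[where d = 1]) (use t sol_pairing(2)[OF \<psi>m \<psi>] in \<open>auto simp: C_def\<close>)
qed

end

subsection \<open>Gain operators\<close>

text \<open>A density in the outgoing velocity \<open>y\<close>: for given \<open>q\<close> and
  \<open>x\<close> the incoming pair is w = y - R q x, v = w + q. No inversion of a collision map is
  involved.\<close>

definition gain1 :: "(vel \<Rightarrow> vel \<Rightarrow> real) \<Rightarrow> (vel \<Rightarrow> vel \<Rightarrow> vel) \<Rightarrow> (vel \<Rightarrow> ennreal) \<Rightarrow> (vel \<Rightarrow> ennreal) \<Rightarrow> vel \<Rightarrow> ennreal" where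
  "gain1 k R f g y = (\<integral>\<^sup>+z. (case z of (q, x) \<Rightarrow> f (y - R q x + q) * g (y - R q x) * ennreal (k q x)) \<partial>(lborel \<Otimes>\<^sub>M sphU))"

definition gain :: "coll \<Rightarrow> (vel \<Rightarrow> ennreal) \<Rightarrow> (vel \<Rightarrow> ennreal) \<Rightarrow> vel \<Rightarrow> ennreal" where
  "gain ts f g y = (\<Sum>(k, R)\<leftarrow>ts. gain1 k R f g y)"

text \<open>The counterpart of \<open>dev\<close> in \<open>ennreal\<close>. Negative weights would
  be cut to 0 by the coercion, hence the companion condition \<open>coll_nonneg\<close>.\<close>

definition ndev :: "coll \<Rightarrow> (vel \<Rightarrow> ennreal) \<Rightarrow> vel \<Rightarrow> vel \<Rightarrow> vel \<Rightarrow> ennreal" where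
  "ndev ts \<psi> v w x = (\<Sum>(k, R)\<leftarrow>ts. ennreal (k (v - w) x) * \<psi> (w + R (v - w) x))"

definition coll_nonneg :: "coll \<Rightarrow> bool" where
  "coll_nonneg ts \<longleftrightarrow> (\<forall>(k, R) \<in> set ts. \<forall>q x. 0 \<le> k q x)"

lemma gain_simps [simp]:
  "gain [] f g y = 0" "gain ((k, R) # ts) f g y = gain1 k R f g y + gain ts f g y"
  by (auto simp: gain_def)

lemma ndev_simps [simp]:
  "ndev [] \<psi> v w x = 0"
  "ndev ((k, R) # ts) \<psi> v w x = ennreal (k (v - w) x) * \<psi> (w + R (v - w) x) + ndev ts \<psi> v w x"
  by (auto simp: ndev_def)

lemma gain1_measurable:
  assumes [measurable]: "(\<lambda>(q, x). k q x) \<in> borel_measurable (borel \<Otimes>\<^sub>M borel)" "(\<lambda>(q, x). R q x) \<in> borel_measurable (borel \<Otimes>\<^sub>M borel)"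
    "f \<in> borel_measurable borel" "g \<in> borel_measurable borel"
  shows "gain1 k R f g \<in> borel_measurable borel"
  unfolding gain1_def by measurable

lemma gain_measurable:
  assumes "coll_wf K ts" "f \<in> borel_measurable borel" "g \<in> borel_measurable borel"
  shows "gain ts f g \<in> borel_measurable borel"
  using assms(1)
proof (induction ts)
  case Nil
  have "gain [] f g = (\<lambda>_. 0)" by (intro ext) simp
  then show ?case by simp
next
  case (Cons t ts)
  obtain k R where t: "t = (k, R)" by fastforce
  have "gain (t # ts) f g = (\<lambda>y. gain1 k R f g y + gain ts f g y)" by (intro ext) (simp add: t)
  moreover have "gain1 k R f g \<in> borel_measurable borel"
    using Cons.prems assms by (intro gain1_measurable) (auto simp: t coll_wf_Cons)
  moreover have "gain ts f g \<in> borel_measurable borel" using Cons by (auto simp: t coll_wf_Cons)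
  ultimately show ?case by simp
qed

lemma measurable_triple_ennreal:
  fixes F :: "vel \<Rightarrow> vel \<Rightarrow> vel \<Rightarrow> ennreal"
  assumes "(\<lambda>(v, w, x). F v w x) \<in> borel_measurable (borel \<Otimes>\<^sub>M (borel \<Otimes>\<^sub>M borel))"
    and [measurable]: "f1 \<in> borel_measurable M" "f2 \<in> borel_measurable M" "f3 \<in> borel_measurable M"
  shows "(\<lambda>z. F (f1 z) (f2 z) (f3 z)) \<in> borel_measurable M"
proof -
  have "(\<lambda>z. (f1 z, f2 z, f3 z)) \<in> M \<rightarrow>\<^sub>M (borel \<Otimes>\<^sub>M (borel \<Otimes>\<^sub>M borel))" by measurable
  from measurable_compose[OF this assms(1)] show ?thesis by simp
qed

lemma ndev_measurable:
  assumes "coll_wf K ts" and [measurable]: "\<psi> \<in> borel_measurable borel"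
  shows "(\<lambda>(v, w, x). ndev ts \<psi> v w x) \<in> borel_measurable (borel \<Otimes>\<^sub>M (borel \<Otimes>\<^sub>M borel))"
  using assms(1)
proof (induction ts)
  case Nil
  have "ndev [] \<psi> = (\<lambda>_ _ _. 0)" by (intro ext) simp
  then show ?case by simp
next
  case (Cons t ts)
  obtain k R where t: "t = (k, R)" by fastforce
  with Cons have dev: "(\<lambda>(v, w, x). ndev ts \<psi> v w x) \<in> borel_measurable (borel \<Otimes>\<^sub>M (borel \<Otimes>\<^sub>M borel))"
    and [measurable]: "(\<lambda>(q, x). k q x) \<in> borel_measurable (borel \<Otimes>\<^sub>M borel)"
    "(\<lambda>(q, x). R q x) \<in> borel_measurable (borel \<Otimes>\<^sub>M borel)"
    by (auto simp: coll_wf_Cons)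
  note [measurable (raw)] = measurable_triple_ennreal[OF dev]
  show ?case unfolding t ndev_simps by measurable
qed

text \<open>\<open>nn_integral_colM_shift\<close> with \<open>y\<close> as the outgoing velocity:
  the observable is evaluated at \<open>y\<close> and leaves the inner integral.\<close>

lemma gain1_pairing:
  assumes [measurable]: "(\<lambda>(q, x). k q x) \<in> borel_measurable (borel \<Otimes>\<^sub>M borel)" "(\<lambda>(q, x). R q x) \<in> borel_measurable (borel \<Otimes>\<^sub>M borel)"
    "f \<in> borel_measurable borel" "g \<in> borel_measurable borel" "\<psi> \<in> borel_measurable borel"
  shows "(\<integral>\<^sup>+y. gain1 k R f g y * \<psi> y \<partial>lborel) =
    (\<integral>\<^sup>+z. (case z of (v, w, x) \<Rightarrow> f v * g w * (ennreal (k (v - w) x) * \<psi> (w + R (v - w) x))) \<partial>colM)"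
proof -
  have "(\<integral>\<^sup>+z. (case z of (v, w, x) \<Rightarrow> f v * g w * (ennreal (k (v - w) x) * \<psi> (w + R (v - w) x))) \<partial>colM) =
    (\<integral>\<^sup>+y. (\<integral>\<^sup>+z. (case z of (q, x) \<Rightarrow> f (y - R q x + q) * g (y - R q x) * ennreal (k q x) * \<psi> y) \<partial>(lborel \<Otimes>\<^sub>M sphU)) \<partial>lborel)"
    by (subst nn_integral_colM_shift[OF _ assms(2)]) (auto intro!: nn_integral_cong simp: mult_ac)
  also have "\<dots> = (\<integral>\<^sup>+y. gain1 k R f g y * \<psi> y \<partial>lborel)"
    unfolding gain1_def
    by (intro nn_integral_cong, subst nn_integral_multc[symmetric]) (auto intro!: nn_integral_cong)
  finally show ?thesis by simp
qed

lemma gain_pairing: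
  assumes "coll_wf K ts" and [measurable]: "f \<in> borel_measurable borel" "g \<in> borel_measurable borel" "\<psi> \<in> borel_measurable borel"
  shows "(\<integral>\<^sup>+y. gain ts f g y * \<psi> y \<partial>lborel) =
    (\<integral>\<^sup>+z. (case z of (v, w, x) \<Rightarrow> f v * g w * ndev ts \<psi> v w x) \<partial>colM)"
  using assms(1)
proof (induction ts)
  case (Cons t ts)
  obtain k R where t: "t = (k, R)" by fastforce
  with Cons.prems have [measurable]: "(\<lambda>(q, x). k q x) \<in> borel_measurable (borel \<Otimes>\<^sub>M borel)"
    "(\<lambda>(q, x). R q x) \<in> borel_measurable (borel \<Otimes>\<^sub>M borel)" and ts: "coll_wf K ts"
    by (auto simp: coll_wf_Cons)
  have [measurable]: "gain ts f g \<in> borel_measurable borel" "gain1 k R f g \<in> borel_measurable borel"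
    using gain_measurable[OF ts] gain1_measurable by auto
  note [measurable (raw)] = measurable_triple_ennreal[OF ndev_measurable[OF ts assms(4)]]
  have "(\<integral>\<^sup>+y. gain (t # ts) f g y * \<psi> y \<partial>lborel) = (\<integral>\<^sup>+y. gain1 k R f g y * \<psi> y \<partial>lborel) + (\<integral>\<^sup>+y. gain ts f g y * \<psi> y \<partial>lborel)"
    by (simp add: t distrib_right nn_integral_add)
  also have "\<dots> = (\<integral>\<^sup>+z. (case z of (v, w, x) \<Rightarrow> f v * g w * (ennreal (k (v - w) x) * \<psi> (w + R (v - w) x))) +
      (case z of (v, w, x) \<Rightarrow> f v * g w * ndev ts \<psi> v w x) \<partial>colM)"
    unfolding Cons.IH[OF ts] by (subst gain1_pairing) (auto simp: nn_integral_add)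
  also have "\<dots> = (\<integral>\<^sup>+z. (case z of (v, w, x) \<Rightarrow> f v * g w * ndev (t # ts) \<psi> v w x) \<partial>colM)"
    by (intro nn_integral_cong) (auto simp: t algebra_simps)
  finally show ?case .
qed (simp add: case_prod_beta')

lemma nn_integral_colM_iterated:
  fixes G :: "vel \<Rightarrow> vel \<Rightarrow> vel \<Rightarrow> ennreal"
  assumes G: "(\<lambda>(v, w, x). G v w x) \<in> borel_measurable (borel \<Otimes>\<^sub>M (borel \<Otimes>\<^sub>M borel))"
    and [measurable]: "f \<in> borel_measurable borel" "g \<in> borel_measurable borel"
  shows "(\<integral>\<^sup>+z. (case z of (v, w, x) \<Rightarrow> f v * g w * G v w x) \<partial>colM) =
    (\<integral>\<^sup>+v. (\<integral>\<^sup>+w. f v * g w * (\<integral>\<^sup>+x. G v w x \<partial>sphU) \<partial>lborel) \<partial>lborel)"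
proof -
  note [measurable (raw)] = measurable_triple_ennreal[OF G]
  have "(\<integral>\<^sup>+z. (case z of (v, w, x) \<Rightarrow> f v * g w * G v w x) \<partial>colM) =
    (\<integral>\<^sup>+v. (\<integral>\<^sup>+z. (case z of (w, x) \<Rightarrow> f v * g w * G v w x) \<partial>(lborel \<Otimes>\<^sub>M sphU)) \<partial>lborel)"
    unfolding colM_def by (subst lborel_sphU.P.nn_integral_fst[symmetric]) auto
  also have "\<dots> = (\<integral>\<^sup>+v. (\<integral>\<^sup>+w. (\<integral>\<^sup>+x. f v * g w * G v w x \<partial>sphU) \<partial>lborel) \<partial>lborel)"
    by (intro nn_integral_cong, subst sphU.nn_integral_fst[symmetric]) auto
  also have "\<dots> = (\<integral>\<^sup>+v. (\<integral>\<^sup>+w. f v * g w * (\<integral>\<^sup>+x. G v w x \<partial>sphU) \<partial>lborel) \<partial>lborel)"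
    by (intro nn_integral_cong nn_integral_cmult) measurable
  finally show ?thesis .
qed

lemma ndev_eq_dev:
  assumes "coll_nonneg ts" "\<And>v. 0 \<le> \<psi> v"
  shows "ndev ts (\<lambda>v. ennreal (\<psi> v)) v w x = ennreal (dev ts \<psi> v w x) \<and> 0 \<le> dev ts \<psi> v w x"
  using assms(1)
proof (induction ts)
  case (Cons t ts)
  obtain k R where t: "t = (k, R)" by fastforce
  with Cons.prems have k: "\<And>q x. 0 \<le> k q x" "coll_nonneg ts" by (auto simp: coll_nonneg_def)
  with Cons.IH assms(2) show ?case by (auto simp: t ennreal_mult ennreal_plus)
qed simp

lemma dev_le_const:
  assumes "coll_wf K ts" "coll_nonneg ts" "\<And>r. norm r \<le> 3 * norm (v - w) \<Longrightarrow> \<phi> (w + r) \<le> B"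
  shows "dev ts \<phi> v w x \<le> B * dev ts (\<lambda>_. 1) v w x"
  using assms(1,2)
proof (induction ts)
  case (Cons t ts)
  obtain k R where t: "t = (k, R)" by fastforce
  with Cons.prems have k: "0 \<le> k (v - w) x" "norm (R (v - w) x) \<le> 3 * norm (v - w)" "coll_wf K ts" "coll_nonneg ts"
    by (auto simp: coll_nonneg_def coll_wf_Cons)
  have "k (v - w) x * \<phi> (w + R (v - w) x) \<le> k (v - w) x * B"
    using k assms(3) by (intro mult_left_mono) auto
  then show ?case using Cons.IH[OF k(3,4)] by (simp add: t algebra_simps)
qed simp

lemma nn_integral_ndev_eq_cint:
  assumes ts: "coll_wf K ts" "coll_nonneg ts" and \<psi>: "\<psi> \<in> borel_measurable borel" "\<And>v. 0 \<le> \<psi> v" "\<And>v. \<psi> v \<le> jbr v ^ 4"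
    and f: "L1w 4 f" "\<And>v. 0 \<le> f v" and g: "L1w 4 g" "\<And>v. 0 \<le> g v"
  shows "(\<integral>\<^sup>+v. (\<integral>\<^sup>+w. ennreal (f v) * ennreal (g w) * (\<integral>\<^sup>+x. ndev ts (\<lambda>v. ennreal (\<psi> v)) v w x \<partial>sphU) \<partial>lborel) \<partial>lborel)
    = ennreal (cint (\<lambda>_. 1) ts f g \<psi>)" and "0 \<le> cint (\<lambda>_. 1) ts f g \<psi>"
proof -
  have [measurable]: "f \<in> borel_measurable borel" "g \<in> borel_measurable borel" "\<psi> \<in> borel_measurable borel"
    using L1wD f(1) g(1) \<psi> by auto
  have int: "integrable colM (\<lambda>(v, w, x). f v * g w * 1 * dev ts \<psi> v w x)"
    by (rule cint_integrable(1)[OF ts(1) _ \<psi>(1), where p = 4 and r = 0 and C = 1 and B = 1])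
      (use \<psi> f g in \<open>auto simp: kernel_bound_def\<close>)
  note nd = ndev_eq_dev[OF ts(2) \<psi>(2)]
  have nn: "0 \<le> f v * g w * 1 * dev ts \<psi> v w x" for v w x
    using nd f g by (intro mult_nonneg_nonneg) auto
  have m: "(\<lambda>(v, w, x). ndev ts (\<lambda>v. ennreal (\<psi> v)) v w x) \<in> borel_measurable (borel \<Otimes>\<^sub>M (borel \<Otimes>\<^sub>M borel))"
    by (rule ndev_measurable[OF ts(1)]) measurable
  have "(\<integral>\<^sup>+v. (\<integral>\<^sup>+w. ennreal (f v) * ennreal (g w) * (\<integral>\<^sup>+x. ndev ts (\<lambda>v. ennreal (\<psi> v)) v w x \<partial>sphU) \<partial>lborel) \<partial>lborel)
    = (\<integral>\<^sup>+z. (case z of (v, w, x) \<Rightarrow> ennreal (f v) * ennreal (g w) * ndev ts (\<lambda>v. ennreal (\<psi> v)) v w x) \<partial>colM)"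
    by (rule nn_integral_colM_iterated[OF m, symmetric]) auto
  also have "\<dots> = (\<integral>\<^sup>+z. ennreal (case z of (v, w, x) \<Rightarrow> f v * g w * 1 * dev ts \<psi> v w x) \<partial>colM)"
    using nd f g by (intro nn_integral_cong) (auto simp: ennreal_mult)
  also have "\<dots> = ennreal (cint (\<lambda>_. 1) ts f g \<psi>)"
    unfolding cint_def using nn by (intro nn_integral_eq_integral[OF int] AE_I2) (auto split: prod.split)
  finally show "(\<integral>\<^sup>+v. (\<integral>\<^sup>+w. ennreal (f v) * ennreal (g w) * (\<integral>\<^sup>+x. ndev ts (\<lambda>v. ennreal (\<psi> v)) v w x \<partial>sphU) \<partial>lborel) \<partial>lborel)
    = ennreal (cint (\<lambda>_. 1) ts f g \<psi>)" .
  show "0 \<le> cint (\<lambda>_. 1) ts f g \<psi>"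
    unfolding cint_def using nn by (intro Bochner_Integration.integral_nonneg) (auto split: prod.split)
qed

text \<open>Additive, in contrast to \<open>jbr_shift_le\<close>: in the Wild recursion a fourth
  moment may meet only the mass of the other factor, otherwise the recursion would be quadratic in
  the moments.\<close>

lemma jbr_shift_pow4_le:
  assumes "norm r \<le> 3 * norm (v - w)"
  shows "jbr (w + r) ^ 4 \<le> 8 ^ 4 * (jbr v ^ 4 + jbr w ^ 4)"
proof -
  have "norm (w + r) \<le> norm w + 3 * (norm v + norm w)"
    using norm_triangle_ineq[of w r] norm_triangle_ineq4[of v w] assms by (smt (verit))
  then have "jbr (w + r) \<le> 8 * max (jbr v) (jbr w)"
    using jbr_le_Suc_norm[of "w + r"] norm_le_jbr[of v] norm_le_jbr[of w] jbr_ge_1[of v] by (smt (verit))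
  then have "jbr (w + r) ^ 4 \<le> (8 * max (jbr v) (jbr w)) ^ 4" by (intro power_mono) auto
  also have "\<dots> \<le> 8 ^ 4 * (jbr v ^ 4 + jbr w ^ 4)"
    by (cases "jbr v \<le> jbr w") (auto simp: power_mult_distrib max_def)
  finally show ?thesis .
qed

context granular
begin

subsection \<open>Solutions with a truncated kernel\<close>

definition trunc :: "real \<Rightarrow> vel \<Rightarrow> real" where
  "trunc N q = min (norm q) N"

text \<open>A bounded kernel costs no weights, so observables may grow like the fourth weight. This
  admits the moments 2, 3, 4 and the signed weights of the stability estimate as test
  functions.\<close>

definition truncated_evolution :: "real \<Rightarrow> (real \<Rightarrow> vel \<Rightarrow> real) \<Rightarrow> bool" where
  "truncated_evolution N f \<longleftrightarrow> (\<forall>t\<ge>0. L1w 4 (f t) \<and> (\<forall>v. 0 \<le> f t v)) \<and>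
     (\<forall>T t \<psi>. t \<in> {0..T} \<longrightarrow> \<psi> \<in> borel_measurable borel \<longrightarrow> (\<forall>v. \<bar>\<psi> v\<bar> \<le> jbr v ^ 4) \<longrightarrow>
        ((\<lambda>s. \<integral>v. f s v * \<psi> v \<partial>lborel) has_real_derivative W (trunc N) (f t) \<psi>) (at t within {0..T}))"

lemma trunc_bounds: "0 \<le> N \<Longrightarrow> 0 \<le> trunc N q" "trunc N q \<le> N"
  by (auto simp: trunc_def)

lemma trunc_measurable [measurable]: "trunc N \<in> borel_measurable borel"
  unfolding trunc_def [abs_def] by measurable

lemma trunc_admissible: "0 \<le> N \<Longrightarrow> admissible (trunc N)"
  using admissible_min unfolding trunc_def [abs_def] .

lemma trunc_kernel_bound: "0 \<le> N \<Longrightarrow> kernel_bound N 0 (trunc N)"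
  using kernel_bound_min unfolding trunc_def [abs_def] .

text \<open>Total collision frequency with every kernel value replaced by its maximum:
  \<open>N\<close> for pairs of particles, \<open>2 * N\<close> for the host because
  \<open>wt\<close> is at most 2.\<close>

definition rate :: "real \<Rightarrow> real \<Rightarrow> real" where
  "rate N m = tau * N * m + 2 * N / lam"

definition cfQ :: "real \<Rightarrow> real \<Rightarrow> real" where
  "cfQ N m = tau / (2 * rate N m)"

definition cfL :: "real \<Rightarrow> real \<Rightarrow> real" where
  "cfL N m = 1 / (lam * rate N m)"

text \<open>The last two entries are fictitious collisions that keep both velocities and fill the
  kernel up to the constant \<open>N\<close>. Gain and loss increase equally, and the loss becomes a
  constant multiple of the solution. \<open>gainL\<close> does the same for the host.\<close>

definition gainQ :: "real \<Rightarrow> real \<Rightarrow> coll" where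
  "gainQ N m = [(\<lambda>q x. cfQ N m * trunc N q, disp_v zeta),
     (\<lambda>q x. cfQ N m * trunc N q, disp_w zeta),
     (\<lambda>q x. cfQ N m * (N - trunc N q), disp_id),
     (\<lambda>q x. cfQ N m * (N - trunc N q), disp_zero)]"

definition gainL :: "real \<Rightarrow> real \<Rightarrow> coll" where
  "gainL N m = [(\<lambda>q x. cfL N m * (trunc N q * wt q x), disp_star c),
     (\<lambda>q x. cfL N m * (2 * N - trunc N q * wt q x), disp_id)]"

lemma abs_scaled_le:
  fixes r y z :: real
  shows "0 \<le> r \<Longrightarrow> 0 \<le> y \<Longrightarrow> y \<le> z \<Longrightarrow> \<bar>r * y\<bar> \<le> r * z"
  by (simp add: abs_mult mult_left_mono)

lemma trunc_wt_bounds: "0 < N \<Longrightarrow> 0 \<le> trunc N q * wt q x" "0 < N \<Longrightarrow> trunc N q * wt q x \<le> 2 * N"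
proof -
  assume N: "0 < N"
  then show "0 \<le> trunc N q * wt q x" using trunc_bounds wt_bounds by simp
  have "trunc N q * wt q x \<le> N * 2"
    using N trunc_bounds wt_bounds by (intro mult_mono) auto
  then show "trunc N q * wt q x \<le> 2 * N" by simp
qed

context
  fixes N m :: real
  assumes N: "0 < N" and m: "0 < m"
begin

lemma rate_pos: "0 < rate N m"
  unfolding rate_def using N m tau lam by (intro add_nonneg_pos) auto

lemma cf_nonneg: "0 \<le> cfQ N m" "0 \<le> cfL N m"
  using tau lam rate_pos by (auto simp: cfQ_def cfL_def)

lemma rate_cf: "rate N m * (cfQ N m * y) = tau / 2 * y" "rate N m * (cfL N m * y) = 1 / lam * y"
  using rate_pos by (auto simp: cfQ_def cfL_def)

lemma gainQ_wf: "coll_wf (cfQ N m * N) (gainQ N m)" "coll_nonneg (gainQ N m)"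
proof -
  have m1: "(\<lambda>(q, x). cfQ N m * trunc N q) \<in> borel_measurable (borel \<Otimes>\<^sub>M borel)" by measurable
  have m2: "(\<lambda>(q, x). cfQ N m * (N - trunc N q)) \<in> borel_measurable (borel \<Otimes>\<^sub>M borel)" by measurable
  have t: "0 \<le> trunc N q" "trunc N q \<le> N" "0 \<le> N - trunc N q" "N - trunc N q \<le> N" for q
    using trunc_bounds[of N q] N by auto
  note b1 = abs_scaled_le[OF cf_nonneg(1) t(1,2)]
  note b2 = abs_scaled_le[OF cf_nonneg(1) t(3,4)]
  show "coll_wf (cfQ N m * N) (gainQ N m)"
    unfolding gainQ_def coll_wf_Cons
    by (intro conjI allI coll_wf_Nil m1 m2 b1 b2 disp_measurable norm_disp_v_le norm_disp_w_le norm_disp_id_le norm_disp_zero_le zeta)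
  show "coll_nonneg (gainQ N m)"
    unfolding coll_nonneg_def gainQ_def using mult_nonneg_nonneg[OF cf_nonneg(1) t(1)] mult_nonneg_nonneg[OF cf_nonneg(1) t(3)]
    by (simp only: list.set ball_simps prod.case) simp
qed

lemma gainL_wf: "coll_wf (cfL N m * (2 * N)) (gainL N m)" "coll_nonneg (gainL N m)"
proof -
  have m1: "(\<lambda>(q, x). cfL N m * (trunc N q * wt q x)) \<in> borel_measurable (borel \<Otimes>\<^sub>M borel)" by measurable
  have m2: "(\<lambda>(q, x). cfL N m * (2 * N - trunc N q * wt q x)) \<in> borel_measurable (borel \<Otimes>\<^sub>M borel)" by measurable
  have t: "0 \<le> trunc N q * wt q x" "trunc N q * wt q x \<le> 2 * N" "0 \<le> 2 * N - trunc N q * wt q x" "2 * N - trunc N q * wt q x \<le> 2 * N" for q x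
    using trunc_wt_bounds[OF N, of q x] by auto
  note b1 = abs_scaled_le[OF cf_nonneg(2) t(1,2)]
  note b2 = abs_scaled_le[OF cf_nonneg(2) t(3,4)]
  have c': "0 \<le> c" "c \<le> 2" using c by auto
  show "coll_wf (cfL N m * (2 * N)) (gainL N m)"
    unfolding gainL_def coll_wf_Cons
    by (intro conjI allI coll_wf_Nil m1 m2 b1 b2 disp_measurable norm_disp_star_le norm_disp_id_le c')
  show "coll_nonneg (gainL N m)"
    unfolding coll_nonneg_def gainL_def using mult_nonneg_nonneg[OF cf_nonneg(2) t(1)] mult_nonneg_nonneg[OF cf_nonneg(2) t(3)]
    by (simp only: list.set ball_simps prod.case) simp
qed

lemma rate_dev_gainQ: "rate N m * dev (gainQ N m) \<psi> v w x = tau / 2 * (trunc N (v - w) * dev tsQ \<psi> v w x + N * (\<psi> v + \<psi> w))"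
proof -
  have "dev (gainQ N m) \<psi> v w x = cfQ N m * (trunc N (v - w) * dev tsQ \<psi> v w x + N * (\<psi> v + \<psi> w))"
    unfolding gainQ_def dev_Cons dev_Nil dev_tsQ disp_id_def disp_zero_def by (simp add: algebra_simps)
  then show ?thesis by (simp only: rate_cf)
qed

lemma rate_dev_gainL: "rate N m * dev (gainL N m) \<psi> v w x = 1 / lam * (trunc N (v - w) * dev tsL \<psi> v w x + 2 * N * \<psi> v)"
proof -
  have "dev (gainL N m) \<psi> v w x = cfL N m * (trunc N (v - w) * dev tsL \<psi> v w x + 2 * N * \<psi> v)"
    unfolding gainL_def dev_Cons dev_Nil dev_tsL disp_id_def by (simp add: algebra_simps)
  then show ?thesis by (simp only: rate_cf)
qed

lemma dev_gain_one: "dev (gainQ N m) (\<lambda>_. 1) v w x = tau * N / rate N m" "dev (gainL N m) (\<lambda>_. 1) v w x = 2 * N / (lam * rate N m)"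
  using rate_dev_gainQ[of "\<lambda>_. 1" v w x] rate_dev_gainL[of "\<lambda>_. 1" v w x] rate_pos lam
  by (simp_all add: dev_tsQ dev_tsL field_simps)

text \<open>The host term is linear in the solution; the factor \<open>1 / m\<close> times the mass
  of \<open>g\<close> equals 1 on functions of mass \<open>m\<close> and makes the whole operator
  bilinear, as Wild sums require.\<close>

definition Gam :: "(vel \<Rightarrow> ennreal) \<Rightarrow> (vel \<Rightarrow> ennreal) \<Rightarrow> vel \<Rightarrow> ennreal" where
  "Gam f g y = gain (gainQ N m) f g y
    + ennreal (1 / m) * (\<integral>\<^sup>+w. g w \<partial>lborel) * gain (gainL N m) f (\<lambda>v. ennreal (F1 v)) y"

definition Kl :: "(vel \<Rightarrow> ennreal) \<Rightarrow> vel \<Rightarrow> ennreal" where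
  "Kl \<psi> v = (\<integral>\<^sup>+u. ennreal (F1 u) * (\<integral>\<^sup>+x. ndev (gainL N m) \<psi> v u x \<partial>sphU) \<partial>lborel)"

definition Kg :: "(vel \<Rightarrow> ennreal) \<Rightarrow> vel \<Rightarrow> vel \<Rightarrow> ennreal" where
  "Kg \<psi> v w = (\<integral>\<^sup>+x. ndev (gainQ N m) \<psi> v w x \<partial>sphU) + ennreal (1 / m) * Kl \<psi> v"

definition Ag :: real where
  "Ag = 8 ^ 4 * (tau * N / rate N m) + 1 / m * (2 * 8 ^ 4 * (2 * N / (lam * rate N m)) * L1w_norm 4 F1)"

lemma F1_measurable [measurable]: "F1 \<in> borel_measurable borel"
  by (rule L1wD[OF F1_L1w])

lemma nn_integral_F1: "(\<integral>\<^sup>+v. ennreal (F1 v) \<partial>lborel) = 1"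
proof -
  have "integrable lborel F1" using L1wD(2)[OF F1_L1w'[of 0]] F1_nonneg by simp
  then show ?thesis using F1_nonneg F1_mass by (simp add: nn_integral_eq_integral)
qed

lemma nn_integral_F1_moment: "(\<integral>\<^sup>+v. ennreal (F1 v * jbr v ^ 4) \<partial>lborel) = ennreal (L1w_norm 4 F1)"
proof -
  have "integrable lborel (\<lambda>v. F1 v * jbr v ^ 4)" using L1wD(2)[OF F1_L1w'[of 4]] F1_nonneg by simp
  then show ?thesis using F1_nonneg by (simp add: nn_integral_eq_integral L1w_norm_def)
qed

lemma Kl_measurable:
  assumes "\<psi> \<in> borel_measurable borel"
  shows "Kl \<psi> \<in> borel_measurable borel"
proof -
  note [measurable (raw)] = measurable_triple_ennreal[OF ndev_measurable[OF gainL_wf(1) assms]]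
  show ?thesis unfolding Kl_def by measurable
qed

lemma Kg_measurable:
  assumes "\<psi> \<in> borel_measurable borel"
  shows "(\<lambda>(v, w). Kg \<psi> v w) \<in> borel_measurable (borel \<Otimes>\<^sub>M borel)"
proof -
  note [measurable] = Kl_measurable[OF assms]
  note [measurable (raw)] = measurable_triple_ennreal[OF ndev_measurable[OF gainQ_wf(1) assms]]
  show ?thesis unfolding Kg_def by measurable
qed

text \<open>The first form separates the two collision types for evaluation at a solution. The
  second reads the mass of \<open>g\<close> as an integral over \<open>w\<close> against a kernel
  constant in \<open>w\<close>, which gives a single dual kernel.\<close>

lemma Gam_pairing:
  assumes [measurable]: "f \<in> borel_measurable borel" "g \<in> borel_measurable borel" and \<psi>[measurable]: "\<psi> \<in> borel_measurable borel"
  shows "(\<integral>\<^sup>+y. Gam f g y * \<psi> y \<partial>lborel) =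
      (\<integral>\<^sup>+v. \<integral>\<^sup>+w. f v * g w * (\<integral>\<^sup>+x. ndev (gainQ N m) \<psi> v w x \<partial>sphU) \<partial>lborel \<partial>lborel) +
      ennreal (1 / m) * (\<integral>\<^sup>+w. g w \<partial>lborel) * (\<integral>\<^sup>+v. \<integral>\<^sup>+u. f v * ennreal (F1 u) * (\<integral>\<^sup>+x. ndev (gainL N m) \<psi> v u x \<partial>sphU) \<partial>lborel \<partial>lborel)" (is ?A)
    and "(\<integral>\<^sup>+y. Gam f g y * \<psi> y \<partial>lborel) = (\<integral>\<^sup>+v. \<integral>\<^sup>+w. f v * g w * Kg \<psi> v w \<partial>lborel \<partial>lborel)"
proof -
  note [measurable] = gain_measurable[OF gainQ_wf(1) assms(1,2)] gain_measurable[OF gainL_wf(1) assms(1), of "\<lambda>v. ennreal (F1 v)"]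
  note mQ = ndev_measurable[OF gainQ_wf(1) \<psi>] and mL = ndev_measurable[OF gainL_wf(1) \<psi>]
  note [measurable (raw)] = measurable_triple_ennreal[OF mQ] measurable_triple_ennreal[OF mL]
  note [measurable] = Kl_measurable[OF \<psi>]
  have "(\<integral>\<^sup>+y. Gam f g y * \<psi> y \<partial>lborel) = (\<integral>\<^sup>+y. gain (gainQ N m) f g y * \<psi> y +
      ennreal (1 / m) * (\<integral>\<^sup>+w. g w \<partial>lborel) * (gain (gainL N m) f (\<lambda>v. ennreal (F1 v)) y * \<psi> y) \<partial>lborel)"
    unfolding Gam_def by (simp add: distrib_right mult.assoc)
  also have "\<dots> = (\<integral>\<^sup>+y. gain (gainQ N m) f g y * \<psi> y \<partial>lborel)
      + ennreal (1 / m) * (\<integral>\<^sup>+w. g w \<partial>lborel) * (\<integral>\<^sup>+y. gain (gainL N m) f (\<lambda>v. ennreal (F1 v)) y * \<psi> y \<partial>lborel)"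
    by (simp add: nn_integral_add nn_integral_cmult)
  also have "(\<integral>\<^sup>+y. gain (gainQ N m) f g y * \<psi> y \<partial>lborel) = (\<integral>\<^sup>+v. \<integral>\<^sup>+w. f v * g w * (\<integral>\<^sup>+x. ndev (gainQ N m) \<psi> v w x \<partial>sphU) \<partial>lborel \<partial>lborel)"
    by (subst gain_pairing[OF gainQ_wf(1) assms], rule nn_integral_colM_iterated[OF mQ]) auto
  also have "(\<integral>\<^sup>+y. gain (gainL N m) f (\<lambda>v. ennreal (F1 v)) y * \<psi> y \<partial>lborel)
      = (\<integral>\<^sup>+v. \<integral>\<^sup>+u. f v * ennreal (F1 u) * (\<integral>\<^sup>+x. ndev (gainL N m) \<psi> v u x \<partial>sphU) \<partial>lborel \<partial>lborel)"
    by (subst gain_pairing[OF gainL_wf(1) assms(1) _ \<psi>], measurable, rule nn_integral_colM_iterated[OF mL]) auto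
  finally show A: ?A .
  have "(\<integral>\<^sup>+v. \<integral>\<^sup>+u. f v * ennreal (F1 u) * (\<integral>\<^sup>+x. ndev (gainL N m) \<psi> v u x \<partial>sphU) \<partial>lborel \<partial>lborel) = (\<integral>\<^sup>+v. f v * Kl \<psi> v \<partial>lborel)"
    unfolding Kl_def mult.assoc by (intro nn_integral_cong nn_integral_cmult) measurable
  then have "ennreal (1 / m) * (\<integral>\<^sup>+w. g w \<partial>lborel) * (\<integral>\<^sup>+v. \<integral>\<^sup>+u. f v * ennreal (F1 u) * (\<integral>\<^sup>+x. ndev (gainL N m) \<psi> v u x \<partial>sphU) \<partial>lborel \<partial>lborel)
    = (\<integral>\<^sup>+v. \<integral>\<^sup>+w. f v * g w * (ennreal (1 / m) * Kl \<psi> v) \<partial>lborel \<partial>lborel)"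
  proof -
    have "(\<integral>\<^sup>+v. \<integral>\<^sup>+w. f v * g w * (ennreal (1 / m) * Kl \<psi> v) \<partial>lborel \<partial>lborel)
      = (\<integral>\<^sup>+v. \<integral>\<^sup>+w. (ennreal (1 / m) * (f v * Kl \<psi> v)) * g w \<partial>lborel \<partial>lborel)" by (simp add: mult_ac)
    also have "\<dots> = (\<integral>\<^sup>+v. (ennreal (1 / m) * (\<integral>\<^sup>+w. g w \<partial>lborel)) * (f v * Kl \<psi> v) \<partial>lborel)"
      by (intro nn_integral_cong, subst nn_integral_cmult) (auto simp: mult_ac)
    also have "\<dots> = ennreal (1 / m) * (\<integral>\<^sup>+w. g w \<partial>lborel) * (\<integral>\<^sup>+v. f v * Kl \<psi> v \<partial>lborel)"
      by (intro nn_integral_cmult) measurable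
    finally show ?thesis
      using \<open>(\<integral>\<^sup>+v. \<integral>\<^sup>+u. f v * ennreal (F1 u) * (\<integral>\<^sup>+x. ndev (gainL N m) \<psi> v u x \<partial>sphU) \<partial>lborel \<partial>lborel) = (\<integral>\<^sup>+v. f v * Kl \<psi> v \<partial>lborel)\<close>
      by simp
  qed
  with A show "(\<integral>\<^sup>+y. Gam f g y * \<psi> y \<partial>lborel) = (\<integral>\<^sup>+v. \<integral>\<^sup>+w. f v * g w * Kg \<psi> v w \<partial>lborel \<partial>lborel)"
    unfolding Kg_def by (simp add: distrib_left nn_integral_add)
qed

lemma nn_integral_sphU_const: "(\<integral>\<^sup>+x. r \<partial>sphU) = (r :: ennreal)"
  by (simp add: emeasure_sphU_UNIV)

lemma Kg_one: "Kg (\<lambda>_. 1) v w = ennreal (1 / m)"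
proof -
  have Q: "ndev (gainQ N m) (\<lambda>_. 1) v w x = ennreal (tau * N / rate N m)" for v w x
    using ndev_eq_dev[OF gainQ_wf(2), of "\<lambda>_. 1" v w x] by (simp add: dev_gain_one)
  have L: "ndev (gainL N m) (\<lambda>_. 1) v w x = ennreal (2 * N / (lam * rate N m))" for v w x
    using ndev_eq_dev[OF gainL_wf(2), of "\<lambda>_. 1" v w x] by (simp add: dev_gain_one)
  have nn: "0 \<le> tau * N / rate N m" "0 \<le> 2 * N / (lam * rate N m)" using tau N lam rate_pos by auto
  have "Kg (\<lambda>_. 1) v w = ennreal (tau * N / rate N m) + ennreal (1 / m) * ennreal (2 * N / (lam * rate N m))"
    unfolding Kg_def Kl_def Q L nn_integral_sphU_const by (simp add: nn_integral_multc nn_integral_F1)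
  also have "\<dots> = ennreal (tau * N / rate N m + 1 / m * (2 * N / (lam * rate N m)))"
    using nn m by (subst ennreal_mult[symmetric], simp, simp, subst ennreal_plus[symmetric])
      (use rate_pos lam N in auto)
  also have "tau * N / rate N m + 1 / m * (2 * N / (lam * rate N m)) = (tau * N * m + 2 * N / lam) / (m * rate N m)"
    using rate_pos m lam by (simp add: field_simps)
  \<comment> \<open>The value of \<open>rate\<close> is the one for which mass is conserved
    here.\<close>
  also have "tau * N * m + 2 * N / lam = rate N m" by (simp add: rate_def)
  also have "rate N m / (m * rate N m) = 1 / m" using rate_pos by simp
  finally show ?thesis .
qed

lemma Kg_moment: "Kg (\<lambda>v. ennreal (jbr v ^ 4)) v w \<le> ennreal Ag * (ennreal (jbr v ^ 4) + ennreal (jbr w ^ 4))"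
proof -
  define c1 c2 F4 where "c1 = tau * N / rate N m" and "c2 = 2 * N / (lam * rate N m)" and "F4 = L1w_norm 4 F1"
  have nn: "0 \<le> c1" "0 \<le> c2" "0 \<le> F4" using tau N lam rate_pos by (auto simp: c1_def c2_def F4_def L1w_norm_nonneg)
  have Q: "ndev (gainQ N m) (\<lambda>v. ennreal (jbr v ^ 4)) v w x \<le> ennreal (8 ^ 4 * (jbr v ^ 4 + jbr w ^ 4) * c1)" for x
  proof -
    have "dev (gainQ N m) (\<lambda>v. jbr v ^ 4) v w x \<le> 8 ^ 4 * (jbr v ^ 4 + jbr w ^ 4) * dev (gainQ N m) (\<lambda>_. 1) v w x"
      by (rule dev_le_const[OF gainQ_wf]) (rule jbr_shift_pow4_le)
    then show ?thesis
      using ndev_eq_dev[OF gainQ_wf(2), of "\<lambda>v. jbr v ^ 4" v w x]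
      by (auto simp: dev_gain_one c1_def intro!: ennreal_leI)
  qed
  have L: "ndev (gainL N m) (\<lambda>v. ennreal (jbr v ^ 4)) v u x \<le> ennreal (2 * 8 ^ 4 * c2 * (jbr v ^ 4 * jbr u ^ 4))" for u x
  proof -
    have "dev (gainL N m) (\<lambda>v. jbr v ^ 4) v u x \<le> 8 ^ 4 * (jbr v ^ 4 + jbr u ^ 4) * dev (gainL N m) (\<lambda>_. 1) v u x"
      by (rule dev_le_const[OF gainL_wf]) (rule jbr_shift_pow4_le)
    also have "\<dots> = 8 ^ 4 * (jbr v ^ 4 + jbr u ^ 4) * c2" by (simp add: dev_gain_one c2_def)
    also have "\<dots> \<le> 8 ^ 4 * (2 * (jbr v ^ 4 * jbr u ^ 4)) * c2"
      using nn by (intro mult_right_mono mult_left_mono sum_le_twice_prod one_le_power jbr_ge_1) auto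
    finally show ?thesis
      using ndev_eq_dev[OF gainL_wf(2), of "\<lambda>v. jbr v ^ 4" v u x] by (auto intro!: ennreal_leI simp: mult_ac)
  qed
  have "(\<integral>\<^sup>+x. ndev (gainQ N m) (\<lambda>v. ennreal (jbr v ^ 4)) v w x \<partial>sphU) \<le> (\<integral>\<^sup>+x. ennreal (8 ^ 4 * (jbr v ^ 4 + jbr w ^ 4) * c1) \<partial>sphU)"
    by (intro nn_integral_mono Q)
  then have Q': "(\<integral>\<^sup>+x. ndev (gainQ N m) (\<lambda>v. ennreal (jbr v ^ 4)) v w x \<partial>sphU) \<le> ennreal (8 ^ 4 * (jbr v ^ 4 + jbr w ^ 4) * c1)"
    by (simp only: nn_integral_sphU_const)
  have "Kl (\<lambda>v. ennreal (jbr v ^ 4)) v \<le> (\<integral>\<^sup>+u. ennreal (F1 u) * (\<integral>\<^sup>+x. ennreal (2 * 8 ^ 4 * c2 * (jbr v ^ 4 * jbr u ^ 4)) \<partial>sphU) \<partial>lborel)"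
    unfolding Kl_def by (intro nn_integral_mono mult_left_mono L) auto
  also have "\<dots> = (\<integral>\<^sup>+u. ennreal (2 * 8 ^ 4 * c2 * jbr v ^ 4) * ennreal (F1 u * jbr u ^ 4) \<partial>lborel)"
    using F1_nonneg nn unfolding nn_integral_sphU_const
    by (intro nn_integral_cong) (simp add: ennreal_mult[symmetric] mult_ac)
  also have "\<dots> = ennreal (2 * 8 ^ 4 * c2 * jbr v ^ 4) * ennreal F4"
    unfolding F4_def by (subst nn_integral_cmult) (auto simp: nn_integral_F1_moment)
  finally have L': "Kl (\<lambda>v. ennreal (jbr v ^ 4)) v \<le> ennreal (2 * 8 ^ 4 * c2 * jbr v ^ 4 * F4)"
    using nn by (simp add: ennreal_mult[symmetric])
  have "Kg (\<lambda>v. ennreal (jbr v ^ 4)) v w \<le> ennreal (8 ^ 4 * (jbr v ^ 4 + jbr w ^ 4) * c1) + ennreal (1 / m) * ennreal (2 * 8 ^ 4 * c2 * jbr v ^ 4 * F4)"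
    unfolding Kg_def by (intro add_mono Q' mult_left_mono L') auto
  also have "\<dots> = ennreal (8 ^ 4 * (jbr v ^ 4 + jbr w ^ 4) * c1 + 1 / m * (2 * 8 ^ 4 * c2 * jbr v ^ 4 * F4))"
    using nn m by (subst ennreal_mult[symmetric], simp, simp, subst ennreal_plus[symmetric]) auto
  also have "\<dots> \<le> ennreal (Ag * (jbr v ^ 4 + jbr w ^ 4))"
  proof (rule ennreal_leI)
    have "1 / m * (2 * 8 ^ 4 * c2 * F4) * jbr v ^ 4 \<le> 1 / m * (2 * 8 ^ 4 * c2 * F4) * (jbr v ^ 4 + jbr w ^ 4)"
      using nn m by (intro mult_left_mono) auto
    then show "8 ^ 4 * (jbr v ^ 4 + jbr w ^ 4) * c1 + 1 / m * (2 * 8 ^ 4 * c2 * jbr v ^ 4 * F4) \<le> Ag * (jbr v ^ 4 + jbr w ^ 4)"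
      unfolding Ag_def c1_def[symmetric] c2_def[symmetric] F4_def[symmetric] by (simp add: algebra_simps)
  qed
  also have "\<dots> = ennreal Ag * (ennreal (jbr v ^ 4) + ennreal (jbr w ^ 4))"
    by (simp add: ennreal_mult'' ennreal_plus[symmetric] del: ennreal_plus)
  finally show ?thesis .
qed


lemma wild_sum_granular:
  assumes "L1w 4 f0" "\<And>v. 0 \<le> f0 v" "(\<integral>v. f0 v \<partial>lborel) = m"
  shows "wild_sum Gam Kg f0 m Ag (rate N m)"
proof
  show "Gam f g \<in> borel_measurable borel" if [measurable]: "f \<in> borel_measurable borel" "g \<in> borel_measurable borel" for f g
  proof -
    note [measurable] = gain_measurable[OF gainQ_wf(1) that] gain_measurable[OF gainL_wf(1) that(1), of "\<lambda>v. ennreal (F1 v)"]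
    show ?thesis unfolding Gam_def [abs_def] by measurable
  qed
  show "0 \<le> Ag"
    unfolding Ag_def using tau N m lam rate_pos L1w_norm_nonneg[of 4 F1]
    by (intro add_nonneg_nonneg mult_nonneg_nonneg divide_nonneg_nonneg) auto
  show "0 \<le> rate N m" using rate_pos by simp
qed (fact Kg_measurable Gam_pairing(2) Kg_one Kg_moment assms m)+

text \<open>The fictitious collisions contribute \<open>tau * N * m\<close> and
  \<open>2 * N / lam\<close> times the pairing of \<open>f\<close> with \<psi>. Their sum is
  \<open>rate N m\<close>, so the loss removes exactly this contribution.\<close>

lemma cint_gain_eq_W:
  assumes \<psi>[measurable]: "\<psi> \<in> borel_measurable borel" and \<psi>4: "\<And>v. \<bar>\<psi> v\<bar> \<le> jbr v ^ 4"
    and f: "L1w 4 f" "\<And>v. 0 \<le> f v" and mass: "(\<integral>v. f v \<partial>lborel) = m"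
  shows "rate N m * (cint (\<lambda>_. 1) (gainQ N m) f f \<psi> + cint (\<lambda>_. 1) (gainL N m) f F1 \<psi> - (\<integral>v. f v * \<psi> v \<partial>lborel))
    = W (trunc N) f \<psi>"
proof -
  note [measurable] = L1wD(1)[OF f(1)]
  have \<psi>': "\<bar>\<psi> v\<bar> \<le> 1 * jbr v powr 4" for v using \<psi>4 by simp
  have f4: "L1w (4 + 0) f" "L1w (4 + 0) F1" using f F1_L1w'[of 4] by auto
  have k1: "kernel_bound 1 0 (\<lambda>_. 1)" by (auto simp: kernel_bound_def)
  note kN = trunc_kernel_bound[OF less_imp_le[OF N]]
  have f\<psi>: "integrable lborel (\<lambda>v. f v * \<psi> v)"
    by (rule integrable_bound_L1w(1)[OF f(1) \<psi> \<psi>'])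
  have f_int: "integrable lborel f" "integrable lborel F1"
    using L1wD(2)[OF L1w_mono(1)[OF f(1), of 0]] L1wD(2)[OF F1_L1w'[of 0]] f(2) F1_nonneg by auto
  note p1 = integrable_integral_colM_mult[OF f\<psi> f_int(1)]
    and p2 = integrable_integral_colM_mult[OF f_int(1) f\<psi>]
    and p3 = integrable_integral_colM_mult[OF f\<psi> f_int(2)]
  let ?I = "\<integral>v. f v * \<psi> v \<partial>lborel"
  have "rate N m * cint (\<lambda>_. 1) (gainQ N m) f f \<psi> = tau / 2 * (cint (trunc N) tsQ f f \<psi> + N * (?I * m + m * ?I))"
  proof -
    have "rate N m * cint (\<lambda>_. 1) (gainQ N m) f f \<psi> = (\<integral>z. rate N m * (case z of (v, w, x) \<Rightarrow> f v * f w * 1 * dev (gainQ N m) \<psi> v w x) \<partial>colM)"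
      unfolding cint_def by simp
    also have "\<dots> = (\<integral>z. tau / 2 * ((case z of (v, w, x) \<Rightarrow> f v * f w * trunc N (v - w) * dev tsQ \<psi> v w x)
        + N * ((case z of (v, w, x) \<Rightarrow> f v * \<psi> v * f w) + (case z of (v, w, x) \<Rightarrow> f v * (f w * \<psi> w)))) \<partial>colM)"
    proof (intro Bochner_Integration.integral_cong refl)
      fix z :: "vel \<times> vel \<times> vel"
      obtain v w x where z: "z = (v, w, x)" by (cases z)
      have "rate N m * (f v * f w * 1 * dev (gainQ N m) \<psi> v w x) = f v * f w * (rate N m * dev (gainQ N m) \<psi> v w x)" by simp
      also have "\<dots> = tau / 2 * (f v * f w * trunc N (v - w) * dev tsQ \<psi> v w x + N * (f v * \<psi> v * f w + f v * (f w * \<psi> w)))"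
        unfolding rate_dev_gainQ by (simp add: algebra_simps)
      finally show "rate N m * (case z of (v, w, x) \<Rightarrow> f v * f w * 1 * dev (gainQ N m) \<psi> v w x) = tau / 2 * ((case z of (v, w, x) \<Rightarrow> f v * f w * trunc N (v - w) * dev tsQ \<psi> v w x)
        + N * ((case z of (v, w, x) \<Rightarrow> f v * \<psi> v * f w) + (case z of (v, w, x) \<Rightarrow> f v * (f w * \<psi> w))))"
        by (simp add: z)
    qed
    also have "\<dots> = tau / 2 * (cint (trunc N) tsQ f f \<psi> + N * (?I * m + m * ?I))"
      unfolding integral_mult_right_zero
      by (subst Bochner_Integration.integral_add)
        (use cint_integrable(1)[OF coll_wf_tsQ _ \<psi> \<psi>' kN f4(1) f4(1)] p1 p2 in \<open>auto simp: cint_def mass\<close>)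
    finally show ?thesis .
  qed
  moreover have "rate N m * cint (\<lambda>_. 1) (gainL N m) f F1 \<psi> = 1 / lam * (cint (trunc N) tsL f F1 \<psi> + 2 * N * ?I)"
  proof -
    have "rate N m * cint (\<lambda>_. 1) (gainL N m) f F1 \<psi> = (\<integral>z. rate N m * (case z of (v, w, x) \<Rightarrow> f v * F1 w * 1 * dev (gainL N m) \<psi> v w x) \<partial>colM)"
      unfolding cint_def by simp
    also have "\<dots> = (\<integral>z. 1 / lam * ((case z of (v, w, x) \<Rightarrow> f v * F1 w * trunc N (v - w) * dev tsL \<psi> v w x)
        + 2 * N * (case z of (v, w, x) \<Rightarrow> f v * \<psi> v * F1 w)) \<partial>colM)"
    proof (intro Bochner_Integration.integral_cong refl)
      fix z :: "vel \<times> vel \<times> vel"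
      obtain v w x where z: "z = (v, w, x)" by (cases z)
      have "rate N m * (f v * F1 w * 1 * dev (gainL N m) \<psi> v w x) = f v * F1 w * (rate N m * dev (gainL N m) \<psi> v w x)" by simp
      also have "\<dots> = 1 / lam * (f v * F1 w * trunc N (v - w) * dev tsL \<psi> v w x + 2 * N * (f v * \<psi> v * F1 w))"
        unfolding rate_dev_gainL by (simp add: algebra_simps)
      finally show "rate N m * (case z of (v, w, x) \<Rightarrow> f v * F1 w * 1 * dev (gainL N m) \<psi> v w x) = 1 / lam * ((case z of (v, w, x) \<Rightarrow> f v * F1 w * trunc N (v - w) * dev tsL \<psi> v w x)
        + 2 * N * (case z of (v, w, x) \<Rightarrow> f v * \<psi> v * F1 w))"
        by (simp add: z)
    qed
    also have "\<dots> = 1 / lam * (cint (trunc N) tsL f F1 \<psi> + 2 * N * ?I)"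
      unfolding integral_mult_right_zero
      by (subst Bochner_Integration.integral_add)
        (use cint_integrable(1)[OF coll_wf_tsL _ \<psi> \<psi>' kN f4] p3 in \<open>auto simp: cint_def F1_mass\<close>)
    finally show ?thesis .
  qed
  ultimately show ?thesis
    unfolding W_def rate_def by (simp add: algebra_simps)
qed

end

lemma truncated_evolution_exists:
  assumes N: "0 < N" and f0: "L1w 4 f0" "\<And>v. 0 \<le> f0 v" and m: "0 < (\<integral>v. f0 v \<partial>lborel)"
  shows "\<exists>f. truncated_evolution N f \<and> (\<forall>v. f 0 v = f0 v)"
proof -
  define m where "m = (\<integral>v. f0 v \<partial>lborel)"
  have mpos: "0 < m" using m by (simp add: m_def)
  interpret wild_sum "Gam N m" "Kg N m" f0 m "Ag N m" "rate N m"
    by (rule wild_sum_granular[OF N mpos f0]) (simp add: m_def)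
  have nonneg: "((\<lambda>s. \<integral>v. sol s v * \<psi> v \<partial>lborel) has_real_derivative W (trunc N) (sol t) \<psi>) (at t within {0..T})"
    if \<psi>[measurable]: "\<psi> \<in> borel_measurable borel" and \<psi>4: "\<And>v. 0 \<le> \<psi> v" "\<And>v. \<psi> v \<le> jbr v ^ 4" and t: "t \<in> {0..T}" for \<psi> t T
  proof -
    have t0: "0 \<le> t" using t by auto
    let ?f = "\<lambda>v. ennreal (sol t v)" and ?\<psi> = "\<lambda>v. ennreal (\<psi> v)"
    note s4 = sol_L1w[OF t0]
    have F4: "L1w 4 F1" by (rule F1_L1w') simp
    have mass: "(\<integral>\<^sup>+w. ?f w \<partial>lborel) = ennreal m"
    proof -
      have "integrable lborel (sol t)" using L1wD(2)[OF L1w_mono(1)[OF s4, of 0]] sol_nonneg by simp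
      then show ?thesis using sol_mass[OF t0] sol_nonneg by (simp add: nn_integral_eq_integral)
    qed
    note Q = nn_integral_ndev_eq_cint[OF gainQ_wf[OF N mpos] \<psi> \<psi>4 s4 sol_nonneg s4 sol_nonneg]
    note L = nn_integral_ndev_eq_cint[OF gainL_wf[OF N mpos] \<psi> \<psi>4 s4 sol_nonneg F4 F1_nonneg]
    have "Epair ?\<psi> ?f ?f = (\<integral>\<^sup>+y. Gam N m ?f ?f y * ?\<psi> y \<partial>lborel)"
      unfolding Epair_def by (rule Gam_pairing(2)[OF N mpos, symmetric]) auto
    also have "\<dots> = ennreal (cint (\<lambda>_. 1) (gainQ N m) (sol t) (sol t) \<psi>)
        + ennreal (1 / m) * ennreal m * ennreal (cint (\<lambda>_. 1) (gainL N m) (sol t) F1 \<psi>)"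
      by (subst Gam_pairing(1)[OF N mpos]) (auto simp: Q(1) L(1) mass)
    also have "ennreal (1 / m) * ennreal m = 1"
      using mpos by (subst ennreal_mult[symmetric]) auto
    also have "ennreal (cint (\<lambda>_. 1) (gainQ N m) (sol t) (sol t) \<psi>) + 1 * ennreal (cint (\<lambda>_. 1) (gainL N m) (sol t) F1 \<psi>)
      = ennreal (cint (\<lambda>_. 1) (gainQ N m) (sol t) (sol t) \<psi> + cint (\<lambda>_. 1) (gainL N m) (sol t) F1 \<psi>)"
      using Q(2) L(2) by (simp add: ennreal_plus)
    finally have E: "enn2real (Epair ?\<psi> ?f ?f) = cint (\<lambda>_. 1) (gainQ N m) (sol t) (sol t) \<psi> + cint (\<lambda>_. 1) (gainL N m) (sol t) F1 \<psi>"
      using Q(2) L(2) by (simp del: ennreal_plus)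
    have "\<bar>\<psi> v\<bar> \<le> jbr v ^ 4" for v using \<psi>4 by (simp add: abs_of_nonneg)
    from cint_gain_eq_W[OF N mpos \<psi> this s4 sol_nonneg sol_mass[OF t0]]
    show ?thesis using sol_derivative[OF \<psi> \<psi>4 t] unfolding E by simp
  qed
  have "truncated_evolution N sol"
    unfolding truncated_evolution_def
  proof (intro conjI allI impI)
    fix T t :: real and \<psi> :: "vel \<Rightarrow> real"
    assume t: "t \<in> {0..T}" and \<psi>[measurable]: "\<psi> \<in> borel_measurable borel" and le: "\<forall>v. \<bar>\<psi> v\<bar> \<le> jbr v ^ 4"
    \<comment> \<open>The series argument in \<open>ennreal\<close> handles nonnegative observables;
      signed ones are differences of positive and negative parts.\<close>
    define \<psi>1 \<psi>2 where "\<psi>1 = (\<lambda>v. max (\<psi> v) 0)" and "\<psi>2 = (\<lambda>v. max (- \<psi> v) 0)"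
    have m12[measurable]: "\<psi>1 \<in> borel_measurable borel" "\<psi>2 \<in> borel_measurable borel" unfolding \<psi>1_def \<psi>2_def by measurable
    have b: "0 \<le> \<psi>1 v" "0 \<le> \<psi>2 v" "\<psi>1 v \<le> jbr v ^ 4" "\<psi>2 v \<le> jbr v ^ 4" for v
      using le[rule_format, of v] by (auto simp: \<psi>1_def \<psi>2_def)
    have b': "\<bar>\<psi>1 v\<bar> \<le> 1 * jbr v powr 4" "\<bar>\<psi>2 v\<bar> \<le> 1 * jbr v powr 4" for v using b[of v] by simp_all
    have eq: "\<psi> = (\<lambda>v. 1 * \<psi>1 v + (- 1) * \<psi>2 v)" by (auto simp: \<psi>1_def \<psi>2_def max_def)
    have t0: "0 \<le> t" using t by auto
    have s4: "L1w (4 + 0) (sol t)" "L1w (4 + 0) F1" using sol_L1w[OF t0] F1_L1w'[of 4] by auto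
    note kN = trunc_kernel_bound[OF less_imp_le[OF N]]
    have W: "W (trunc N) (sol t) \<psi> = W (trunc N) (sol t) \<psi>1 - W (trunc N) (sol t) \<psi>2"
      unfolding eq W_def
        cint_linear_test[OF coll_wf_tsQ _ m12(1) b'(1) m12(2) b'(2) kN s4(1) s4(1), simplified]
        cint_linear_test[OF coll_wf_tsL _ m12(1) b'(1) m12(2) b'(2) kN s4, simplified]
      by (simp add: algebra_simps diff_divide_distrib)
    have "((\<lambda>s. (\<integral>v. sol s v * \<psi>1 v \<partial>lborel) - (\<integral>v. sol s v * \<psi>2 v \<partial>lborel)) has_real_derivative W (trunc N) (sol t) \<psi>) (at t within {0..T})"
      unfolding W by (intro DERIV_diff nonneg m12 b t)
    then show "((\<lambda>s. \<integral>v. sol s v * \<psi> v \<partial>lborel) has_real_derivative W (trunc N) (sol t) \<psi>) (at t within {0..T})"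
    proof (rule has_field_derivative_transform_within[where d = 1])
      fix s assume "s \<in> {0..T}"
      then have s0: "0 \<le> s" by simp
      show "(\<integral>v. sol s v * \<psi>1 v \<partial>lborel) - (\<integral>v. sol s v * \<psi>2 v \<partial>lborel) = (\<integral>v. sol s v * \<psi> v \<partial>lborel)"
        using sol_pairing(1)[OF m12(1) b(1,3) s0] sol_pairing(1)[OF m12(2) b(2,4) s0]
        by (subst Bochner_Integration.integral_diff[symmetric]) (auto simp: eq algebra_simps)
    qed (use t in auto)
  qed (auto simp: sol_L1w sol_nonneg)
  then show ?thesis using sol_0 by blast
qed

end

subsection \<open>Completeness of the weighted spaces\<close>

lemma L1w_norm_nn_integral:
  assumes "L1w p f"
  shows "(\<integral>\<^sup>+v. ennreal (\<bar>f v\<bar> * jbr v powr p) \<partial>lborel) = ennreal (L1w_norm p f)"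
  unfolding L1w_norm_def by (rule nn_integral_eq_integral[OF L1wD(2)[OF assms]]) auto

text \<open>Besides completeness, this preserves the third-moment bound in the limit, where
  convergence is known in weight 2 only.\<close>

lemma L1w_fatou:
  assumes g: "\<And>j. L1w p (g j)" "\<And>j. L1w_norm p (g j) \<le> M" and h: "h \<in> borel_measurable borel"
    and lim: "AE v in lborel. (\<lambda>j. g j v) \<longlonglongrightarrow> h v"
  shows "L1w p h" "L1w_norm p h \<le> M"
proof -
  note [measurable] = L1wD(1)[OF g(1)] h
  have M: "0 \<le> M" using g(2)[of 0] L1w_norm_nonneg[of p "g 0"] by linarith
  have "(\<integral>\<^sup>+v. ennreal (\<bar>h v\<bar> * jbr v powr p) \<partial>lborel) = (\<integral>\<^sup>+v. liminf (\<lambda>j. ennreal (\<bar>g j v\<bar> * jbr v powr p)) \<partial>lborel)"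
  proof (rule nn_integral_cong_AE)
    show "AE v in lborel. ennreal (\<bar>h v\<bar> * jbr v powr p) = liminf (\<lambda>j. ennreal (\<bar>g j v\<bar> * jbr v powr p))"
      using lim
    proof eventually_elim
      case (elim v)
      then have "(\<lambda>j. ennreal (\<bar>g j v\<bar> * jbr v powr p)) \<longlonglongrightarrow> ennreal (\<bar>h v\<bar> * jbr v powr p)"
        by (intro tendsto_ennrealI tendsto_mult_right tendsto_rabs)
      then show ?case by (intro lim_imp_Liminf[symmetric]) auto
    qed
  qed
  also have "\<dots> \<le> liminf (\<lambda>j. \<integral>\<^sup>+v. ennreal (\<bar>g j v\<bar> * jbr v powr p) \<partial>lborel)"
    by (rule nn_integral_liminf) measurable
  also have "\<dots> = liminf (\<lambda>j. ennreal (L1w_norm p (g j)))"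
    by (simp only: L1w_norm_nn_integral[OF g(1)])
  also have "\<dots> \<le> liminf (\<lambda>j. ennreal M)"
    by (intro Liminf_mono always_eventually allI ennreal_leI g(2))
  also have "\<dots> = ennreal M" by (simp add: Liminf_const)
  finally have le: "(\<integral>\<^sup>+v. ennreal (\<bar>h v\<bar> * jbr v powr p) \<partial>lborel) \<le> ennreal M" .
  then have "integrable lborel (\<lambda>v. \<bar>h v\<bar> * jbr v powr p)"
    by (intro integrableI_bounded) (auto simp: top.extremum_strict intro: le_less_trans)
  then show hp: "L1w p h" by (simp add: L1w_def)
  show "L1w_norm p h \<le> M" using le M unfolding L1w_norm_nn_integral[OF hp] by (simp add: L1w_norm_nonneg)
qed

text \<open>Geometric Cauchy bounds make the telescoping series converge almost everywhere without
  passing to a subsequence. The explicit formula chooses the limit uniformly in a parameter, and the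
  maximum with 0 gives nonnegativity at every point, also where the sequence diverges.\<close>

lemma L1w_cauchy_limit:
  assumes g: "\<And>j. L1w p (g j)" and C: "\<And>j l. j \<le> l \<Longrightarrow> L1w_norm p (\<lambda>v. g l v - g j v) \<le> C * (1/2) ^ j"
    and g0: "\<And>j v. 0 \<le> g j v"
  defines "h \<equiv> (\<lambda>v. max 0 (lim (\<lambda>j. g j v)))"
  shows "h \<in> borel_measurable borel" "AE v in lborel. (\<lambda>j. g j v) \<longlonglongrightarrow> h v"
    "L1w p h" "L1w_norm p (\<lambda>v. h v - g j v) \<le> C * (1/2) ^ j"
proof -
  note [measurable] = L1wD(1)[OF g]
  show hm[measurable]: "h \<in> borel_measurable borel"
    unfolding h_def by (intro borel_measurable_max borel_measurable_const borel_measurable_lim_metric) auto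
  let ?d = "\<lambda>j v. \<bar>g (Suc j) v - g j v\<bar> * jbr v powr p"
  have "(\<integral>\<^sup>+v. (\<Sum>j. ennreal (?d j v)) \<partial>lborel) = (\<Sum>j. \<integral>\<^sup>+v. ennreal (?d j v) \<partial>lborel)"
    by (rule nn_integral_suminf) measurable
  also have "\<dots> \<le> (\<Sum>j. ennreal (C * (1/2) ^ j))"
  proof (rule suminf_le)
    show "(\<integral>\<^sup>+v. ennreal (?d j v) \<partial>lborel) \<le> ennreal (C * (1/2) ^ j)" for j
      unfolding L1w_norm_nn_integral[OF L1w_diff(1)[OF g g]] by (intro ennreal_leI C) simp
  qed auto
  also have "\<dots> = ennreal (\<Sum>j. C * (1/2) ^ j)"
  proof (rule suminf_ennreal_eq)
    show "0 \<le> C * (1/2) ^ j" for j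
      using C[of j j] by (simp add: L1w_norm_def)
    show "(\<lambda>j. C * (1/2) ^ j) sums (\<Sum>j. C * (1/2) ^ j)" by (intro summable_sums summable_mult summable_geometric) simp
  qed
  finally have fin: "(\<integral>\<^sup>+v. (\<Sum>j. ennreal (?d j v)) \<partial>lborel) < \<infinity>"
    by (rule le_less_trans) simp
  have "AE v in lborel. (\<Sum>j. ennreal (?d j v)) \<noteq> \<infinity>"
    by (rule nn_integral_PInf_AE) (use fin in \<open>auto simp: less_top\<close>)
  then show lim: "AE v in lborel. (\<lambda>j. g j v) \<longlonglongrightarrow> h v"
  proof eventually_elim
    case (elim v)
    then have "summable (\<lambda>j. ?d j v)" by (intro summable_suminf_not_top) auto
    then have "summable (\<lambda>j. ?d j v * (1 / jbr v powr p))" by (rule summable_mult2)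
    then have "summable (\<lambda>j. norm (g (Suc j) v - g j v))" by simp
    then have "summable (\<lambda>j. g (Suc j) v - g j v)" by (rule summable_norm_cancel)
    then have "convergent (\<lambda>n. \<Sum>j<n. g (Suc j) v - g j v)" by (simp add: summable_iff_convergent)
    then have "convergent (\<lambda>n. g n v - g 0 v)" using sum_lessThan_telescope[of "\<lambda>j. g j v"] by simp
    then have "convergent (\<lambda>n. g n v)" by (simp add: convergent_diff_const_right_iff)
    then have L: "(\<lambda>j. g j v) \<longlonglongrightarrow> lim (\<lambda>j. g j v)" by (simp add: convergent_LIMSEQ_iff)
    then have "0 \<le> lim (\<lambda>j. g j v)" by (rule LIMSEQ_le_const) (use g0 in auto)
    then show ?case using L by (simp add: h_def max_def)
  qed
  \<comment> \<open>With \<open>j\<close> fixed and the running index shifted to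
    \<open>l + j\<close>, the Cauchy bound holds along the whole sequence given to Fatou.\<close>
  have lim': "AE v in lborel. (\<lambda>l. g (l + j) v - g j v) \<longlonglongrightarrow> h v - g j v" for j
    using lim by eventually_elim (intro tendsto_diff tendsto_const LIMSEQ_ignore_initial_segment)
  have d: "L1w p (\<lambda>v. g (l + j) v - g j v)" "L1w_norm p (\<lambda>v. g (l + j) v - g j v) \<le> C * (1/2) ^ j" for l j
    by (auto intro: L1w_diff g C)
  have hd[measurable]: "(\<lambda>v. h v - g j v) \<in> borel_measurable borel" for j by measurable
  note fat = L1w_fatou[of p "\<lambda>l v. g (l + j) v - g j v" "C * (1/2) ^ j" "\<lambda>v. h v - g j v" for j, OF d hd lim']
  show "L1w_norm p (\<lambda>v. h v - g j v) \<le> C * (1/2) ^ j" by (rule fat(2))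
  show "L1w p h" using L1w_add(1)[OF fat(1)[of 0] g[of 0]] by simp
qed

lemma L1w_norm_zero_AE:
  assumes "L1w p f" "L1w_norm p f \<le> 0"
  shows "AE v in lborel. f v = 0"
proof -
  have "L1w_norm p f = 0" using assms(2) L1w_norm_nonneg[of p f] by linarith
  then have "AE v in lborel. \<bar>f v\<bar> * jbr v powr p = 0"
    using L1wD(2)[OF assms(1)] unfolding L1w_norm_def by (subst (asm) integral_nonneg_eq_0_iff_AE) auto
  then show ?thesis by eventually_elim simp
qed

lemma L1w_norm_sgn:
  assumes h: "L1w p h"
  shows "(\<integral>v. h v * (sgn (h v) * jbr v powr p) \<partial>lborel) = L1w_norm p h"
  unfolding L1w_norm_def
  by (intro Bochner_Integration.integral_cong refl) (simp add: mult.assoc[symmetric], simp add: abs_sgn mult.commute)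

text \<open>Convexity of the absolute value: freezing the sign at the later time bounds the
  increment of the norm from above.\<close>

lemma L1w_norm_diff_le_sgn:
  assumes h: "L1w p h" and k: "L1w p k"
  shows "L1w_norm p h - L1w_norm p k \<le> (\<integral>v. h v * (sgn (h v) * jbr v powr p) \<partial>lborel) - (\<integral>v. k v * (sgn (h v) * jbr v powr p) \<partial>lborel)"
proof -
  note [measurable] = L1wD(1)[OF h]
  have "(\<integral>v. k v * (sgn (h v) * jbr v powr p) \<partial>lborel) \<le> 1 * L1w_norm p k"
    by (rule order_trans[OF abs_ge_self], rule integrable_bound_L1w(2)[OF k]) (measurable, auto simp: abs_mult abs_sgn_eq)
  then show ?thesis by (simp add: L1w_norm_sgn[OF h])
qed

context granular
begin

subsection \<open>A priori bounds for the truncated problem\<close>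

lemma truncated_evolutionD:
  assumes "truncated_evolution N f"
  shows "0 \<le> t \<Longrightarrow> L1w 4 (f t)" "0 \<le> t \<Longrightarrow> 0 \<le> f t v"
    "t \<in> {0..T} \<Longrightarrow> \<psi> \<in> borel_measurable borel \<Longrightarrow> (\<And>v. \<bar>\<psi> v\<bar> \<le> jbr v ^ 4) \<Longrightarrow>
      ((\<lambda>s. \<integral>v. f s v * \<psi> v \<partial>lborel) has_real_derivative W (trunc N) (f t) \<psi>) (at t within {0..T})"
  using assms by (auto simp: truncated_evolution_def)

lemma truncated_evolution_L1w:
  "truncated_evolution N f \<Longrightarrow> 0 \<le> t \<Longrightarrow> p \<le> 4 \<Longrightarrow> L1w p (f t)"
  using truncated_evolutionD(1) L1w_mono(1) by blast

lemma moment_gronwall: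
  assumes f: "truncated_evolution N f" and s: "s \<in> {2, 3, 4::nat}" and A: "0 \<le> A"
    and le: "\<And>t. t \<in> {0..T} \<Longrightarrow> W (trunc N) (f t) (\<lambda>v. jbr v ^ s) \<le> A * L1w_norm (real s) (f t)" and t: "t \<in> {0..T}"
  shows "L1w_norm (real s) (f t) \<le> exp (A * t) * L1w_norm (real s) (f 0)"
proof -
  let ?u = "\<lambda>t. \<integral>v. f t v * jbr v ^ s \<partial>lborel"
  have pw: "\<bar>jbr v ^ s\<bar> \<le> jbr v ^ 4" for v using s jbr_ge_1[of v] by (auto intro: power_increasing)
  have eq: "L1w_norm (real s) (f t) = ?u t" if "0 \<le> t" for t
    using truncated_evolutionD(2)[OF f that] by (simp add: L1w_norm_def powr_realpow)
  have der: "(?u has_real_derivative W (trunc N) (f t) (\<lambda>v. jbr v ^ s)) (at t within {0..T})" if "t \<in> {0..T}" for t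
    by (rule truncated_evolutionD(3)[OF f that _ pw]) measurable
  have cont: "continuous_on {0..T} ?u"
    by (rule DERIV_continuous_on) (rule der)
  have "?u t \<le> exp (A * t) * (?u 0 + 0 * t)"
  proof (rule dini_gronwall[OF cont A order_refl])
    fix t e :: real assume t: "0 < t" "t \<le> T" and e: "0 < e"
    from has_real_derivative_left_upper[OF der[of t] _ _ e] t
    obtain d where d: "0 < d" "\<And>s'. 0 \<le> s' \<Longrightarrow> s' < t \<Longrightarrow> t - s' < d \<Longrightarrow> ?u t - ?u s' \<le> (t - s') * (W (trunc N) (f t) (\<lambda>v. jbr v ^ s) + e)"
      by auto
    have "?u t - ?u s' \<le> (t - s') * (A * ?u t + 0 + e)" if "0 \<le> s'" "s' < t" "t - s' < d" for s'
    proof -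
      have "(t - s') * (W (trunc N) (f t) (\<lambda>v. jbr v ^ s) + e) \<le> (t - s') * (A * ?u t + 0 + e)"
        using le[of t] t that eq[of t] by (intro mult_left_mono) auto
      then show ?thesis using d(2)[OF that] by linarith
    qed
    with d(1) show "\<exists>d>0. \<forall>s'. 0 \<le> s' \<longrightarrow> s' < t \<longrightarrow> t - s' < d \<longrightarrow> ?u t - ?u s' \<le> (t - s') * (A * ?u t + 0 + e)"
      by blast
  qed (use t in auto)
  then show ?thesis using eq[of t] eq[of 0] t by simp
qed

lemma moment2_bound:
  assumes N: "0 < N" and f: "truncated_evolution N f" and t: "t \<in> {0..T}"
  shows "L1w_norm 2 (f t) \<le> exp (CM * T) * L1w_norm 2 (f 0)"
proof -
  have "L1w_norm (real 2) (f t) \<le> exp (CM * t) * L1w_norm (real 2) (f 0)"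
  proof (rule moment_gronwall[OF f _ CM_nonneg _ t])
    fix t assume "t \<in> {0..T}"
    then show "W (trunc N) (f t) (\<lambda>v. jbr v ^ 2) \<le> CM * L1w_norm (real 2) (f t)"
      using W_moment2[OF trunc_admissible trunc_kernel_bound, of N "f t"] N f
      by (auto simp: truncated_evolution_L1w truncated_evolutionD(2))
  qed auto
  also have "\<dots> \<le> exp (CM * T) * L1w_norm (real 2) (f 0)"
    using t CM_nonneg by (intro mult_right_mono) (auto intro: mult_left_mono simp: L1w_norm_nonneg)
  finally show ?thesis by simp
qed

definition growth :: "real \<Rightarrow> real \<Rightarrow> real" where
  "growth T M = exp (CM * (1 + exp (CM * T) * M) * T)"

lemma growth_pos: "0 < growth T M"
  by (simp add: growth_def)

lemma moment34_bound:
  assumes N: "0 < N" and f: "truncated_evolution N f" and s: "s \<in> {3, 4::nat}" and M: "L1w_norm 2 (f 0) \<le> M" and t: "t \<in> {0..T}"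
  shows "L1w_norm (real s) (f t) \<le> growth T M * L1w_norm (real s) (f 0)"
proof -
  let ?A = "CM * (1 + exp (CM * T) * M)"
  have M0: "0 \<le> M" using M L1w_norm_nonneg[of 2 "f 0"] by linarith
  have A: "0 \<le> ?A" using CM_nonneg M0 by simp
  have "L1w_norm (real s) (f t) \<le> exp (?A * t) * L1w_norm (real s) (f 0)"
  proof (rule moment_gronwall[OF f _ A _ t])
    fix t assume t: "t \<in> {0..T}"
    have "W (trunc N) (f t) (\<lambda>v. jbr v ^ s) \<le> CM * (1 + L1w_norm 2 (f t)) * L1w_norm (real s) (f t)"
      using t s N f by (intro W_moment34[OF trunc_admissible trunc_kernel_bound])
        (auto simp: truncated_evolution_L1w truncated_evolutionD(2))
    also have "\<dots> \<le> ?A * L1w_norm (real s) (f t)"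
    proof (intro mult_right_mono mult_left_mono add_left_mono)
      have "L1w_norm 2 (f t) \<le> exp (CM * T) * L1w_norm 2 (f 0)" by (rule moment2_bound[OF N f t])
      also have "\<dots> \<le> exp (CM * T) * M" using M by (intro mult_left_mono) auto
      finally show "L1w_norm 2 (f t) \<le> exp (CM * T) * M" .
    qed (auto simp: CM_nonneg L1w_norm_nonneg)
    finally show "W (trunc N) (f t) (\<lambda>v. jbr v ^ s) \<le> ?A * L1w_norm (real s) (f t)" .
  qed (use s in auto)
  also have "\<dots> \<le> growth T M * L1w_norm (real s) (f 0)"
    unfolding growth_def using t A by (intro mult_right_mono) (auto intro: mult_left_mono simp: L1w_norm_nonneg)
  finally show ?thesis .
qed

lemma sgn_weight_bound: "p \<le> 4 \<Longrightarrow> \<bar>sgn (h v) * jbr v powr p\<bar> \<le> jbr v ^ 4"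
  using jbr_powr_mono[of p 4 v] by (auto simp: abs_mult abs_sgn_eq)

text \<open>For fixed \<open>s\<close> and \<open>t\<close> the norm of the increment is its pairing
  with one observable, the weighted sign; the mean value inequality applies to that pairing.\<close>

lemma truncated_lipschitz:
  assumes N: "0 < N" and f: "truncated_evolution N f" and M: "\<And>t. t \<in> {0..T} \<Longrightarrow> L1w_norm 3 (f t) \<le> M"
    and s: "s \<in> {0..T}" and t: "t \<in> {0..T}"
  shows "L1w_norm 2 (\<lambda>v. f t v - f s v) \<le> CW 2 * (1 + M) * M * \<bar>t - s\<bar>"
proof -
  define \<psi> where "\<psi> = (\<lambda>v. sgn (f t v - f s v) * jbr v powr 2)"
  have L: "L1w p (f r)" if "r \<in> {0..T}" "p \<le> 4" for p r using that f by (auto intro: truncated_evolution_L1w)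
  have [measurable]: "f t \<in> borel_measurable borel" "f s \<in> borel_measurable borel" using L1wD(1)[OF L] s t by auto
  have \<psi>m[measurable]: "\<psi> \<in> borel_measurable borel" unfolding \<psi>_def by measurable
  have M0: "0 \<le> M" using M[OF t] L1w_norm_nonneg[of 3 "f t"] by linarith
  have "norm ((\<integral>v. f t v * \<psi> v \<partial>lborel) - (\<integral>v. f s v * \<psi> v \<partial>lborel)) \<le> CW 2 * (1 + M) * M * norm (t - s)"
  proof (rule field_differentiable_bound[of "{0..T}"])
    show "((\<lambda>s. \<integral>v. f s v * \<psi> v \<partial>lborel) has_real_derivative W (trunc N) (f r) \<psi>) (at r within {0..T})" if "r \<in> {0..T}" for r
      by (rule truncated_evolutionD(3)[OF f that \<psi>m]) (unfold \<psi>_def, rule sgn_weight_bound, simp)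
    show "norm (W (trunc N) (f r) \<psi>) \<le> CW 2 * (1 + M) * M" if r: "r \<in> {0..T}" for r
    proof -
      have "\<bar>W (trunc N) (f r) \<psi>\<bar> \<le> CW 2 * (1 + L1w_norm (2 + 1) (f r)) * L1w_norm (2 + 1) (f r)"
        using N L[OF r] by (intro W_le trunc_admissible \<psi>m) (auto simp: \<psi>_def abs_mult abs_sgn_eq)
      also have "\<dots> \<le> CW 2 * (1 + M) * M"
        using M[OF r] M0 CW_nonneg by (intro mult_mono mult_left_mono) (auto simp: L1w_norm_nonneg)
      finally show ?thesis by simp
    qed
  qed (use s t in auto)
  moreover have "(\<integral>v. f t v * \<psi> v \<partial>lborel) - (\<integral>v. f s v * \<psi> v \<partial>lborel) = L1w_norm 2 (\<lambda>v. f t v - f s v)"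
  proof -
    have b: "\<bar>\<psi> v\<bar> \<le> 1 * jbr v powr 2" for v by (auto simp: \<psi>_def abs_mult abs_sgn_eq)
    note i = integrable_bound_L1w(1)[OF L[OF t] \<psi>m b] integrable_bound_L1w(1)[OF L[OF s] \<psi>m b]
    have "(\<integral>v. f t v * \<psi> v \<partial>lborel) - (\<integral>v. f s v * \<psi> v \<partial>lborel) = (\<integral>v. (f t v - f s v) * \<psi> v \<partial>lborel)"
      using i by (subst Bochner_Integration.integral_diff[symmetric]) (auto simp: algebra_simps)
    also have "\<dots> = L1w_norm 2 (\<lambda>v. f t v - f s v)"
      unfolding \<psi>_def using L[OF t, of 2] L[OF s, of 2] by (intro L1w_norm_sgn L1w_diff) auto
    finally show ?thesis .
  qed
  ultimately show ?thesis by (simp add: L1w_norm_nonneg)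
qed

text \<open>The kernels agree up to relative speed \<open>N1\<close>; beyond it the error is at most
  q \<le> q^2 / N1, and \<open>norm_diff_le_jbr_prod\<close> turns the square into 4 times the
  weights.\<close>

lemma trunc_diff_le:
  assumes "0 < N1" "N1 \<le> N2"
  shows "\<bar>trunc N2 (v - w) - trunc N1 (v - w)\<bar> \<le> 4 / N1 * (jbr v * jbr w) powr 2"
    and "\<bar>norm (v - w) - trunc N1 (v - w)\<bar> \<le> 4 / N1 * (jbr v * jbr w) powr 2"
proof -
  define q where "q = norm (v - w)"
  have q: "0 \<le> q" "q \<le> 2 * (jbr v * jbr w)" by (auto simp: q_def norm_diff_le_jbr_prod)
  have "\<bar>r - min q N1\<bar> \<le> 4 / N1 * (jbr v * jbr w) powr 2" if "r = q \<or> r = min q N2" for r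
  proof (cases "q \<le> N1")
    case True
    then show ?thesis using that assms by (auto simp: min_def)
  next
    case False
    have "\<bar>r - min q N1\<bar> \<le> q * 1" using that False assms by (auto simp: min_def)
    also have "\<dots> \<le> q * (q / N1)" using False assms q by (intro mult_left_mono) auto
    also have "\<dots> = q ^ 2 / N1" by (simp add: power2_eq_square)
    also have "\<dots> \<le> (2 * (jbr v * jbr w)) ^ 2 / N1"
      using q assms by (intro divide_right_mono power_mono) auto
    also have "\<dots> = 4 / N1 * (jbr v * jbr w) powr 2"
      by (simp add: power_mult_distrib powr_mult)
    finally show ?thesis .
  qed
  from this[of "min q N2"] this[of q]
  show "\<bar>trunc N2 (v - w) - trunc N1 (v - w)\<bar> \<le> 4 / N1 * (jbr v * jbr w) powr 2"
    "\<bar>norm (v - w) - trunc N1 (v - w)\<bar> \<le> 4 / N1 * (jbr v * jbr w) powr 2"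
    by (auto simp: trunc_def q_def)
qed

text \<open>Inserting the kernel of \<open>g\<close> with the solution \<open>f\<close> splits the
  difference. \<open>W_stability\<close> with p = 2 has no error term, since
  \<open>2 powr (1 - 2 / 2) = 1\<close>; the kernel mismatch is paid for by the fourth moment of
  \<open>f\<close> alone.\<close>

lemma truncated_stability:
  assumes N: "0 < N1" "N1 \<le> N2" and f: "truncated_evolution N1 f" and g: "truncated_evolution N2 g"
    and M: "\<And>t. t \<in> {0..T} \<Longrightarrow> L1w_norm 3 (f t) \<le> M" "\<And>t. t \<in> {0..T} \<Longrightarrow> L1w_norm 3 (g t) \<le> M"
    and M4: "\<And>t. t \<in> {0..T} \<Longrightarrow> L1w_norm 4 (f t) \<le> M4" and t: "t \<in> {0..T}"
  shows "L1w_norm 2 (\<lambda>v. g t v - f t v) \<le> exp (CA M * t) * (L1w_norm 2 (\<lambda>v. g 0 v - f 0 v) + 4 / N1 * CW 2 * (1 + M4) * M4 * t)"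
proof -
  define h where "h = (\<lambda>t v. g t v - f t v)"
  define E where "E = 4 / N1 * CW 2 * (1 + M4) * M4"
  have N2: "0 < N2" using N by simp
  have Lf: "L1w p (f r)" if "r \<in> {0..T}" "p \<le> 4" for p r using that f by (auto intro: truncated_evolution_L1w)
  have Lg: "L1w p (g r)" if "r \<in> {0..T}" "p \<le> 4" for p r using that g by (auto intro: truncated_evolution_L1w)
  have Lh: "L1w p (h r)" if "r \<in> {0..T}" "p \<le> 4" for p r unfolding h_def by (intro L1w_diff Lf Lg that)
  have M0: "0 \<le> M" "0 \<le> M4" using M(1)[OF t] M4[OF t] L1w_norm_nonneg[of 3 "f t"] L1w_norm_nonneg[of 4 "f t"] by linarith+
  have E0: "0 \<le> E" using N M0 CW_nonneg by (simp add: E_def)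
  define B where "B = 2 * (CW 2 * (1 + M) * M)"
  have B0: "0 \<le> B" using M0 CW_nonneg by (simp add: B_def)
  have lip: "L1w_norm 2 (\<lambda>v. h r v - h s v) \<le> B * \<bar>r - s\<bar>" if "r \<in> {0..T}" "s \<in> {0..T}" for r s
  proof -
    have "(\<lambda>v. h r v - h s v) = (\<lambda>v. (g r v - g s v) - (f r v - f s v))" by (auto simp: h_def)
    moreover have "L1w_norm 2 (\<lambda>v. (g r v - g s v) - (f r v - f s v)) \<le> L1w_norm 2 (\<lambda>v. g r v - g s v) + L1w_norm 2 (\<lambda>v. f r v - f s v)"
      by (intro L1w_diff(2) L1w_diff(1) Lf Lg that) auto
    ultimately show ?thesis
      using truncated_lipschitz[OF N(1) f M(1) that(2,1)] truncated_lipschitz[OF N2 g M(2) that(2,1)]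
      by (simp add: B_def algebra_simps)
  qed
  have cont: "continuous_on {0..T} (\<lambda>r. L1w_norm 2 (h r))"
  proof (rule continuous_on_subset[OF _ order_refl], rule lipschitz_on_continuous_on, rule lipschitz_onI[OF _ B0])
    fix r s assume rs: "r \<in> {0..T}" "s \<in> {0..T}"
    have z: "L1w 2 (\<lambda>v. 0)" by simp
    have "L1w_norm 2 (h r) \<le> L1w_norm 2 (\<lambda>v. h r v - h s v) + L1w_norm 2 (h s)"
      using L1w_norm_triangle[OF Lh[OF rs(1)] Lh[OF rs(2)] z] by simp
    moreover have "L1w_norm 2 (h s) \<le> L1w_norm 2 (\<lambda>v. h s v - h r v) + L1w_norm 2 (h r)"
      using L1w_norm_triangle[OF Lh[OF rs(2)] Lh[OF rs(1)] z] by simp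
    ultimately have "\<bar>L1w_norm 2 (h r) - L1w_norm 2 (h s)\<bar> \<le> L1w_norm 2 (\<lambda>v. h r v - h s v)"
      using L1w_norm_minus_commute[of 2 "h s" "h r"] by linarith
    then show "dist (L1w_norm 2 (h r)) (L1w_norm 2 (h s)) \<le> B * dist r s"
      using lip[OF rs] by (simp add: dist_real_def)
  qed
  have "L1w_norm 2 (h t) \<le> exp (CA M * t) * (L1w_norm 2 (h 0) + E * t)"
  proof (rule dini_gronwall[OF cont CA_nonneg[OF M0(1)] E0])
    fix t e :: real assume t: "0 < t" "t \<le> T" and e: "0 < e"
    then have tT: "t \<in> {0..T}" by auto
    define \<psi> where "\<psi> = (\<lambda>v. sgn (h t v) * jbr v powr 2)"
    have [measurable]: "h t \<in> borel_measurable borel" using L1wD(1)[OF Lh[OF tT, of 0]] by simp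
    have \<psi>m[measurable]: "\<psi> \<in> borel_measurable borel" unfolding \<psi>_def by measurable
    have b4: "\<bar>\<psi> v\<bar> \<le> jbr v ^ 4" for v unfolding \<psi>_def by (rule sgn_weight_bound) simp
    have b2: "\<bar>\<psi> v\<bar> \<le> jbr v powr 2" for v by (auto simp: \<psi>_def abs_mult abs_sgn_eq)
    have b2': "\<bar>\<psi> v\<bar> \<le> 1 * jbr v powr 2" for v using b2 by simp
    define D where "D = W (trunc N2) (g t) \<psi> - W (trunc N1) (f t) \<psi>"
    have "((\<lambda>s. (\<integral>v. g s v * \<psi> v \<partial>lborel) - (\<integral>v. f s v * \<psi> v \<partial>lborel)) has_real_derivative D) (at t within {0..T})"
      unfolding D_def by (intro DERIV_diff truncated_evolutionD(3)[OF f tT \<psi>m b4] truncated_evolutionD(3)[OF g tT \<psi>m b4])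
    from has_real_derivative_left_upper[OF this _ _ e] t
    obtain d where d: "0 < d" "\<And>s. 0 \<le> s \<Longrightarrow> s < t \<Longrightarrow> t - s < d \<Longrightarrow>
        ((\<integral>v. g t v * \<psi> v \<partial>lborel) - (\<integral>v. f t v * \<psi> v \<partial>lborel)) - ((\<integral>v. g s v * \<psi> v \<partial>lborel) - (\<integral>v. f s v * \<psi> v \<partial>lborel)) \<le> (t - s) * (D + e)"
      by auto
    have split: "(\<integral>v. g s v * \<psi> v \<partial>lborel) - (\<integral>v. f s v * \<psi> v \<partial>lborel) = (\<integral>v. h s v * \<psi> v \<partial>lborel)" if "s \<in> {0..T}" for s
      using integrable_bound_L1w(1)[OF Lg[OF that] \<psi>m b2'] integrable_bound_L1w(1)[OF Lf[OF that] \<psi>m b2']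
      by (subst Bochner_Integration.integral_diff[symmetric]) (auto simp: h_def algebra_simps)
    have D: "D \<le> CA M * L1w_norm 2 (h t) + E"
    proof -
      have "W (trunc N2) (g t) \<psi> - W (trunc N2) (f t) \<psi> \<le> CA M * L1w_norm 2 (h t) + 4 * tau * M\<^sup>2 * (2 powr (1 - 2 / 2) - 1)"
        unfolding \<psi>_def h_def using N2 M[OF tT] Lf[OF tT] Lg[OF tT] truncated_evolutionD(2)[OF f] t
        by (intro W_stability trunc_admissible) auto
      moreover have "\<bar>W (trunc N2) (f t) \<psi> - W (trunc N1) (f t) \<psi>\<bar> \<le> 4 / N1 * CW 2 * (1 + L1w_norm (2 + 2) (f t)) * L1w_norm (2 + 2) (f t)"
        using N N2 Lf[OF tT] by (intro W_kernel_diff_le trunc_admissible trunc_diff_le(1) \<psi>m b2) auto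
      moreover have "4 / N1 * CW 2 * (1 + L1w_norm (2 + 2) (f t)) * L1w_norm (2 + 2) (f t) \<le> E"
        unfolding E_def using M4[OF tT] M0 CW_nonneg N by (intro mult_mono mult_left_mono) (auto simp: L1w_norm_nonneg)
      ultimately show ?thesis unfolding D_def by simp
    qed
    have "L1w_norm 2 (h t) - L1w_norm 2 (h s) \<le> (t - s) * (CA M * L1w_norm 2 (h t) + E + e)"
      if s: "0 \<le> s" "s < t" "t - s < d" for s
    proof -
      have sT: "s \<in> {0..T}" using s t by auto
      have "L1w_norm 2 (h t) - L1w_norm 2 (h s) \<le> (\<integral>v. h t v * \<psi> v \<partial>lborel) - (\<integral>v. h s v * \<psi> v \<partial>lborel)"
        unfolding \<psi>_def using Lh[OF tT, of 2] Lh[OF sT, of 2] by (intro L1w_norm_diff_le_sgn) auto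
      also have "\<dots> \<le> (t - s) * (D + e)" using d(2)[OF s] unfolding split[OF tT] split[OF sT] .
      also have "\<dots> \<le> (t - s) * (CA M * L1w_norm 2 (h t) + E + e)"
        using D s by (intro mult_left_mono) auto
      finally show ?thesis .
    qed
    with d(1) show "\<exists>d>0. \<forall>s. 0 \<le> s \<longrightarrow> s < t \<longrightarrow> t - s < d \<longrightarrow> L1w_norm 2 (h t) - L1w_norm 2 (h s) \<le> (t - s) * (CA M * L1w_norm 2 (h t) + E + e)"
      by blast
  qed (use t in auto)
  then show ?thesis by (simp add: h_def E_def)
qed

end

subsection \<open>Removing the truncation\<close>

lemma L1w_dominated:
  assumes g[measurable]: "g \<in> borel_measurable borel" and f: "L1w q f"
    and le: "\<And>v. \<bar>g v\<bar> * jbr v powr p \<le> r * (\<bar>f v\<bar> * jbr v powr q)"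
  shows "L1w p g" "L1w_norm p g \<le> r * L1w_norm q f"
proof -
  have int: "integrable lborel (\<lambda>v. r * (\<bar>f v\<bar> * jbr v powr q))" using L1wD(2)[OF f] by simp
  have "integrable lborel (\<lambda>v. \<bar>g v\<bar> * jbr v powr p)"
    by (rule Bochner_Integration.integrable_bound[OF int]) (use le in \<open>auto intro!: AE_I2 order_trans[OF _ abs_ge_self]\<close>)
  then show gp: "L1w p g" by (simp add: L1w_def)
  have "L1w_norm p g \<le> (\<integral>v. r * (\<bar>f v\<bar> * jbr v powr q) \<partial>lborel)"
    unfolding L1w_norm_def by (rule integral_mono[OF L1wD(2)[OF gp] int le])
  then show "L1w_norm p g \<le> r * L1w_norm q f" by (simp add: L1w_norm_def)
qed

text \<open>The factor \<open>2 ^ j / jbr v\<close> trades one weight: the fourth moment is at most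
  \<open>2 ^ j\<close> times the third, and the error in weight 2 at most \<open>2 ^ -j\<close>
  times the third. Unlike an indicator the factor is positive everywhere, so the mass stays positive
  for every \<open>j\<close>.\<close>

definition cutoff :: "(vel \<Rightarrow> real) \<Rightarrow> nat \<Rightarrow> vel \<Rightarrow> real" where
  "cutoff f j v = f v * min 1 (2 ^ j / jbr v)"

context
  fixes f0 :: "vel \<Rightarrow> real"
  assumes f0: "L1w 3 f0" "\<And>v. 0 \<le> f0 v"
begin

lemma cutoff_measurable [measurable]: "cutoff f0 j \<in> borel_measurable borel"
proof -
  note [measurable] = L1wD(1)[OF f0(1)]
  show ?thesis unfolding cutoff_def [abs_def] by measurable
qed

lemma cutoff_bounds: "0 \<le> cutoff f0 j v" "cutoff f0 j v \<le> f0 v"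
proof -
  have "0 \<le> min 1 (2 ^ j / jbr v)" by simp
  then show "0 \<le> cutoff f0 j v" using f0(2) by (simp add: cutoff_def)
  have "f0 v * min 1 (2 ^ j / jbr v) \<le> f0 v * 1" using f0(2) by (intro mult_left_mono) auto
  then show "cutoff f0 j v \<le> f0 v" by (simp add: cutoff_def)
qed

lemma cutoff_L1w4: "L1w 4 (cutoff f0 j)" "L1w_norm 4 (cutoff f0 j) \<le> 2 ^ j * L1w_norm 3 f0"
proof -
  have le: "\<bar>cutoff f0 j v\<bar> * jbr v powr 4 \<le> 2 ^ j * (\<bar>f0 v\<bar> * jbr v powr 3)" for v
  proof -
    have "cutoff f0 j v * jbr v ^ 4 \<le> (f0 v * (2 ^ j / jbr v)) * jbr v ^ 4"
      unfolding cutoff_def using f0(2) by (intro mult_right_mono mult_left_mono) auto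
    also have "\<dots> = 2 ^ j * (f0 v * jbr v ^ 3)" by (simp add: power4_eq_xxxx power3_eq_cube)
    finally show ?thesis using cutoff_bounds f0(2) by simp
  qed
  show "L1w 4 (cutoff f0 j)" "L1w_norm 4 (cutoff f0 j) \<le> 2 ^ j * L1w_norm 3 f0"
    using L1w_dominated[OF cutoff_measurable f0(1) le] .
qed

lemma cutoff_L1w:
  assumes "p \<le> 3"
  shows "L1w p (cutoff f0 j)" "L1w_norm p (cutoff f0 j) \<le> L1w_norm p f0"
proof -
  have le: "\<bar>cutoff f0 j v\<bar> * jbr v powr p \<le> 1 * (\<bar>f0 v\<bar> * jbr v powr p)" for v
    using cutoff_bounds[of j v] f0(2) by (auto intro!: mult_right_mono)
  show "L1w p (cutoff f0 j)" "L1w_norm p (cutoff f0 j) \<le> L1w_norm p f0"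
    using L1w_dominated[OF cutoff_measurable L1w_mono(1)[OF f0(1) assms] le] by simp_all
qed

lemma cutoff_error: "L1w_norm 2 (\<lambda>v. f0 v - cutoff f0 j v) \<le> L1w_norm 3 f0 * (1/2) ^ j"
proof -
  note [measurable] = L1wD(1)[OF f0(1)]
  have le: "\<bar>f0 v - cutoff f0 j v\<bar> * jbr v powr 2 \<le> (1/2) ^ j * (\<bar>f0 v\<bar> * jbr v powr 3)" for v
  proof (cases "jbr v \<le> 2 ^ j")
    case True
    then have "min 1 (2 ^ j / jbr v) = 1" by (simp add: min_def)
    then show ?thesis by (simp add: cutoff_def)
  next
    case False
    have "\<bar>f0 v - cutoff f0 j v\<bar> * jbr v powr 2 \<le> f0 v * jbr v ^ 2 * 1"
      using cutoff_bounds[of j v] by (auto intro!: mult_right_mono)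
    also have "\<dots> \<le> f0 v * jbr v ^ 2 * (jbr v / 2 ^ j)"
      using False f0(2) by (intro mult_left_mono) auto
    also have "\<dots> = (1/2) ^ j * (\<bar>f0 v\<bar> * jbr v powr 3)"
      using f0(2) by (simp add: power2_eq_square power3_eq_cube power_divide)
    finally show ?thesis .
  qed
  have "(\<lambda>v. f0 v - cutoff f0 j v) \<in> borel_measurable borel" by measurable
  from L1w_dominated(2)[OF this f0(1) le] show ?thesis by (simp add: mult.commute)
qed

lemma cutoff_mass_pos:
  assumes "0 < (\<integral>v. f0 v \<partial>lborel)"
  shows "0 < (\<integral>v. cutoff f0 j v \<partial>lborel)"
proof (rule ccontr)
  assume "\<not> ?thesis"
  moreover have "0 \<le> (\<integral>v. cutoff f0 j v \<partial>lborel)" using cutoff_bounds by simp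
  ultimately have 0: "(\<integral>v. cutoff f0 j v \<partial>lborel) = 0" by linarith
  have "integrable lborel (cutoff f0 j)"
    using L1wD(2)[OF cutoff_L1w(1)[of 0 j]] cutoff_bounds by simp
  from integral_nonneg_eq_0_iff_AE[OF this] 0 have "AE v in lborel. cutoff f0 j v = 0"
    using cutoff_bounds(1) by simp
  then have "AE v in lborel. f0 v = 0"
    by eventually_elim (auto simp: cutoff_def min_def split: if_splits)
  then have "(\<integral>v. f0 v \<partial>lborel) = 0" by (simp add: integral_eq_zero_AE)
  with assms show False by simp
qed

end

context granular
begin

definition evolution :: "real \<Rightarrow> real \<Rightarrow> (real \<Rightarrow> vel \<Rightarrow> real) \<Rightarrow> bool" where
  "evolution T M f \<longleftrightarrow> (\<forall>t\<in>{0..T}. L1w 3 (f t) \<and> L1w_norm 3 (f t) \<le> M) \<and>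
     (\<forall>t\<in>{0..T}. ((\<lambda>s. L1w_norm 2 (\<lambda>v. f s v - f t v)) \<longlongrightarrow> 0) (at t within {0..T})) \<and>
     (\<forall>\<psi>. test_fun \<psi> \<longrightarrow> (\<forall>t\<in>{0..T}.
        ((\<lambda>s. \<integral>v. f s v * \<psi> v \<partial>lborel) has_real_derivative W norm (f t) \<psi>) (at t within {0..T})))"

lemma test_fun_bounded:
  assumes "test_fun \<psi>"
  shows "\<psi> \<in> borel_measurable borel" "\<exists>C>0. \<forall>v. \<bar>\<psi> v\<bar> \<le> C"
proof -
  have cont: "continuous_on UNIV \<psi>" and bdd: "bounded {v. \<psi> v \<noteq> 0}" using assms by (auto simp: test_fun_def)
  show "\<psi> \<in> borel_measurable borel" using cont by (rule borel_measurable_continuous_onI)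
  obtain r where "\<And>v. \<psi> v \<noteq> 0 \<Longrightarrow> norm v \<le> r" using bdd by (auto simp: bounded_iff)
  then have r: "{v. \<psi> v \<noteq> 0} \<subseteq> cball 0 r" by auto
  have "compact (\<psi> ` cball 0 r)"
    using cont by (intro compact_continuous_image) (auto intro: continuous_on_subset)
  then have "bounded (\<psi> ` cball 0 r)" by (rule compact_imp_bounded)
  then obtain C where C: "0 < C" "\<forall>y\<in>\<psi> ` cball 0 r. norm y \<le> C" by (auto simp: bounded_pos)
  have "\<bar>\<psi> v\<bar> \<le> C" for v
  proof (cases "\<psi> v = 0")
    case False
    then have "v \<in> cball 0 r" using r by auto
    then show ?thesis using C(2) by auto
  qed (use C in simp)
  with C(1) show "\<exists>C>0. \<forall>v. \<bar>\<psi> v\<bar> \<le> C" by blast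
qed

lemma evolution_exists:
  assumes f0: "L1w 3 f0" "\<And>v. 0 \<le> f0 v" and mass: "0 < (\<integral>v. f0 v \<partial>lborel)" and T: "0 < T"
  shows "\<exists>f M. evolution T M f \<and> (\<forall>t\<in>{0..T}. \<forall>v. 0 \<le> f t v) \<and> (AE v in lborel. f 0 v = f0 v)"
proof -
  let ?M3 = "L1w_norm 3 f0"
  have "\<exists>F. truncated_evolution (8 ^ j) F \<and> (\<forall>v. F 0 v = cutoff f0 j v)" for j
    by (rule truncated_evolution_exists[OF _ cutoff_L1w4(1)[OF f0] cutoff_bounds(1)[OF f0] cutoff_mass_pos[OF f0 mass]]) simp
  then obtain F where F: "\<And>j. truncated_evolution (8 ^ j) (F j)" and F0: "\<And>j. F j 0 = cutoff f0 j"
    by (metis ext)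
  define M where "M = growth T (L1w_norm 2 f0) * ?M3"
  have M0: "0 \<le> M" using growth_pos[of T "L1w_norm 2 f0"] by (simp add: M_def L1w_norm_nonneg less_imp_le)
  have LF: "L1w p (F j t)" if "t \<in> {0..T}" "p \<le> 4" for j t p using that F by (auto intro: truncated_evolution_L1w)
  have F2: "L1w_norm 2 (F j 0) \<le> L1w_norm 2 f0" for j unfolding F0 by (rule cutoff_L1w(2)[OF f0]) simp
  have m3: "L1w_norm 3 (F j t) \<le> M" if t: "t \<in> {0..T}" for j t
  proof -
    have "L1w_norm (real 3) (F j t) \<le> growth T (L1w_norm 2 f0) * L1w_norm (real 3) (F j 0)"
      by (rule moment34_bound[OF _ F _ F2 t]) auto
    also have "\<dots> \<le> growth T (L1w_norm 2 f0) * ?M3"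
      unfolding F0 using cutoff_L1w(2)[OF f0, of 3 j] growth_pos by (intro mult_left_mono) (auto simp: less_imp_le)
    finally show ?thesis by (simp add: M_def)
  qed
  have m4: "L1w_norm 4 (F j t) \<le> M * 2 ^ j" if t: "t \<in> {0..T}" for j t
  proof -
    have "L1w_norm (real 4) (F j t) \<le> growth T (L1w_norm 2 f0) * L1w_norm (real 4) (F j 0)"
      by (rule moment34_bound[OF _ F _ F2 t]) auto
    also have "\<dots> \<le> growth T (L1w_norm 2 f0) * (2 ^ j * ?M3)"
      unfolding F0 using cutoff_L1w4(2)[OF f0, of j] growth_pos by (intro mult_left_mono) (auto simp: less_imp_le)
    finally show ?thesis by (simp add: M_def mult_ac)
  qed
  define C where "C = exp (CA M * T) * (2 * ?M3 + 4 * CW 2 * (1 + M) * M * T)"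
  have cauchy: "L1w_norm 2 (\<lambda>v. F l t v - F j t v) \<le> C * (1/2) ^ j" if t: "t \<in> {0..T}" and jl: "j \<le> l" for j l t
  proof -
    have "L1w_norm 2 (\<lambda>v. F l t v - F j t v) \<le>
      exp (CA M * t) * (L1w_norm 2 (\<lambda>v. F l 0 v - F j 0 v) + 4 / 8 ^ j * CW 2 * (1 + M * 2 ^ j) * (M * 2 ^ j) * t)"
      by (rule truncated_stability[OF _ _ F F m3 m3 m4 t]) (use jl in \<open>auto intro: power_increasing\<close>)
    also have "\<dots> \<le> exp (CA M * T) * ((2 * ?M3) * (1/2) ^ j + (4 * CW 2 * (1 + M) * M * T) * (1/2) ^ j)"
    proof (rule mult_mono[OF _ add_mono])
      show "exp (CA M * t) \<le> exp (CA M * T)" using t CA_nonneg[OF M0] by (auto intro: mult_left_mono)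
      have f0': "L1w 2 f0" "L1w 2 (cutoff f0 l)" "L1w 2 (cutoff f0 j)" using L1w_mono(1)[OF f0(1)] cutoff_L1w(1)[OF f0] by auto
      have "L1w_norm 2 (\<lambda>v. F l 0 v - F j 0 v) \<le> L1w_norm 2 (\<lambda>v. F l 0 v - f0 v) + L1w_norm 2 (\<lambda>v. f0 v - F j 0 v)"
        unfolding F0 by (rule L1w_norm_triangle[OF f0'(2,1,3)])
      also have "\<dots> \<le> ?M3 * (1/2) ^ l + ?M3 * (1/2) ^ j"
        unfolding F0 using cutoff_error[OF f0, of l] cutoff_error[OF f0, of j]
        by (intro add_mono) (simp_all add: L1w_norm_minus_commute[of 2 _ f0])
      also have "\<dots> \<le> ?M3 * (1/2) ^ j + ?M3 * (1/2) ^ j"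
        using jl by (intro add_mono mult_left_mono power_decreasing) (auto simp: L1w_norm_nonneg)
      finally show "L1w_norm 2 (\<lambda>v. F l 0 v - F j 0 v) \<le> (2 * ?M3) * (1/2) ^ j" by simp
      have p8: "(8::real) ^ j = 2 ^ j * (2 ^ j * 2 ^ j)" by (simp flip: power_mult_distrib)
      \<comment> \<open>Both factors of the fourth moment are of order \<open>2 ^ j\<close>; against
        \<open>8 ^ j\<close> this leaves \<open>2 ^ -j\<close>.\<close>
      have "4 / 8 ^ j * CW 2 * (1 + M * 2 ^ j) * (M * 2 ^ j) * t \<le> 4 / 8 ^ j * CW 2 * ((1 + M) * 2 ^ j) * (M * 2 ^ j) * T"
        using t M0 CW_nonneg[of 2] by (intro mult_mono mult_left_mono) (auto simp: distrib_right)
      also have "\<dots> = (4 * CW 2 * (1 + M) * M * T) * (1/2) ^ j"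
        unfolding p8 by (simp add: power_divide)
      finally show "4 / 8 ^ j * CW 2 * (1 + M * 2 ^ j) * (M * 2 ^ j) * t \<le> (4 * CW 2 * (1 + M) * M * T) * (1/2) ^ j" .
    qed (use t M0 CW_nonneg[of 2] in \<open>auto simp: L1w_norm_nonneg\<close>)
    also have "\<dots> = C * (1/2) ^ j" by (simp add: C_def algebra_simps)
    finally show ?thesis .
  qed
  define f where "f = (\<lambda>t v. max 0 (lim (\<lambda>j. F j t v)))"
  have lim: "f t \<in> borel_measurable borel" "AE v in lborel. (\<lambda>j. F j t v) \<longlonglongrightarrow> f t v"
    "L1w 2 (f t)" "L1w_norm 2 (\<lambda>v. f t v - F j t v) \<le> C * (1/2) ^ j" if t: "t \<in> {0..T}" for t j
  proof -
    have nn: "0 \<le> F j t v" for j v using truncated_evolutionD(2)[OF F] t by auto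
    have L2: "L1w 2 (F j t)" for j using LF[OF t] by simp
    show "f t \<in> borel_measurable borel" "AE v in lborel. (\<lambda>j. F j t v) \<longlonglongrightarrow> f t v"
      "L1w 2 (f t)" "L1w_norm 2 (\<lambda>v. f t v - F j t v) \<le> C * (1/2) ^ j"
      unfolding f_def using L1w_cauchy_limit[of 2 "\<lambda>j. F j t" C, OF L2 cauchy[OF t] nn] by auto
  qed
  have f3: "L1w 3 (f t)" "L1w_norm 3 (f t) \<le> M" if t: "t \<in> {0..T}" for t
    using L1w_fatou[of 3 "\<lambda>j. F j t" M "f t", OF _ m3[OF t] lim(1,2)[OF t]] LF[OF t] by auto
  have f_nonneg: "0 \<le> f t v" for t v by (simp add: f_def)
  have half0: "(\<lambda>j. r * (1/2) ^ j) \<longlonglongrightarrow> (0::real)" for r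
    by (intro tendsto_mult_right_zero LIMSEQ_power_zero) simp
  define L where "L = CW 2 * (1 + M) * M"
  have lip: "L1w_norm 2 (\<lambda>v. f s v - f t v) \<le> L * \<bar>s - t\<bar>" if s: "s \<in> {0..T}" and t: "t \<in> {0..T}" for s t
  proof -
    have le: "L1w_norm 2 (\<lambda>v. f s v - f t v) \<le> 2 * C * (1/2) ^ j + L * \<bar>s - t\<bar>" for j
    proof -
      have Fj: "L1w 2 (F j s)" "L1w 2 (F j t)" using LF[OF s] LF[OF t] by auto
      have "L1w_norm 2 (\<lambda>v. f s v - f t v) \<le> L1w_norm 2 (\<lambda>v. f s v - F j s v) + L1w_norm 2 (\<lambda>v. F j s v - f t v)"
        by (rule L1w_norm_triangle[OF lim(3)[OF s] Fj(1) lim(3)[OF t]])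
      moreover have "L1w_norm 2 (\<lambda>v. F j s v - f t v) \<le> L1w_norm 2 (\<lambda>v. F j s v - F j t v) + L1w_norm 2 (\<lambda>v. F j t v - f t v)"
        by (rule L1w_norm_triangle[OF Fj lim(3)[OF t]])
      moreover have "L1w_norm 2 (\<lambda>v. F j s v - F j t v) \<le> L * \<bar>s - t\<bar>"
        unfolding L_def by (rule truncated_lipschitz[OF _ F m3 t s]) simp
      moreover have "L1w_norm 2 (\<lambda>v. F j t v - f t v) \<le> C * (1/2) ^ j"
        using lim(4)[OF t, of j] by (simp only: L1w_norm_minus_commute[of 2 "F j t" "f t"])
      ultimately show ?thesis using lim(4)[OF s, of j] by linarith
    qed
    have "(\<lambda>j. 2 * C * (1/2) ^ j + L * \<bar>s - t\<bar>) \<longlonglongrightarrow> 0 + L * \<bar>s - t\<bar>"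
      by (intro tendsto_add half0 tendsto_const)
    then have "L1w_norm 2 (\<lambda>v. f s v - f t v) \<le> 0 + L * \<bar>s - t\<bar>"
      by (rule LIMSEQ_le_const) (use le in blast)
    then show ?thesis by simp
  qed
  have cont: "((\<lambda>s. L1w_norm 2 (\<lambda>v. f s v - f t v)) \<longlongrightarrow> 0) (at t within {0..T})" if t: "t \<in> {0..T}" for t
  proof (rule tendsto_sandwich[where f = "\<lambda>_. 0"])
    show "((\<lambda>s. L * \<bar>s - t\<bar>) \<longlongrightarrow> 0) (at t within {0..T})"
    proof -
      have "((\<lambda>s. L * \<bar>s - t\<bar>) \<longlongrightarrow> L * \<bar>t - t\<bar>) (at t within {0..T})" by (intro tendsto_intros)
      then show ?thesis by simp
    qed
    show "eventually (\<lambda>s. L1w_norm 2 (\<lambda>v. f s v - f t v) \<le> L * \<bar>s - t\<bar>) (at t within {0..T})"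
      unfolding eventually_at by (rule exI[of _ 1]) (use lip t in auto)
  qed (auto simp: L1w_norm_nonneg)
  have init: "AE v in lborel. f 0 v = f0 v"
  proof -
    have T0: "0 \<in> {0..T}" using T by simp
    have f02: "L1w 2 f0" using L1w_mono(1)[OF f0(1)] by simp
    have "L1w_norm 2 (\<lambda>v. f 0 v - f0 v) \<le> (C + ?M3) * (1/2) ^ j" for j
    proof -
      have "L1w_norm 2 (\<lambda>v. f 0 v - f0 v) \<le> L1w_norm 2 (\<lambda>v. f 0 v - F j 0 v) + L1w_norm 2 (\<lambda>v. F j 0 v - f0 v)"
        by (rule L1w_norm_triangle[OF lim(3)[OF T0] LF[OF T0] f02]) simp
      moreover have "L1w_norm 2 (\<lambda>v. F j 0 v - f0 v) \<le> ?M3 * (1/2) ^ j"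
        unfolding F0 using cutoff_error[OF f0, of j] by (simp add: L1w_norm_minus_commute[of 2 _ f0])
      ultimately show ?thesis using lim(4)[OF T0, of j] by (simp add: distrib_right)
    qed
    then have "L1w_norm 2 (\<lambda>v. f 0 v - f0 v) \<le> 0"
      by (intro LIMSEQ_le_const[OF half0]) blast
    from L1w_norm_zero_AE[OF L1w_diff(1)[OF lim(3)[OF T0] f02] this] show ?thesis by simp
  qed
  define D where "D = 4 * CW 0 * (1 + M) * M + CW 0 * (1 + 2 * M) * C"
  have deriv1: "((\<lambda>s. \<integral>v. f s v * \<psi> v \<partial>lborel) has_real_derivative W norm (f t) \<psi>) (at t within {0..T})"
    if \<psi>[measurable]: "\<psi> \<in> borel_measurable borel" and b: "\<And>v. \<bar>\<psi> v\<bar> \<le> 1" and t: "t \<in> {0..T}" for \<psi> t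
  proof -
    have b0: "\<bar>\<psi> v\<bar> \<le> jbr v powr 0" for v using b by simp
    have b4: "\<bar>\<psi> v\<bar> \<le> jbr v ^ 4" for v using b[of v] one_le_power[OF jbr_ge_1, of v 4] by linarith
    have unif: "\<bar>W (trunc (8 ^ j)) (F j s) \<psi> - W norm (f s) \<psi>\<bar> \<le> D * (1/2) ^ j" if s: "s \<in> {0..T}" for j s
    proof -
      have n: "L1w_norm p (F j s) \<le> M" "L1w_norm p (f s) \<le> M" if "p \<le> 3" for p
        using L1w_mono(2)[OF LF[OF s] that, of j] m3[OF s, of j] L1w_mono(2)[OF f3(1)[OF s] that] f3(2)[OF s] by auto
      have "\<bar>W norm (F j s) \<psi> - W (trunc (8 ^ j)) (F j s) \<psi>\<bar> \<le> 4 / 8 ^ j * CW 0 * (1 + L1w_norm (0 + 2) (F j s)) * L1w_norm (0 + 2) (F j s)"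
        using LF[OF s] by (intro W_kernel_diff_le admissible_norm trunc_admissible trunc_diff_le(2)[OF _ order_refl] \<psi> b0) auto
      also have "\<dots> \<le> 4 / 8 ^ j * CW 0 * (1 + M) * M"
        using n[of 2] M0 CW_nonneg[of 0] by (intro mult_mono mult_left_mono) (auto simp: L1w_norm_nonneg)
      also have "\<dots> \<le> 4 * CW 0 * (1 + M) * M * (1/2) ^ j"
      proof -
        have "(1/8) ^ j \<le> (1/2::real) ^ j" by (rule power_mono) auto
        then have "(4 * CW 0 * (1 + M) * M) * (1/8) ^ j \<le> (4 * CW 0 * (1 + M) * M) * (1/2) ^ j"
          using M0 CW_nonneg[of 0] by (intro mult_left_mono) auto
        then show ?thesis by (simp add: power_divide)
      qed
      finally have 1: "\<bar>W norm (F j s) \<psi> - W (trunc (8 ^ j)) (F j s) \<psi>\<bar> \<le> 4 * CW 0 * (1 + M) * M * (1/2) ^ j" .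
      have "\<bar>W norm (F j s) \<psi> - W norm (f s) \<psi>\<bar> \<le> CW 0 * (1 + L1w_norm (0 + 1) (F j s) + L1w_norm (0 + 1) (f s)) * L1w_norm (0 + 1) (\<lambda>v. F j s v - f s v)"
        using LF[OF s] L1w_mono(1)[OF f3(1)[OF s]] by (intro W_diff_le admissible_norm \<psi> b0) auto
      also have "\<dots> \<le> CW 0 * (1 + 2 * M) * (C * (1/2) ^ j)"
      proof (intro mult_mono)
        have "L1w_norm (0 + 1) (\<lambda>v. F j s v - f s v) \<le> L1w_norm 2 (\<lambda>v. F j s v - f s v)"
          using LF[OF s, of 2 j] lim(3)[OF s] by (intro L1w_mono(2) L1w_diff) auto
        also have "\<dots> \<le> C * (1/2) ^ j"
          using lim(4)[OF s, of j] by (simp only: L1w_norm_minus_commute[of 2 "F j s" "f s"])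
        finally show "L1w_norm (0 + 1) (\<lambda>v. F j s v - f s v) \<le> C * (1/2) ^ j" .
      qed (use n[of 1] M0 CW_nonneg[of 0] in \<open>auto simp: L1w_norm_nonneg\<close>)
      finally have 2: "\<bar>W norm (F j s) \<psi> - W norm (f s) \<psi>\<bar> \<le> CW 0 * (1 + 2 * M) * C * (1/2) ^ j" by simp
      have "\<bar>W (trunc (8 ^ j)) (F j s) \<psi> - W norm (f s) \<psi>\<bar> \<le> 4 * CW 0 * (1 + M) * M * (1/2) ^ j + CW 0 * (1 + 2 * M) * C * (1/2) ^ j"
        using 1 2 by linarith
      then show ?thesis by (simp add: D_def distrib_right)
    qed
    have limI: "(\<lambda>j. \<integral>v. F j s v * \<psi> v \<partial>lborel) \<longlonglongrightarrow> (\<integral>v. f s v * \<psi> v \<partial>lborel)" if s: "s \<in> {0..T}" for s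
    proof -
      have b2: "\<bar>\<psi> v\<bar> \<le> 1 * jbr v powr 2" for v using b[of v] jbr_powr_ge_1[of 2 v] by linarith
      have "\<bar>(\<integral>v. F j s v * \<psi> v \<partial>lborel) - (\<integral>v. f s v * \<psi> v \<partial>lborel)\<bar> \<le> C * (1/2) ^ j" for j
      proof -
        have L2: "L1w 2 (F j s)" using LF[OF s] by simp
        have "(\<integral>v. F j s v * \<psi> v \<partial>lborel) - (\<integral>v. f s v * \<psi> v \<partial>lborel) = (\<integral>v. (F j s v - f s v) * \<psi> v \<partial>lborel)"
          using integrable_bound_L1w(1)[OF L2 \<psi> b2] integrable_bound_L1w(1)[OF lim(3)[OF s] \<psi> b2]
          by (subst Bochner_Integration.integral_diff[symmetric]) (auto simp: algebra_simps)
        moreover have "\<bar>\<integral>v. (F j s v - f s v) * \<psi> v \<partial>lborel\<bar> \<le> 1 * L1w_norm 2 (\<lambda>v. F j s v - f s v)"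
          by (rule integrable_bound_L1w(2)[OF L1w_diff(1)[OF L2 lim(3)[OF s]] \<psi> b2])
        moreover have "L1w_norm 2 (\<lambda>v. F j s v - f s v) \<le> C * (1/2) ^ j"
          using lim(4)[OF s, of j] by (simp only: L1w_norm_minus_commute[of 2 "F j s" "f s"])
        ultimately show ?thesis by simp
      qed
      then have "(\<lambda>j. (\<integral>v. F j s v * \<psi> v \<partial>lborel) - (\<integral>v. f s v * \<psi> v \<partial>lborel)) \<longlonglongrightarrow> 0"
        by (intro Lim_null_comparison[OF _ half0[of C]] always_eventually allI) simp
      then show ?thesis by (simp only: LIM_zero_iff)
    qed
    \<comment> \<open>Limit and derivative are exchanged: by \<open>unif\<close> the derivatives
      converge uniformly in time, and the pairings themselves converge.\<close>
    have "\<exists>g. \<forall>x\<in>{0..T}. (\<lambda>j. \<integral>v. F j x v * \<psi> v \<partial>lborel) \<longlonglongrightarrow> g x \<and> (g has_derivative (*) (W norm (f x) \<psi>)) (at x within {0..T})"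
    proof (rule has_derivative_sequence[where f' = "\<lambda>j x. (*) (W (trunc (8 ^ j)) (F j x) \<psi>)"])
      show "convex {0..T}" by simp
      show "((\<lambda>s. \<integral>v. F j s v * \<psi> v \<partial>lborel) has_derivative (*) (W (trunc (8 ^ j)) (F j x) \<psi>)) (at x within {0..T})"
        if "x \<in> {0..T}" for j x
        using truncated_evolutionD(3)[OF F that \<psi> b4] by (simp add: has_field_derivative_def)
      show "\<forall>\<^sub>F j in sequentially. \<forall>x\<in>{0..T}. \<forall>h. norm (W (trunc (8 ^ j)) (F j x) \<psi> * h - W norm (f x) \<psi> * h) \<le> e * norm h"
        if e: "0 < e" for e
      proof -
        have "\<forall>\<^sub>F j in sequentially. D * (1/2) ^ j < e" using order_tendstoD(2)[OF half0[of D] e] .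
        then show ?thesis
        proof eventually_elim
          case (elim j)
          show ?case
          proof (intro ballI allI)
            fix x h assume x: "x \<in> {0..T}"
            have "norm (W (trunc (8 ^ j)) (F j x) \<psi> * h - W norm (f x) \<psi> * h) = \<bar>W (trunc (8 ^ j)) (F j x) \<psi> - W norm (f x) \<psi>\<bar> * \<bar>h\<bar>"
              by (simp add: abs_mult left_diff_distrib[symmetric])
            also have "\<dots> \<le> e * \<bar>h\<bar>" using unif[OF x, of j] elim by (intro mult_right_mono) auto
            finally show "norm (W (trunc (8 ^ j)) (F j x) \<psi> * h - W norm (f x) \<psi> * h) \<le> e * norm h" by simp
          qed
        qed
      qed
      show "t \<in> {0..T}" by fact
      show "(\<lambda>j. \<integral>v. F j t v * \<psi> v \<partial>lborel) \<longlonglongrightarrow> (\<integral>v. f t v * \<psi> v \<partial>lborel)" by (rule limI[OF t])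
    qed
    then obtain g where g: "\<And>x. x \<in> {0..T} \<Longrightarrow> (\<lambda>j. \<integral>v. F j x v * \<psi> v \<partial>lborel) \<longlonglongrightarrow> g x"
      "\<And>x. x \<in> {0..T} \<Longrightarrow> (g has_real_derivative W norm (f x) \<psi>) (at x within {0..T})"
      unfolding has_field_derivative_def by blast
    show ?thesis
      by (rule has_field_derivative_transform_within[OF g(2)[OF t] zero_less_one t]) (rule LIMSEQ_unique[OF g(1) limI])
  qed
  have "evolution T M f"
    unfolding evolution_def
  proof (intro conjI ballI allI impI)
    fix \<psi> t assume \<psi>: "test_fun \<psi>" and t: "t \<in> {0..T}"
    obtain K where K: "0 < K" "\<And>v. \<bar>\<psi> v\<bar> \<le> K" using test_fun_bounded(2)[OF \<psi>] by blast
    note [measurable] = test_fun_bounded(1)[OF \<psi>]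
    define \<phi> where "\<phi> = (\<lambda>v. \<psi> v / K)"
    have \<phi>m[measurable]: "\<phi> \<in> borel_measurable borel" unfolding \<phi>_def by measurable
    have \<phi>b: "\<bar>\<phi> v\<bar> \<le> 1" for v using K by (simp add: \<phi>_def)
    \<comment> \<open>Rescaling to the bound 1 of \<open>deriv1\<close>; the summand with
      coefficient 0 only fits the shape of \<open>W_linear_test\<close>.\<close>
    have eq: "\<psi> = (\<lambda>v. K * \<phi> v + 0 * \<phi> v)" using K by (auto simp: \<phi>_def)
    have \<phi>b': "\<bar>\<phi> v\<bar> \<le> 1 * jbr v powr 0" for v using \<phi>b by simp
    have f1: "L1w (0 + 1) (f t)" using L1w_mono(1)[OF f3(1)[OF t]] by simp
    have "((\<lambda>s. K * (\<integral>v. f s v * \<phi> v \<partial>lborel)) has_real_derivative K * W norm (f t) \<phi>) (at t within {0..T})"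
      by (intro DERIV_cmult deriv1 \<phi>m \<phi>b t)
    moreover have "W norm (f t) \<psi> = K * W norm (f t) \<phi>"
      unfolding eq using W_linear_test[OF admissible_norm _ _ \<phi>m \<phi>b' \<phi>m \<phi>b' f1, of K 0] by simp
    moreover have "(\<lambda>s. K * (\<integral>v. f s v * \<phi> v \<partial>lborel)) = (\<lambda>s. \<integral>v. f s v * \<psi> v \<partial>lborel)"
      using K(1) by (simp add: \<phi>_def)
    ultimately show "((\<lambda>s. \<integral>v. f s v * \<psi> v \<partial>lborel) has_real_derivative W norm (f t) \<psi>) (at t within {0..T})" by simp
  qed (use f3 cont in auto)
  with f_nonneg init show ?thesis by blast
qed

end

subsection \<open>Enlarging the class of test functions\<close>

text \<open>Measurable functions are almost everywhere limits of continuous ones; clamping and a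
  compactly supported cutoff preserve the weighted bound.\<close>

lemma test_fun_approximation:
  fixes \<psi> :: "vel \<Rightarrow> real"
  assumes \<psi>: "\<psi> \<in> borel_measurable borel" and b: "\<And>v. \<bar>\<psi> v\<bar> \<le> jbr v powr p"
  shows "\<exists>\<psi>n. (\<forall>n. test_fun (\<psi>n n)) \<and> (\<forall>n v. \<bar>\<psi>n n v\<bar> \<le> jbr v powr p) \<and> (AE v in lborel. (\<lambda>n. \<psi>n n v) \<longlonglongrightarrow> \<psi> v)"
proof -
  have "\<psi> \<in> borel_measurable lebesgue" using \<psi> by (intro measurable_completion) simp
  then have "\<psi> measurable_on UNIV"
    by (simp add: measurable_on_iff_borel_measurable)
  then obtain N g where N: "negligible N" and g: "\<And>n. continuous_on UNIV (g n)" "\<And>v. v \<notin> N \<Longrightarrow> (\<lambda>n. g n v) \<longlonglongrightarrow> \<psi> v"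
    by (auto simp: measurable_on_def)
  define cut where "cut = (\<lambda>n v. max 0 (min 1 (real n - norm (v::vel))))"
  define \<psi>n where "\<psi>n = (\<lambda>n v. cut n v * max (- (jbr v powr p)) (min (jbr v powr p) (g n v)))"
  have cj: "continuous_on UNIV (\<lambda>v. jbr v powr p)"
    by (intro continuous_on_powr continuous_on_jbr continuous_on_const) auto
  have cut: "0 \<le> cut n v" "cut n v \<le> 1" for n v by (auto simp: cut_def)
  have "test_fun (\<psi>n n)" for n
    unfolding test_fun_def
  proof
    show "continuous_on UNIV (\<psi>n n)"
      unfolding \<psi>n_def cut_def by (intro continuous_intros cj g(1))
    have "{v. \<psi>n n v \<noteq> 0} \<subseteq> cball 0 (real n)" by (auto simp: \<psi>n_def cut_def)
    then show "bounded {v. \<psi>n n v \<noteq> 0}" by (rule bounded_subset[OF bounded_cball])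
  qed
  moreover have "\<bar>\<psi>n n v\<bar> \<le> jbr v powr p" for n v
  proof -
    have "\<bar>\<psi>n n v\<bar> = cut n v * \<bar>max (- (jbr v powr p)) (min (jbr v powr p) (g n v))\<bar>"
      using cut by (simp add: \<psi>n_def abs_mult)
    also have "\<dots> \<le> 1 * (jbr v powr p)"
      using cut[of n v] by (intro mult_mono) (auto simp: abs_le_iff min_def max_def)
    finally show ?thesis by simp
  qed
  moreover have "AE v in lborel. (\<lambda>n. \<psi>n n v) \<longlonglongrightarrow> \<psi> v"
  proof -
    have "AE v in lebesgue. v \<notin> N" using N by (simp add: negligible_iff_null_sets AE_not_in)
    then have "AE v in lborel. v \<notin> N" by (simp add: AE_completion_iff)
    then show ?thesis
    proof eventually_elim
      case (elim v)
      have "(\<lambda>n. \<psi>n n v) \<longlonglongrightarrow> 1 * max (- (jbr v powr p)) (min (jbr v powr p) (\<psi> v))"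
        unfolding \<psi>n_def
      proof (intro tendsto_intros g(2) elim)
        obtain m where m: "1 + norm v \<le> real m" using real_arch_simple by blast
        have "eventually (\<lambda>n. cut n v = 1) sequentially"
          unfolding eventually_sequentially
        proof (intro exI allI impI)
          fix n assume "m \<le> n"
          then have "1 + norm v \<le> real n" using m by (meson of_nat_mono order_trans)
          then show "cut n v = 1" by (auto simp: cut_def min_def max_def)
        qed
        then show "(\<lambda>n. cut n v) \<longlonglongrightarrow> 1" by (rule tendsto_eventually)
      qed
      moreover have "1 * max (- (jbr v powr p)) (min (jbr v powr p) (\<psi> v)) = \<psi> v"
        using b[of v] by (simp add: abs_le_iff min_absorb2 max_absorb2)
      ultimately show ?case by (simp only:)
    qed
  qed
  ultimately show ?thesis by blast
qed

text \<open>Split at \<open>jbr v = R\<close>: below, the weight is at most the third, of which one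
  power is bounded by \<open>R\<close>; above, the deficit of \<open>2 - p\<close> powers against
  the third weight is a negative power of \<open>R\<close>.\<close>

lemma L1w_interpolation:
  assumes h: "L1w 3 h" and p: "p < 2" and R: "1 \<le> R"
  shows "L1w_norm (p + 1) h \<le> R * L1w_norm 2 h + R powr (p - 2) * L1w_norm 3 h"
proof -
  have h2: "L1w 2 h" "L1w (p + 1) h" using L1w_mono(1)[OF h] p by auto
  have le: "jbr v powr (p + 1) \<le> R * jbr v powr 2 + R powr (p - 2) * jbr v powr 3" for v
  proof (cases "jbr v \<le> R")
    case True
    have "jbr v powr (p + 1) \<le> jbr v powr 3" using p by (intro jbr_powr_mono) auto
    also have "\<dots> = jbr v * jbr v powr 2" by (simp add: power2_eq_square power3_eq_cube)
    also have "\<dots> \<le> R * jbr v powr 2" using True by (intro mult_right_mono) auto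
    finally show ?thesis by (simp add: add_increasing2)
  next
    case False
    have "jbr v powr (p + 1) = jbr v powr (p - 2) * jbr v powr 3" unfolding powr_add[symmetric] by (simp add: algebra_simps)
    also have "\<dots> \<le> R powr (p - 2) * jbr v powr 3"
      using False p R by (intro mult_right_mono powr_mono2') auto
    finally show ?thesis using R by (simp add: add_increasing)
  qed
  have "L1w_norm (p + 1) h \<le> (\<integral>v. R * (\<bar>h v\<bar> * jbr v powr 2) + R powr (p - 2) * (\<bar>h v\<bar> * jbr v powr 3) \<partial>lborel)"
    unfolding L1w_norm_def
  proof (rule integral_mono[OF L1wD(2)[OF h2(2)]])
    show "\<bar>h v\<bar> * jbr v powr (p + 1) \<le> R * (\<bar>h v\<bar> * jbr v powr 2) + R powr (p - 2) * (\<bar>h v\<bar> * jbr v powr 3)" for v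
      using mult_left_mono[OF le[of v], of "\<bar>h v\<bar>"] by (simp add: algebra_simps)
  qed (use L1wD(2)[OF h2(1)] L1wD(2)[OF h] in auto)
  also have "\<dots> = R * L1w_norm 2 h + R powr (p - 2) * L1w_norm 3 h"
    using L1wD(2)[OF h2(1)] L1wD(2)[OF h] by (simp add: L1w_norm_def)
  finally show ?thesis .
qed

context granular
begin

lemma evolutionD:
  assumes "evolution T M f" "t \<in> {0..T}"
  shows "L1w 3 (f t)" "L1w_norm 3 (f t) \<le> M"
    "((\<lambda>s. L1w_norm 2 (\<lambda>v. f s v - f t v)) \<longlongrightarrow> 0) (at t within {0..T})"
    "test_fun \<psi> \<Longrightarrow> ((\<lambda>s. \<integral>v. f s v * \<psi> v \<partial>lborel) has_real_derivative W norm (f t) \<psi>) (at t within {0..T})"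
  using assms by (auto simp: evolution_def)

lemma evolution_L1w: "evolution T M f \<Longrightarrow> t \<in> {0..T} \<Longrightarrow> p \<le> 3 \<Longrightarrow> L1w p (f t)"
  using evolutionD(1) L1w_mono(1) by blast

text \<open>\<open>R\<close> is chosen for the tail, which is uniformly small by the third-moment
  bound, before continuity in weight 2 fixes \<open>d\<close>. The order matters because the bulk
  term is multiplied by \<open>R\<close>.\<close>

lemma evolution_continuous:
  assumes f: "evolution T M f" and t: "t \<in> {0..T}" and p: "p < 2" and e: "0 < e"
  shows "\<exists>d>0. \<forall>r\<in>{0..T}. \<bar>r - t\<bar> < d \<longrightarrow> L1w_norm (p + 1) (\<lambda>v. f r v - f t v) < e"
proof -
  have M0: "0 \<le> M" using evolutionD(2)[OF f t] L1w_norm_nonneg[of 3 "f t"] by linarith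
  have "((\<lambda>R. R powr (p - 2) * (2 * M)) \<longlongrightarrow> 0 * (2 * M)) at_top"
  proof (rule tendsto_mult[OF _ tendsto_const])
    show "((\<lambda>R. R powr (p - 2)) \<longlongrightarrow> 0) at_top"
      by (rule tendsto_neg_powr[OF _ filterlim_ident]) (use p in simp)
  qed
  then have "eventually (\<lambda>R. R powr (p - 2) * (2 * M) < e / 2) at_top"
    by (rule order_tendstoD) (use e in auto)
  then have "eventually (\<lambda>R. 1 \<le> R \<and> R powr (p - 2) * (2 * M) < e / 2) at_top"
    using eventually_ge_at_top[of "1::real"] by eventually_elim auto
  then obtain R where R: "1 \<le> R" "R powr (p - 2) * (2 * M) < e / 2"
    unfolding eventually_at_top_linorder by blast
  have "eventually (\<lambda>r. L1w_norm 2 (\<lambda>v. f r v - f t v) < e / (2 * R)) (at t within {0..T})"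
    using evolutionD(3)[OF f t] by (rule order_tendstoD) (use e R in auto)
  then obtain d where d: "0 < d" "\<And>r. r \<in> {0..T} \<Longrightarrow> r \<noteq> t \<Longrightarrow> dist r t < d \<Longrightarrow> L1w_norm 2 (\<lambda>v. f r v - f t v) < e / (2 * R)"
    by (auto simp: eventually_at)
  have "L1w_norm (p + 1) (\<lambda>v. f r v - f t v) < e" if r: "r \<in> {0..T}" "\<bar>r - t\<bar> < d" for r
  proof (cases "r = t")
    case False
    note h = L1w_diff[OF evolutionD(1)[OF f r(1)] evolutionD(1)[OF f t]]
    have "L1w_norm (p + 1) (\<lambda>v. f r v - f t v) \<le> R * L1w_norm 2 (\<lambda>v. f r v - f t v) + R powr (p - 2) * L1w_norm 3 (\<lambda>v. f r v - f t v)"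
      by (rule L1w_interpolation[OF h(1) p R(1)])
    moreover have "R * L1w_norm 2 (\<lambda>v. f r v - f t v) < e / 2"
    proof -
      have "L1w_norm 2 (\<lambda>v. f r v - f t v) < e / (2 * R)" using False r by (intro d) (auto simp: dist_real_def)
      then show ?thesis using R by (simp add: field_simps)
    qed
    moreover have "R powr (p - 2) * L1w_norm 3 (\<lambda>v. f r v - f t v) \<le> R powr (p - 2) * (2 * M)"
      using h(2) evolutionD(2)[OF f r(1)] evolutionD(2)[OF f t] by (intro mult_left_mono) auto
    ultimately show ?thesis using R(2) by linarith
  qed (use e in simp)
  with d(1) show ?thesis by blast
qed

text \<open>The equation is known for compactly supported continuous observables, whose pairings
  converge only pointwise in time here. The difference quotients are nevertheless controlled
  uniformly in \<open>n\<close>, since the modulus of continuity of the right-hand side depends on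
  \<psi> through its weight alone.\<close>

lemma evolution_derivative:
  assumes f: "evolution T M f" and t: "t \<in> {0..T}" and p: "0 \<le> p" "p < 2"
    and \<psi>: "\<psi> \<in> borel_measurable borel" "\<And>v. \<bar>\<psi> v\<bar> \<le> jbr v powr p"
  shows "((\<lambda>s. \<integral>v. f s v * \<psi> v \<partial>lborel) has_real_derivative W norm (f t) \<psi>) (at t within {0..T})"
proof -
  have M0: "0 \<le> M" using evolutionD(2)[OF f t] L1w_norm_nonneg[of 3 "f t"] by linarith
  obtain \<psi>n where \<psi>n: "\<And>n. test_fun (\<psi>n n)" "\<And>n v. \<bar>\<psi>n n v\<bar> \<le> jbr v powr p"
    "AE v in lborel. (\<lambda>n. \<psi>n n v) \<longlonglongrightarrow> \<psi> v"
    using test_fun_approximation[OF \<psi>] by blast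
  note \<psi>nm = test_fun_bounded(1)[OF \<psi>n(1)]
  note [measurable] = \<psi>(1) \<psi>nm
  have Lp1: "L1w (p + 1) (f r)" if "r \<in> {0..T}" for r using evolution_L1w[OF f that] p by simp
  have Lp: "L1w p (f r)" if "r \<in> {0..T}" for r using evolution_L1w[OF f that] p by simp
  define B where "B = CW p * (1 + 2 * M)"
  have B0: "0 \<le> B" using CW_nonneg M0 by (simp add: B_def)
  have Wn: "(\<lambda>n. W norm (f t) (\<psi>n n)) \<longlonglongrightarrow> W norm (f t) \<psi>"
    by (rule W_tendsto[OF admissible_norm p(1) _ \<psi> \<psi>nm \<psi>n(2,3) Lp1[OF t]]) (use p in simp)
  have In: "(\<lambda>n. \<integral>v. f s v * \<psi>n n v \<partial>lborel) \<longlonglongrightarrow> (\<integral>v. f s v * \<psi> v \<partial>lborel)" if s: "s \<in> {0..T}" for s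
  proof (rule integral_dominated_convergence)
    note [measurable] = L1wD(1)[OF Lp[OF s]]
    show "(\<lambda>v. f s v * \<psi> v) \<in> borel_measurable lborel" "\<And>n. (\<lambda>v. f s v * \<psi>n n v) \<in> borel_measurable lborel" by measurable
    show "integrable lborel (\<lambda>v. \<bar>f s v\<bar> * jbr v powr p)" by (rule L1wD(2)[OF Lp[OF s]])
    show "AE v in lborel. (\<lambda>n. f s v * \<psi>n n v) \<longlonglongrightarrow> f s v * \<psi> v"
      using \<psi>n(3) by eventually_elim (intro tendsto_intros)
    show "AE v in lborel. norm (f s v * \<psi>n n v) \<le> \<bar>f s v\<bar> * jbr v powr p" for n
      using \<psi>n(2) by (intro AE_I2) (auto simp: abs_mult intro!: mult_left_mono)
  qed
  show ?thesis
    unfolding has_field_derivative_def has_derivative_within_alt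
  proof (intro conjI allI impI)
    show "bounded_linear ((*) (W norm (f t) \<psi>))" by (rule bounded_linear_mult_right)
    fix e :: real assume e: "0 < e"
    \<comment> \<open>The added 1 covers the case \<open>B = 0\<close>.\<close>
    define e' where "e' = e / (B + 1)"
    have e': "0 < e'" using e B0 by (simp add: e'_def)
    obtain d where d: "0 < d" "\<And>r. r \<in> {0..T} \<Longrightarrow> \<bar>r - t\<bar> < d \<Longrightarrow> L1w_norm (p + 1) (\<lambda>v. f r v - f t v) < e'"
      using evolution_continuous[OF f t p(2) e'] by blast
    have "norm ((\<integral>v. f s v * \<psi> v \<partial>lborel) - (\<integral>v. f t v * \<psi> v \<partial>lborel) - W norm (f t) \<psi> * (s - t)) \<le> e * norm (s - t)"
      if s: "s \<in> {0..T}" "norm (s - t) < d" for s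
    proof -
      \<comment> \<open>With the linear part at \<open>t\<close> subtracted, the derivative at
        \<open>r\<close> is the change of the right-hand side between \<open>t\<close> and
        \<open>r\<close>, which is small near \<open>t\<close>.\<close>
      have est: "norm (((\<integral>v. f s v * \<psi>n n v \<partial>lborel) - W norm (f t) (\<psi>n n) * s) - ((\<integral>v. f t v * \<psi>n n v \<partial>lborel) - W norm (f t) (\<psi>n n) * t))
        \<le> (B * e') * norm (s - t)" for n
      proof (rule field_differentiable_bound[of "{0..T} \<inter> {t - d<..<t + d}"])
        show "convex ({0..T} \<inter> {t - d<..<t + d})" by (intro convex_Int) auto
        fix r assume r: "r \<in> {0..T} \<inter> {t - d<..<t + d}"
        have "((\<lambda>s. (\<integral>v. f s v * \<psi>n n v \<partial>lborel) - W norm (f t) (\<psi>n n) * s) has_real_derivative W norm (f r) (\<psi>n n) - W norm (f t) (\<psi>n n) * 1) (at r within {0..T})"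
          using r by (intro DERIV_diff DERIV_cmult DERIV_ident evolutionD(4)[OF f _ \<psi>n(1)]) auto
        then show "((\<lambda>s. (\<integral>v. f s v * \<psi>n n v \<partial>lborel) - W norm (f t) (\<psi>n n) * s) has_real_derivative W norm (f r) (\<psi>n n) - W norm (f t) (\<psi>n n)) (at r within {0..T} \<inter> {t - d<..<t + d})"
          by (auto intro: DERIV_subset)
        have rT: "r \<in> {0..T}" "\<bar>r - t\<bar> < d" using r by auto
        have n3: "L1w_norm (p + 1) (f u) \<le> M" if "u \<in> {0..T}" for u
          using L1w_mono(2)[OF evolutionD(1)[OF f that], of "p + 1"] evolutionD(2)[OF f that] p by simp
        have "\<bar>W norm (f r) (\<psi>n n) - W norm (f t) (\<psi>n n)\<bar> \<le> CW p * (1 + L1w_norm (p + 1) (f r) + L1w_norm (p + 1) (f t)) * L1w_norm (p + 1) (\<lambda>v. f r v - f t v)"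
          using p by (intro W_diff_le admissible_norm \<psi>nm \<psi>n(2) Lp1 rT t) auto
        also have "\<dots> \<le> (CW p * (1 + 2 * M)) * e'"
          using n3[OF rT(1)] n3[OF t] d(2)[OF rT] CW_nonneg[of p] M0
          by (intro mult_mono mult_left_mono) (auto simp: L1w_norm_nonneg)
        finally show "norm (W norm (f r) (\<psi>n n) - W norm (f t) (\<psi>n n)) \<le> B * e'" by (simp add: B_def)
      qed (use s t d(1) in auto)
      have "(\<lambda>n. norm (((\<integral>v. f s v * \<psi>n n v \<partial>lborel) - W norm (f t) (\<psi>n n) * s) - ((\<integral>v. f t v * \<psi>n n v \<partial>lborel) - W norm (f t) (\<psi>n n) * t)))
        \<longlonglongrightarrow> norm (((\<integral>v. f s v * \<psi> v \<partial>lborel) - W norm (f t) \<psi> * s) - ((\<integral>v. f t v * \<psi> v \<partial>lborel) - W norm (f t) \<psi> * t))"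
        by (intro tendsto_intros In Wn s t)
      then have "norm (((\<integral>v. f s v * \<psi> v \<partial>lborel) - W norm (f t) \<psi> * s) - ((\<integral>v. f t v * \<psi> v \<partial>lborel) - W norm (f t) \<psi> * t)) \<le> (B * e') * norm (s - t)"
        by (rule LIMSEQ_le_const2) (intro exI allI impI est)
      also have "\<dots> \<le> e * norm (s - t)"
        using e B0 by (intro mult_right_mono) (auto simp: e'_def field_simps)
      finally show ?thesis by (simp add: algebra_simps)
    qed
    with d(1) show "\<exists>d>0. \<forall>y\<in>{0..T}. norm (y - t) < d \<longrightarrow>
      norm ((\<integral>v. f y v * \<psi> v \<partial>lborel) - (\<integral>v. f t v * \<psi> v \<partial>lborel) - W norm (f t) \<psi> * (y - t)) \<le> e * norm (y - t)" by blast
  qed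
qed

subsection \<open>Uniqueness\<close>

text \<open>For weights \<open>\<langle>v\<rangle>\<^sup>p\<close> with \<open>p < 2\<close> the Gronwall estimate has an error term of size
  \<open>2 powr (1 - p / 2) - 1\<close>, which disappears as \<open>p\<close> tends to \<open>2\<close>; the weight \<open>\<langle>v\<rangle>\<^sup>2\<close> itself
  would need continuity in time in \<open>L\<^sup>1\<close> with weight \<open>\<langle>v\<rangle>\<^sup>3\<close>.\<close>

lemma evolution_stability:
  assumes f: "evolution T M f" and f_nonneg: "\<And>t v. t \<in> {0..T} \<Longrightarrow> 0 \<le> f t v" and g: "evolution T M g"
    and init: "AE v in lborel. g 0 v = f 0 v" and p: "1 \<le> p" "p < 2" and t: "t \<in> {0..T}"
  shows "L1w_norm p (\<lambda>v. g t v - f t v) \<le> exp (CA M * t) * (4 * tau * M\<^sup>2 * (2 powr (1 - p / 2) - 1) * t)"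
proof -
  define h where "h = (\<lambda>t v. g t v - f t v)"
  define E where "E = 4 * tau * M\<^sup>2 * (2 powr (1 - p / 2) - 1)"
  have M0: "0 \<le> M" using evolutionD(2)[OF f t] L1w_norm_nonneg[of 3 "f t"] by linarith
  have "1 \<le> 2 powr (1 - p / 2)" using p by (intro ge_one_powr_ge_zero) auto
  then have E0: "0 \<le> E" using tau by (simp add: E_def)
  have Lh: "L1w q (h r)" if "r \<in> {0..T}" "q \<le> 3" for r q
    unfolding h_def by (intro L1w_diff evolution_L1w[OF f] evolution_L1w[OF g] that)
  have T0: "0 \<in> {0..T}" using t by auto
  have h0: "L1w_norm p (h 0) = 0"
    unfolding L1w_norm_def using init by (intro integral_eq_zero_AE) (auto simp: h_def)
  have cont: "continuous_on {0..T} (\<lambda>r. L1w_norm p (h r))"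
    unfolding continuous_on_def
  proof
    fix r assume r: "r \<in> {0..T}"
    have le: "\<bar>L1w_norm p (h s) - L1w_norm p (h r)\<bar> \<le> L1w_norm 2 (\<lambda>v. g s v - g r v) + L1w_norm 2 (\<lambda>v. f s v - f r v)" if s: "s \<in> {0..T}" for s
    proof -
      have z: "L1w p (\<lambda>v. 0)" by simp
      have L: "L1w p (h s)" "L1w p (h r)" using Lh[OF s] Lh[OF r] p by auto
      have "L1w_norm p (h r) \<le> L1w_norm p (\<lambda>v. h r v - h s v) + L1w_norm p (h s)"
        using L1w_norm_triangle[OF L(2,1) z] by simp
      moreover have "L1w_norm p (h s) \<le> L1w_norm p (\<lambda>v. h s v - h r v) + L1w_norm p (h r)"
        using L1w_norm_triangle[OF L z] by simp
      ultimately have "\<bar>L1w_norm p (h s) - L1w_norm p (h r)\<bar> \<le> L1w_norm p (\<lambda>v. h s v - h r v)"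
        using L1w_norm_minus_commute[of p "h s" "h r"] by linarith
      also have "\<dots> \<le> L1w_norm 2 (\<lambda>v. h s v - h r v)"
        using p Lh[OF s, of 2] Lh[OF r, of 2] by (intro L1w_mono(2) L1w_diff) auto
      also have "(\<lambda>v. h s v - h r v) = (\<lambda>v. (g s v - g r v) - (f s v - f r v))" by (auto simp: h_def)
      also have "L1w_norm 2 \<dots> \<le> L1w_norm 2 (\<lambda>v. g s v - g r v) + L1w_norm 2 (\<lambda>v. f s v - f r v)"
        by (intro L1w_diff(2) L1w_diff(1) evolution_L1w[OF f] evolution_L1w[OF g] s r) auto
      finally show ?thesis .
    qed
    have "((\<lambda>s. L1w_norm 2 (\<lambda>v. g s v - g r v) + L1w_norm 2 (\<lambda>v. f s v - f r v)) \<longlongrightarrow> 0 + 0) (at r within {0..T})"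
      by (intro tendsto_add evolutionD(3)[OF f r] evolutionD(3)[OF g r])
    then have "((\<lambda>s. L1w_norm 2 (\<lambda>v. g s v - g r v) + L1w_norm 2 (\<lambda>v. f s v - f r v)) \<longlongrightarrow> 0) (at r within {0..T})" by simp
    then have "((\<lambda>s. L1w_norm p (h s) - L1w_norm p (h r)) \<longlongrightarrow> 0) (at r within {0..T})"
    proof (rule Lim_null_comparison[rotated])
      show "eventually (\<lambda>s. norm (L1w_norm p (h s) - L1w_norm p (h r)) \<le> L1w_norm 2 (\<lambda>v. g s v - g r v) + L1w_norm 2 (\<lambda>v. f s v - f r v)) (at r within {0..T})"
        unfolding eventually_at by (rule exI[of _ 1]) (use le in auto)
    qed
    then show "((\<lambda>s. L1w_norm p (h s)) \<longlongrightarrow> L1w_norm p (h r)) (at r within {0..T})"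
      by (simp only: LIM_zero_iff)
  qed
  have "L1w_norm p (h t) \<le> exp (CA M * t) * (L1w_norm p (h 0) + E * t)"
  proof (rule dini_gronwall[OF cont CA_nonneg[OF M0] E0])
    fix t e :: real assume t: "0 < t" "t \<le> T" and e: "0 < e"
    then have tT: "t \<in> {0..T}" by auto
    define \<psi> where "\<psi> = (\<lambda>v. sgn (h t v) * jbr v powr p)"
    have [measurable]: "h t \<in> borel_measurable borel" using L1wD(1)[OF Lh[OF tT, of 0]] by simp
    have \<psi>m[measurable]: "\<psi> \<in> borel_measurable borel" unfolding \<psi>_def by measurable
    have b: "\<bar>\<psi> v\<bar> \<le> jbr v powr p" for v by (auto simp: \<psi>_def abs_mult abs_sgn_eq)
    have b': "\<bar>\<psi> v\<bar> \<le> 1 * jbr v powr p" for v using b by simp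
    have p0: "0 \<le> p" using p by simp
    define D where "D = W norm (g t) \<psi> - W norm (f t) \<psi>"
    have "((\<lambda>s. (\<integral>v. g s v * \<psi> v \<partial>lborel) - (\<integral>v. f s v * \<psi> v \<partial>lborel)) has_real_derivative D) (at t within {0..T})"
      unfolding D_def by (intro DERIV_diff evolution_derivative[OF f tT p0 p(2) \<psi>m b] evolution_derivative[OF g tT p0 p(2) \<psi>m b])
    from has_real_derivative_left_upper[OF this _ _ e] t
    obtain d where d: "0 < d" "\<And>s. 0 \<le> s \<Longrightarrow> s < t \<Longrightarrow> t - s < d \<Longrightarrow>
        ((\<integral>v. g t v * \<psi> v \<partial>lborel) - (\<integral>v. f t v * \<psi> v \<partial>lborel)) - ((\<integral>v. g s v * \<psi> v \<partial>lborel) - (\<integral>v. f s v * \<psi> v \<partial>lborel)) \<le> (t - s) * (D + e)"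
      by auto
    have split: "(\<integral>v. g s v * \<psi> v \<partial>lborel) - (\<integral>v. f s v * \<psi> v \<partial>lborel) = (\<integral>v. h s v * \<psi> v \<partial>lborel)" if "s \<in> {0..T}" for s
    proof -
      have "L1w p (g s)" "L1w p (f s)" using evolution_L1w[OF g that] evolution_L1w[OF f that] p by auto
      then show ?thesis
        using integrable_bound_L1w(1)[OF \<open>L1w p (g s)\<close> \<psi>m b'] integrable_bound_L1w(1)[OF \<open>L1w p (f s)\<close> \<psi>m b']
        by (subst Bochner_Integration.integral_diff[symmetric]) (auto simp: h_def algebra_simps)
    qed
    have D: "D \<le> CA M * L1w_norm p (h t) + E"
      unfolding D_def \<psi>_def h_def E_def
      using p evolutionD(1,2)[OF f tT] evolutionD(1,2)[OF g tT] f_nonneg[OF tT]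
      by (intro W_stability admissible_norm) auto
    have "L1w_norm p (h t) - L1w_norm p (h s) \<le> (t - s) * (CA M * L1w_norm p (h t) + E + e)"
      if s: "0 \<le> s" "s < t" "t - s < d" for s
    proof -
      have sT: "s \<in> {0..T}" using s t by auto
      have "L1w_norm p (h t) - L1w_norm p (h s) \<le> (\<integral>v. h t v * \<psi> v \<partial>lborel) - (\<integral>v. h s v * \<psi> v \<partial>lborel)"
        unfolding \<psi>_def using Lh[OF tT, of p] Lh[OF sT, of p] p by (intro L1w_norm_diff_le_sgn) auto
      also have "\<dots> \<le> (t - s) * (D + e)" using d(2)[OF s] unfolding split[OF tT] split[OF sT] .
      also have "\<dots> \<le> (t - s) * (CA M * L1w_norm p (h t) + E + e)"
        using D s by (intro mult_left_mono) auto
      finally show ?thesis .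
    qed
    with d(1) show "\<exists>d>0. \<forall>s. 0 \<le> s \<longrightarrow> s < t \<longrightarrow> t - s < d \<longrightarrow> L1w_norm p (h t) - L1w_norm p (h s) \<le> (t - s) * (CA M * L1w_norm p (h t) + E + e)"
      by blast
  qed (use t in auto)
  then show ?thesis by (simp add: h0 h_def[symmetric] E_def[symmetric]) (simp add: h_def)
qed

lemma evolution_unique:
  assumes f: "evolution T M f" and f_nonneg: "\<And>t v. t \<in> {0..T} \<Longrightarrow> 0 \<le> f t v" and g: "evolution T M g"
    and init: "AE v in lborel. g 0 v = f 0 v" and t: "t \<in> {0..T}"
  shows "AE v in lborel. g t v = f t v"
proof -
  let ?h = "\<lambda>v. g t v - f t v"
  have L3: "L1w 3 ?h" by (intro L1w_diff evolutionD(1)[OF f t] evolutionD(1)[OF g t])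
  define r where "r = (\<lambda>p::real. exp (CA M * t) * (4 * tau * M\<^sup>2 * (2 powr (1 - p / 2) - 1) * t))"
  have "(r \<longlongrightarrow> exp (CA M * t) * (4 * tau * M\<^sup>2 * (2 powr (1 - 2 / 2) - 1) * t)) (at_left 2)"
    unfolding r_def by (intro tendsto_intros) auto
  then have "(r \<longlongrightarrow> 0) (at_left 2)" by simp
  \<comment> \<open>Weight 0 lies below all weights \<open>p\<close>, so the left-hand side stays
    fixed while the bound tends to 0.\<close>
  moreover have "eventually (\<lambda>p. L1w_norm 0 ?h \<le> r p) (at_left 2)"
    unfolding eventually_at_left_field
  proof (intro exI[of _ 1] conjI allI impI)
    fix p :: real assume p: "1 < p" "p < 2"
    have "L1w_norm 0 ?h \<le> L1w_norm p ?h" using p L1w_mono(1)[OF L3, of p] by (intro L1w_mono(2)) auto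
    also have "\<dots> \<le> r p" unfolding r_def using p by (intro evolution_stability[OF f f_nonneg g init _ _ t]) auto
    finally show "L1w_norm 0 ?h \<le> r p" .
  qed simp
  ultimately have "L1w_norm 0 ?h \<le> 0"
    by (intro tendsto_lowerbound[where F = "at_left (2::real)"]) auto
  from L1w_norm_zero_AE[OF L1w_mono(1)[OF L3] this] show ?thesis by simp
qed

lemma evolution_mono: "evolution T M f \<Longrightarrow> M \<le> M' \<Longrightarrow> evolution T M' f"
  unfolding evolution_def by (meson order_trans)

lemma evolution_zero: "evolution T 0 (\<lambda>t v. 0)"
  by (simp add: evolution_def)

end

subsection \<open>Moments of the host distribution\<close>

lemma emeasure_ball_vel:
  assumes "0 \<le> r"
  shows "emeasure lborel (ball (0::vel) r) = ennreal (r ^ 3 * measure lborel (ball (0::vel) 1))"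
proof -
  have "emeasure lborel (ball (0::vel) r) = ennreal (measure lborel (ball (0::vel) r))"
    by (rule emeasure_eq_ennreal_measure) (use emeasure_lborel_ball_finite[of "0::vel" r] in auto)
  also have "measure lborel (ball (0::vel) r) = r ^ 3 * measure lborel (ball (0::vel) 1)"
    using content_ball_conv_unit_ball[OF assms, of "0::vel"] by simp
  finally show ?thesis .
qed

text \<open>Comparison with a series over balls: on \<open>n \<le> norm v < n + 1\<close> the
  integrand is at most 8 / (n + 1)^6, and the ball of radius n + 1 has volume of order (n + 1)^3,
  leaving the summable (n + 1)^(-3).\<close>

lemma integrable_jbr_inverse: "integrable lborel (\<lambda>v::vel. 1 / jbr v ^ 6)"
proof (rule integrableI_bounded)
  let ?V = "measure lborel (ball (0::vel) 1)"
  let ?g = "\<lambda>n v. ennreal (8 / real (Suc n) ^ 6) * indicator (ball 0 (real (Suc n))) (v::vel)"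
  have [measurable]: "ball (0::vel) r \<in> sets borel" for r by simp
  have term_le: "h n \<le> (\<Sum>i. h i)" for h :: "nat \<Rightarrow> ennreal" and n
    using sum_le_suminf[of h "{n}"] by simp
  have pt: "ennreal (norm (1 / jbr v ^ 6)) \<le> (\<Sum>n. ?g n v)" for v
  proof -
    define n where "n = nat \<lfloor>norm v\<rfloor>"
    have n: "real n \<le> norm v" "norm v < real (Suc n)" by (auto simp: n_def) linarith+
    have "(real n)\<^sup>2 \<le> (norm v)\<^sup>2" using n by (intro power_mono) auto
    \<comment> \<open>Equivalent to (n - 1)^2 \<ge> 0; the third power of the factor 2 is the 8
      above.\<close>
    moreover have "(real (Suc n))\<^sup>2 \<le> 2 * (1 + (real n)\<^sup>2)"
      using zero_le_power2[of "real n - 1"] by (simp add: power2_eq_square algebra_simps)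
    ultimately have "(real (Suc n))\<^sup>2 \<le> 2 * (jbr v)\<^sup>2" unfolding jbr_sq by (smt (verit))
    then have "((real (Suc n))\<^sup>2) ^ 3 \<le> (2 * (jbr v)\<^sup>2) ^ 3" by (intro power_mono) auto
    then have "real (Suc n) ^ 6 \<le> 8 * jbr v ^ 6" by (simp add: power_mult_distrib flip: power_mult del: of_nat_Suc)
    then have "1 / jbr v ^ 6 \<le> 8 / real (Suc n) ^ 6" by (simp add: field_simps del: of_nat_Suc)
    then have "ennreal (norm (1 / jbr v ^ 6)) \<le> ennreal (8 / real (Suc n) ^ 6)" by (intro ennreal_leI) simp
    also have "\<dots> = ?g n v" using n by (simp add: indicator_def)
    also have "\<dots> \<le> (\<Sum>i. ?g i v)"
      by (rule term_le)
    finally show ?thesis .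
  qed
  have "(\<integral>\<^sup>+v. ennreal (norm (1 / jbr v ^ 6)) \<partial>lborel) \<le> (\<integral>\<^sup>+v. (\<Sum>n. ?g n v) \<partial>lborel)"
    by (intro nn_integral_mono pt)
  also have "\<dots> = (\<Sum>n. \<integral>\<^sup>+v. ?g n v \<partial>lborel)"
    by (rule nn_integral_suminf) measurable
  also have "\<dots> = (\<Sum>n. ennreal (8 * ?V * inverse (real (Suc n) ^ 3)))"
  proof (rule suminf_cong)
    fix n
    have "(\<integral>\<^sup>+v. ?g n v \<partial>lborel) = ennreal (8 / real (Suc n) ^ 6) * ennreal (real (Suc n) ^ 3 * ?V)"
      by (subst nn_integral_cmult_indicator) (auto simp: emeasure_ball_vel simp del: of_nat_Suc)
    also have "\<dots> = ennreal (8 / real (Suc n) ^ 6 * (real (Suc n) ^ 3 * ?V))"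
      by (rule ennreal_mult[symmetric]) auto
    also have "8 / real (Suc n) ^ 6 * (real (Suc n) ^ 3 * ?V) = 8 * ?V * inverse (real (Suc n) ^ 3)"
    proof -
      have "real (Suc n) ^ 6 = real (Suc n) ^ 3 * real (Suc n) ^ 3" by (simp flip: power_add del: of_nat_Suc)
      then show ?thesis by (simp add: field_simps del: of_nat_Suc)
    qed
    finally show "(\<integral>\<^sup>+v. ?g n v \<partial>lborel) = ennreal (8 * ?V * inverse (real (Suc n) ^ 3))" .
  qed
  also have "\<dots> = ennreal (\<Sum>n. 8 * ?V * inverse (real (Suc n) ^ 3))"
  proof (rule suminf_ennreal_eq)
    have "summable (\<lambda>n. inverse (real n ^ 3))" by (rule inverse_power_summable) simp
    then have "summable (\<lambda>n. inverse (real (Suc n) ^ 3))" by (subst summable_Suc_iff)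
    then show "(\<lambda>n. 8 * ?V * inverse (real (Suc n) ^ 3)) sums (\<Sum>n. 8 * ?V * inverse (real (Suc n) ^ 3))"
      by (intro summable_sums summable_mult)
  qed auto
  finally show "(\<integral>\<^sup>+v. ennreal (norm (1 / jbr v ^ 6)) \<partial>lborel) < \<infinity>"
    by (rule le_less_trans) simp
qed measurable

text \<open>A product estimate: the weight 5 is written as 8 - 3, the square of \<open>F1\<close>
  with weight 8 is integrable by the instance s = 0, delta = 8 of the regularity assumption, and the
  weight -6 is integrable in dimension three.\<close>

lemma host_L1w:
  assumes "host_assumption F1"
  shows "L1w 5 F1"
proof -
  have "Hsw 0 8 F1" using assms unfolding host_assumption_def by auto
  then have L2: "L2w 8 F1" by (simp add: Hsw_def)
  have [measurable]: "F1 \<in> borel_measurable borel" using assms by (simp add: host_assumption_def)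
  have int: "integrable lborel (\<lambda>v. (F1 v)\<^sup>2 * jbr v ^ 16 + 1 / jbr v ^ 6)"
    using L2 integrable_jbr_inverse by (intro Bochner_Integration.integrable_add) (auto simp: L2w_def)
  have le: "\<bar>F1 v\<bar> * jbr v ^ 5 \<le> (F1 v)\<^sup>2 * jbr v ^ 16 + 1 / jbr v ^ 6" for v
  proof -
    define a b where "a = \<bar>F1 v\<bar> * jbr v ^ 8" and "b = 1 / jbr v ^ 3"
    have "2 * (a * b) \<le> a\<^sup>2 + b\<^sup>2" using sum_squares_bound[of a b] by (simp add: mult.assoc)
    moreover have "0 \<le> a * b" by (simp add: a_def b_def)
    ultimately have "a * b \<le> a\<^sup>2 + b\<^sup>2" by linarith
    moreover have "a * b = \<bar>F1 v\<bar> * jbr v ^ 5"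
      using power_diff[of "jbr v" 3 8] by (simp add: a_def b_def)
    moreover have "a\<^sup>2 = (F1 v)\<^sup>2 * jbr v ^ 16" "b\<^sup>2 = 1 / jbr v ^ 6"
      by (simp_all add: a_def b_def power_mult_distrib power_divide flip: power_mult)
    ultimately show ?thesis by simp
  qed
  have "integrable lborel (\<lambda>v. \<bar>F1 v\<bar> * jbr v powr 5)"
    by (rule Bochner_Integration.integrable_bound[OF int]) (use le in \<open>auto intro!: AE_I2 order_trans[OF _ abs_ge_self]\<close>)
  then show ?thesis by (simp add: L1w_def)
qed

subsection \<open>Well-posedness\<close>

lemma weak_solution_iff_evolution:
  fixes eps m1 e lam tau :: real
  assumes gr: "granular ((1 + eps) / 2) (2 * (m1 / (1 + m1)) * (1 - (1 - e) / 2)) tau lam F1"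
  shows "weak_solution eps m1 e lam tau F1 f0 T f \<longleftrightarrow>
    (\<exists>M. granular.evolution ((1 + eps) / 2) (2 * (m1 / (1 + m1)) * (1 - (1 - e) / 2)) tau lam F1 T M f)
    \<and> (AE v in lborel. f 0 v = f0 v)"
proof -
  interpret granular "(1 + eps) / 2" "2 * (m1 / (1 + m1)) * (1 - (1 - e) / 2)" tau lam F1 by (rule gr)
  have rhs: "weak_rhs eps m1 e lam tau F1 u \<psi> = W norm u \<psi>" if "L1w 3 u" "test_fun \<psi>" for u \<psi>
  proof -
    obtain C where C: "\<And>v. \<bar>\<psi> v\<bar> \<le> C" using test_fun_bounded(2)[OF \<open>test_fun \<psi>\<close>] by blast
    have "L1w 1 u" using L1w_mono(1)[OF \<open>L1w 3 u\<close>] by simp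
    from weak_form_eq_W[OF this test_fun_bounded(1)[OF \<open>test_fun \<psi>\<close>] C refl]
    show ?thesis unfolding weak_rhs_def J_op_def Let_def .
  qed
  show ?thesis
  proof
    assume w: "weak_solution eps m1 e lam tau F1 f0 T f"
    then obtain M where M: "\<forall>t\<in>{0..T}. L1w 3 (f t) \<and> L1w_norm 3 (f t) \<le> M"
      by (auto simp: weak_solution_def)
    have "evolution T M f"
      unfolding evolution_def using w M rhs by (auto simp: weak_solution_def)
    then show "(\<exists>M. evolution T M f) \<and> (AE v in lborel. f 0 v = f0 v)"
      using w by (auto simp: weak_solution_def)
  next
    assume "(\<exists>M. evolution T M f) \<and> (AE v in lborel. f 0 v = f0 v)"
    then obtain M where f: "evolution T M f" and init: "AE v in lborel. f 0 v = f0 v" by blast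
    show "weak_solution eps m1 e lam tau F1 f0 T f"
      unfolding weak_solution_def
    proof (intro conjI ballI allI impI)
      show "\<exists>M. \<forall>t\<in>{0..T}. L1w 3 (f t) \<and> L1w_norm 3 (f t) \<le> M"
        using evolutionD(1,2)[OF f] by blast
      show "L1w 2 (f t)" if "t \<in> {0..T}" for t using evolution_L1w[OF f that] by simp
      show "((\<lambda>s. L1w_norm 2 (\<lambda>v. f s v - f t v)) \<longlongrightarrow> 0) (at t within {0..T})" if "t \<in> {0..T}" for t
        by (rule evolutionD(3)[OF f that])
      show "((\<lambda>s. \<integral>v. f s v * \<psi> v \<partial>lborel) has_real_derivative weak_rhs eps m1 e lam tau F1 (f t) \<psi>) (at t within {0..T})"
        if "test_fun \<psi>" "t \<in> {0..T}" for \<psi> t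
        using evolutionD(4)[OF f that(2,1)] rhs[OF evolutionD(1)[OF f that(2)] that(1)] by simp
    qed (rule init)
  qed
qed

theorem mainTheorem4:
  fixes eps m1 e lam tau :: real
    and F1 f0 :: "vel \<Rightarrow> real"
  assumes eps: "0 < eps" "eps < 1"
    and m1: "0 < m1"
    and e: "0 < e" "e < 1"
    and lam: "0 < lam"
    and host: "host_assumption F1"
    and tau: "0 \<le> tau"
    and f0: "L1w 3 f0" "\<forall>v. 0 \<le> f0 v"
  shows "\<forall>T>0. \<exists>f. weak_solution eps m1 e lam tau F1 f0 T f
           \<and> (\<forall>g. weak_solution eps m1 e lam tau F1 f0 T g
                  \<longrightarrow> (\<forall>t\<in>{0..T}. AE v in lborel. g t v = f t v))"
proof (intro allI impI)
  fix T :: real assume T: "0 < T"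
  let ?z = "(1 + eps) / 2" and ?c = "2 * (m1 / (1 + m1)) * (1 - (1 - e) / 2)"
  have gr: "granular ?z ?c tau lam F1"
  proof
    have a: "0 < m1 / (1 + m1)" "m1 / (1 + m1) < 1" and b: "0 < 1 - (1 - e) / 2" "1 - (1 - e) / 2 < 1"
      using m1 e by auto
    then show "0 < ?c" by (intro mult_pos_pos) auto
    \<comment> \<open>Both alpha and 1 - beta are less than 1, which gives the strict bound that
      \<open>energy_star_le\<close> divides by.\<close>
    have "m1 / (1 + m1) * (1 - (1 - e) / 2) < 1 * 1"
      using a b by (intro mult_strict_mono) auto
    then show "?c < 2" by simp
  qed (use eps tau lam host host_L1w[OF host] in \<open>auto simp: host_assumption_def\<close>)
  interpret granular ?z ?c tau lam F1 by (rule gr)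
  note iff = weak_solution_iff_evolution[OF gr]
  obtain f M where f: "evolution T M f" "\<And>t v. t \<in> {0..T} \<Longrightarrow> 0 \<le> f t v" and init: "AE v in lborel. f 0 v = f0 v"
  proof (cases "0 < (\<integral>v. f0 v \<partial>lborel)")
    case True
    then show ?thesis using evolution_exists[OF f0(1) _ True T] f0(2) that by blast
  next
    \<comment> \<open>The Wild sum normalises by the mass, so zero mass is separate: the datum
      vanishes almost everywhere and the zero function is a solution.\<close>
    case False
    moreover have "0 \<le> (\<integral>v. f0 v \<partial>lborel)" using f0(2) by simp
    ultimately have 0: "(\<integral>v. f0 v \<partial>lborel) = 0" by linarith
    have "integrable lborel f0" using L1wD(2)[OF L1w_mono(1)[OF f0(1), of 0]] f0(2) by simp
    from integral_nonneg_eq_0_iff_AE[OF this] 0 f0(2) have "AE v in lborel. f0 v = 0" by simp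
    then have "AE v in lborel. (\<lambda>t v. 0) 0 v = f0 v" by eventually_elim simp
    then show ?thesis by (intro that[OF evolution_zero]) auto
  qed
  show "\<exists>f. weak_solution eps m1 e lam tau F1 f0 T f
      \<and> (\<forall>g. weak_solution eps m1 e lam tau F1 f0 T g \<longrightarrow> (\<forall>t\<in>{0..T}. AE v in lborel. g t v = f t v))"
  proof (intro exI[of _ f] conjI allI impI ballI)
    show "weak_solution eps m1 e lam tau F1 f0 T f" using iff f(1) init by blast
    fix g t assume g: "weak_solution eps m1 e lam tau F1 f0 T g" and t: "t \<in> {0..T}"
    obtain M' where M': "evolution T M' g" and init': "AE v in lborel. g 0 v = f0 v" using g iff by blast
    have "AE v in lborel. g 0 v = f 0 v" using init init' by eventually_elim simp
    \<comment> \<open>The uniqueness statement takes one third-moment bound for both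
      solutions.\<close>
    moreover have "evolution T (max M M') f" "evolution T (max M M') g"
      using evolution_mono[OF f(1)] evolution_mono[OF M'] by auto
    ultimately show "AE v in lborel. g t v = f t v"
      using evolution_unique[of T "max M M'" f g t] f(2) t by blast
  qed
qed

end
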